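(* Let $k_n:=\lfloor n/2\rfloor$. Suppose $\{\lambda^{(n)}\vdash n\}$, $\{\mu^{(n)}\vdash k_n\}$ and $\{\nu^{(n)}\vdash n-k_n\}$ are three partition sequences such that $$c^{\lambda^{(n)}}_{\mu^{(n)},\,\nu^{(n)}}\,=\,\binom{n}{k_n}^{1/2}e^{-O(n/\log n)}.$$ Then all three partition sequences satisfy $$f^{\lambda^{(n)}}=\sqrt{n!}\;e^{-O(n)},\qquad f^{\mu^{(n)}}=\sqrt{k_n!}\;e^{-O(n)}\qquad\text{and}\qquad f^{\nu^{(n)}}=\sqrt{(n-k_n)!}\;e^{-O(n)}.$$
   Context: For a partition $\lambda$, $f^\lambda$ denotes the dimension of the irreducible representation of the symmetric group indexed by $\lambda$ (the number of standard Young tableaux of shape $\lambda$). The Littlewood–Richardson coefficients $c^\lambda_{\mu,\nu}$ are defined by $s_\mu\cdot s_\nu=\sum_\lambda c^\lambda_{\mu,\nu}s_\lambda$, where $s_\lambda$ are Schur functions. The notation $X(n)=Y(n)\,e^{-O(h(n))}$ means that there is a constant $C>0$ with $Y(n)e^{-Ch(n)}\le X(n)\le Y(n)e^{Ch(n)}$ for all sufficiently large $n$. *)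

theory Defs
  imports Complex_Main "HOL-Library.FuncSet" "HOL-Library.Poly_Mapping"
begin

definition partition_of :: "nat list \<Rightarrow> nat \<Rightarrow> bool" (infix "\<turnstile>" 50) where
  "p \<turnstile> n \<longleftrightarrow> sorted_wrt (\<ge>) p \<and> 0 \<notin> set p \<and> sum_list p = n"

text \<open>Cells \<open>(row, column)\<close> of the Young diagram, indexed from 0.\<close>

definition diagram :: "nat list \<Rightarrow> (nat \<times> nat) set" where
  "diagram p = {(i, j). i < length p \<and> j < p ! i}"

text \<open>Tableaux are functions on the diagram, fixed to be \<open>undefined\<close> outside it, so
  that distinct functions are distinct tableaux.\<close>

definition ssyt :: "nat list \<Rightarrow> (nat \<times> nat \<Rightarrow> nat) set" where
  "ssyt p = {T \<in> extensional (diagram p).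
     (\<forall>i j j'. (i, j) \<in> diagram p \<longrightarrow> (i, j') \<in> diagram p \<longrightarrow> j < j' \<longrightarrow> T (i, j) \<le> T (i, j')) \<and>
     (\<forall>i i' j. (i, j) \<in> diagram p \<longrightarrow> (i', j) \<in> diagram p \<longrightarrow> i < i' \<longrightarrow> T (i, j) < T (i', j))}"

definition syt :: "nat list \<Rightarrow> (nat \<times> nat \<Rightarrow> nat) set" where
  "syt p = {T \<in> extensional (diagram p). bij_betw T (diagram p) {1..sum_list p} \<and>
     (\<forall>i j j'. (i, j) \<in> diagram p \<longrightarrow> (i, j') \<in> diagram p \<longrightarrow> j < j' \<longrightarrow> T (i, j) < T (i, j')) \<and>
     (\<forall>i i' j. (i, j) \<in> diagram p \<longrightarrow> (i', j) \<in> diagram p \<longrightarrow> i < i' \<longrightarrow> T (i, j) < T (i', j))}"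

definition num_syt :: "nat list \<Rightarrow> nat" where
  "num_syt p = card (syt p)"

text \<open>Formal power series over the integers in the variables \<open>x\<^sub>0, x\<^sub>1, x\<^sub>2, \<dots>\<close>, given by their
  coefficients. A monomial is its finitely supported exponent vector, so the sum in the
  product is finite.\<close>

type_synonym mseries = "(nat \<Rightarrow>\<^sub>0 nat) \<Rightarrow> int"

definition mseries_mult :: "mseries \<Rightarrow> mseries \<Rightarrow> mseries" where
  "mseries_mult F G a = (\<Sum>(b, c) | b + c = a. F b * G c)"

text \<open>The Schur function is the sum over semistandard tableaux \<open>T\<close> of the monomials
  \<open>\<Prod>c. x\<^bsub>T c\<^esub>\<close>. Entries are variable indices, hence start from 0.\<close>

definition schur :: "nat list \<Rightarrow> mseries" where
  "schur p a = int (card {T \<in> ssyt p. \<forall>i. card {c \<in> diagram p. T c = i} = Poly_Mapping.lookup a i})"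

text \<open>The coefficients of the (unique, finite) expansion of a product of two Schur functions
  in Schur functions: \<open>lr_coeff m v l\<close> is \<open>c\<^sup>l\<^bsub>m,v\<^esub>\<close>.\<close>

definition lr_coeff :: "nat list \<Rightarrow> nat list \<Rightarrow> nat list \<Rightarrow> int" where
  "lr_coeff m v = (THE c.
     finite {l. c l \<noteq> 0} \<and> (\<forall>l. c l \<noteq> 0 \<longrightarrow> (\<exists>n. l \<turnstile> n)) \<and>
     (\<forall>a. mseries_mult (schur m) (schur v) a = (\<Sum>l | c l \<noteq> 0. c l * schur l a)))"

text \<open>\<open>eq_up_to_exp X Y h\<close> is \<open>X(n) = Y(n) exp(-O(h(n)))\<close>, which here bounds \<open>X\<close> on both sides.\<close>

definition eq_up_to_exp :: "(nat \<Rightarrow> real) \<Rightarrow> (nat \<Rightarrow> real) \<Rightarrow> (nat \<Rightarrow> real) \<Rightarrow> bool" where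
  "eq_up_to_exp X Y h \<longleftrightarrow> (\<exists>C>0. \<forall>\<^sub>F n in sequentially.
     Y n * exp (- C * h n) \<le> X n \<and> X n \<le> Y n * exp (C * h n))"

end

theory Submission
  imports Defs "HOL-Combinatorics.Permutations" "HOL-Real_Asymp.Real_Asymp"
begin

text \<open>Write \<open>f(\<lambda>)\<close> for the number of standard tableaux. Restriction and induction between
  \<open>S\<^bsub>k+l\<^esub>\<close> and \<open>S\<^bsub>k\<^esub> \<times> S\<^bsub>l\<^esub>\<close> give \<open>c f(\<mu>) f(\<nu>) \<le> f(\<lambda>)\<close> and \<open>c f(\<lambda>) \<le> binom(n,k) f(\<mu>) f(\<nu>)\<close>
  for \<open>c = c(\<lambda>;\<mu>,\<nu>)\<close>. Hence \<open>c\<^sup>2 \<le> binom(n,k)\<close>, and if \<open>c\<close> is close to that bound, then the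
  defect \<open>a(\<lambda>) = ln (sqrt(n!) / f(\<lambda>))\<close> is close to \<open>a(\<mu>) + a(\<nu>)\<close>. Mackey's formula expresses
  \<open>\<Sum>\<lambda>. c(\<lambda>;\<mu>,\<nu>)\<^sup>2\<close> as a sum of subexponentially many products
  \<open>c(\<mu>;\<alpha>,\<beta>) c(\<nu>;\<gamma>,\<delta>) c(\<mu>;\<alpha>,\<gamma>) c(\<nu>;\<beta>,\<delta>)\<close>, so some pair of coefficients one level down is on the
  whole as close to maximal as \<open>c\<close> was. Iterating over about \<open>ln n\<close> levels of halving, a deficiency
  \<open>O(n / ln n)\<close> at each level adds up to \<open>a(\<lambda>) = O(n)\<close>.

  Nonnegativity of the coefficients comes from the Littlewood--Richardson rule in the form
  \<open>s\<^sub>\<mu> s\<^sub>\<nu> = \<Sum>T. s\<^bsub>\<mu> + wt T\<^esub>\<close>, proved by Stembridge's sign-reversing involution on alternants; the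
  coproduct, and with it Mackey's formula, comes from the expansion of products of complete
  homogeneous functions by Kostka numbers.\<close>

section \<open>Partitions\<close>

text \<open>Mackey's sum does not control the sizes of the four pieces, so a level need not halve
  anything. This is harmless: a coefficient is at most the square root of a binomial coefficient,
  and for a splitting more uneven than 1:3 this is exponentially below
  \<open>2 powr (n / 2)\<close>. The deficiency is then of order \<open>n\<close>, and its product
  with \<open>ln n\<close> dominates, up to a constant, the trivial bound
  \<open>n * ln n / 2\<close> on the defect. In a more even splitting \<open>ln\<close> drops by at
  least \<open>ln (4/3)\<close>; this drop, times the deficiency, pays for the deficiency charged at
  that level. The loss from the number of partitions may be paid at every node of the recursion, so
  it has to stay well below linear; a crude \<open>exp (O(sqrt n * ln n))\<close> for that number is
  enough.

  No representations occur. Coefficients are compared in finitely many variables, where the Schur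
  polynomials of partitions with at most as many parts are linearly independent. Restriction and
  induction are the coproduct and the product read at squarefree monomials, where Schur functions
  have the coefficient \<open>num_syt\<close>.\<close>

definition part :: "nat list \<Rightarrow> nat \<Rightarrow> nat" where
  "part p i = (if i < length p then p ! i else 0)"

lemma mem_diagram [simp]: "(i, j) \<in> diagram p \<longleftrightarrow> j < part p i"
  by (auto simp: diagram_def part_def)

lemma part_antimono:
  assumes "p \<turnstile> n" "i \<le> i'"
  shows "part p i' \<le> part p i"
proof -
  have "sorted_wrt (\<ge>) p" using assms by (simp add: partition_of_def)
  then show ?thesis using assms(2)
    using sorted_wrt_nth_less[of "(\<ge>)" p i i'] by (cases "i = i'") (auto simp: part_def)
qed

lemma part_beyond: "length p \<le> i \<Longrightarrow> part p i = 0"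
  by (simp add: part_def)

lemma part_pos: "p \<turnstile> n \<Longrightarrow> 0 < part p i \<longleftrightarrow> i < length p"
  by (auto simp: part_def partition_of_def) (metis gr0I nth_mem)

lemma sum_part: "length p \<le> L \<Longrightarrow> (\<Sum>i<L. part p i) = sum_list p"
proof -
  assume L: "length p \<le> L"
  have "(\<Sum>i<L. part p i) = (\<Sum>i<length p. part p i)"
    using L by (intro sum.mono_neutral_right) (auto simp: part_def)
  also have "\<dots> = sum_list p"
    by (simp add: part_def sum_list_sum_nth atLeast0LessThan)
  finally show ?thesis .
qed

lemma partition_sum_list: "p \<turnstile> n \<Longrightarrow> sum_list p = n"
  by (simp add: partition_of_def)

lemma sum_part_partition: "p \<turnstile> n \<Longrightarrow> length p \<le> L \<Longrightarrow> (\<Sum>i<L. part p i) = n"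
  by (simp add: sum_part partition_sum_list)

lemma partition_length_le: 
  assumes "p \<turnstile> n" shows "length p \<le> n"
proof -
  have "(\<Sum>i<length p. 1) \<le> (\<Sum>i<length p. part p i)"
    using part_pos[OF assms] by (intro sum_mono) (simp add: Suc_le_eq)
  then show ?thesis using sum_part_partition[OF assms order_refl] by simp
qed

lemma partition_eqI:
  assumes "p \<turnstile> n" "q \<turnstile> m" "part p = part q"
  shows "p = q"
proof -
  have "i < length p \<longleftrightarrow> i < length q" for i
    using part_pos[OF assms(1)] part_pos[OF assms(2)] assms(3) by metis
  then have len: "length p = length q" by (meson linorder_neqE_nat less_irrefl)
  show ?thesis
  proof (rule nth_equalityI[OF len])
    show "p ! i = q ! i" if "i < length p" for i
      using fun_cong[OF assms(3), of i] that len by (simp add: part_def)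
  qed
qed

lemma partition_exI:
  assumes anti: "\<And>i. g (Suc i) \<le> g i" and "g L = (0::nat)"
  obtains p where "p \<turnstile> (\<Sum>i<L. g i)" "part p = g"
proof -
  define l where "l = (LEAST i. g i = 0)"
  have gl: "g l = 0" and l: "\<And>i. g i = 0 \<Longrightarrow> l \<le> i"
    unfolding l_def using assms(2) by (auto intro: LeastI Least_le)
  have anti': "i \<le> j \<Longrightarrow> g j \<le> g i" for i j
    using anti by (rule lift_Suc_antimono_le)
  define p where "p = map g [0..<l]"
  have pp: "part p = g"
    using anti'[of l] gl by (auto simp: part_def p_def fun_eq_iff)
  have "0 \<notin> set p" by (auto simp: p_def dest!: sym[of 0] l)
  moreover have "sorted_wrt (\<ge>) p"
    by (auto simp: p_def sorted_wrt_iff_nth_less intro: anti')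
  moreover have "sum_list p = (\<Sum>i<L. g i)"
    using sum_part[of p L] pp l[OF assms(2)] by (simp add: p_def)
  ultimately show ?thesis using that pp by (simp add: partition_of_def)
qed

text \<open>One finite index set for all sizes at once: summands of the wrong size vanish, so sums
  need not track the degree.\<close>

definition partitions_upto :: "nat \<Rightarrow> nat list set" where
  "partitions_upto n = {p. \<exists>k\<le>n. p \<turnstile> k}"

lemma partitions_uptoI: "p \<turnstile> k \<Longrightarrow> k \<le> n \<Longrightarrow> p \<in> partitions_upto n"
  by (auto simp: partitions_upto_def)

lemma partitions_upto_mono: "k \<le> m \<Longrightarrow> partitions_upto k \<subseteq> partitions_upto m"
  by (auto simp: partitions_upto_def intro: order_trans)

lemma finite_partitions_upto [simp]: "finite (partitions_upto n)"
proof (rule finite_subset)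
  show "partitions_upto n \<subseteq> {xs. set xs \<subseteq> {..n} \<and> length xs \<le> n}"
  proof
    fix p assume "p \<in> partitions_upto n"
    then obtain k where k: "k \<le> n" "p \<turnstile> k" by (auto simp: partitions_upto_def)
    have "x \<le> sum_list p" if "x \<in> set p" for x
      using member_le_sum_list[of x p] that by simp
    then show "p \<in> {xs. set xs \<subseteq> {..n} \<and> length xs \<le> n}"
      using k partition_length_le[OF k(2)] partition_sum_list[OF k(2)] by fastforce
  qed
qed (rule finite_lists_length_le, simp)

section \<open>Gelfand--Tsetlin patterns\<close>

text \<open>\<open>r i m\<close> is the number of entries smaller than \<open>m\<close> in row \<open>i\<close> of a semistandard tableau
  with entries below \<open>N\<close>.\<close>

definition gt :: "nat \<Rightarrow> nat list \<Rightarrow> (nat \<Rightarrow> nat \<Rightarrow> nat) set" where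
  "gt N p = {r. (\<forall>i. r i 0 = 0) \<and> (\<forall>i m. N \<le> m \<longrightarrow> r i m = part p i) \<and>
     (\<forall>i m. r i m \<le> r i (Suc m)) \<and> (\<forall>i m. r (Suc i) (Suc m) \<le> r i m)}"

lemma gtD:
  assumes "r \<in> gt N p"
  shows "r i 0 = 0" "N \<le> m \<Longrightarrow> r i m = part p i" "r i m \<le> r i (Suc m)" "r (Suc i) (Suc m) \<le> r i m"
  using assms by (auto simp: gt_def)

lemma gt_mono: "r \<in> gt N p \<Longrightarrow> m \<le> m' \<Longrightarrow> r i m \<le> r i m'"
  by (rule lift_Suc_mono_le[of "r i"]) (auto simp: gtD)

lemma gt_le_part: "r \<in> gt N p \<Longrightarrow> r i m \<le> part p i"
  using gt_mono[of r N p m "max m N" i] gtD(2)[of r N p "max m N" i] by simp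

lemma gt_antimono_row:
  assumes "r \<in> gt N p" "i \<le> i'" shows "r i' m \<le> r i m"
proof (rule lift_Suc_antimono_le[of "\<lambda>i. r i m", OF _ assms(2)])
  show "r (Suc i) m \<le> r i m" for i
    using gtD(3,4)[OF assms(1), of _ m] by (meson order_trans)
qed

lemma gt_interlace:
  assumes "r \<in> gt N p" "i < i'" shows "r i' (Suc m) \<le> r i m"
proof -
  have "r i' (Suc m) \<le> r (Suc i) (Suc m)" by (rule gt_antimono_row) (use assms in auto)
  then show ?thesis using gtD(4)[OF assms(1)] order_trans by blast
qed

lemma gt_beyond: "r \<in> gt N p \<Longrightarrow> length p \<le> i \<Longrightarrow> r i m = 0"
  using gt_le_part[of r N p i m] by (simp add: part_beyond)

text \<open>Columns increase strictly, so every entry of row \<open>i\<close> is at least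
  \<open>i\<close>.\<close>

lemma gt_diag: "r \<in> gt N p \<Longrightarrow> m \<le> i \<Longrightarrow> r i m = 0"
proof (induction m arbitrary: i)
  case 0 then show ?case by (simp add: gtD)
next
  case (Suc m)
  then have "i - 1 < i" "m \<le> i - 1" by auto
  then show ?case using gt_interlace[OF Suc.prems(1), of "i-1" i m] Suc.IH[of "i-1"] Suc.prems by simp
qed

text \<open>The number of entries \<open>m\<close> in the columns from \<open>j\<close> on.\<close>

definition cut_weight :: "nat list \<Rightarrow> nat \<Rightarrow> (nat \<Rightarrow> nat \<Rightarrow> nat) \<Rightarrow> nat \<Rightarrow> nat" where
  "cut_weight p j r m = (\<Sum>i<length p. max (r i (Suc m)) j - max (r i m) j)"

definition weight :: "nat list \<Rightarrow> (nat \<Rightarrow> nat \<Rightarrow> nat) \<Rightarrow> nat \<Rightarrow>\<^sub>0 nat" where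
  "weight p r = Abs_poly_mapping (cut_weight p 0 r)"

text \<open>Rows grow with \<open>m\<close>, so the truncated subtractions are exact; over the
  integers the sum telescopes in \<open>m\<close>.\<close>

lemma int_cut_weight:
  assumes "r \<in> gt N p"
  shows "int (cut_weight p j r m) = (\<Sum>i<length p. int (max (r i (Suc m)) j)) - (\<Sum>i<length p. int (max (r i m) j))"
  unfolding cut_weight_def of_nat_sum sum_subtractf[symmetric]
  using gtD(3)[OF assms] by (intro sum.cong refl) (simp add: max_def le_diff_conv, use le_trans in blast)

lemma cut_weight_beyond:
  assumes "r \<in> gt N p" "N \<le> m" shows "cut_weight p j r m = 0"
  using assms by (simp add: cut_weight_def gtD(2)[OF assms(1)])

lemma lookup_weight:
  assumes "r \<in> gt N p"
  shows "Poly_Mapping.lookup (weight p r) = cut_weight p 0 r"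
proof -
  have "{m. cut_weight p 0 r m \<noteq> 0} \<subseteq> {..<N}"
    using cut_weight_beyond[OF assms] by (metis (mono_tags, lifting) lessThan_iff linorder_not_le mem_Collect_eq subsetI)
  then have "finite {m. cut_weight p 0 r m \<noteq> 0}" by (rule finite_subset) simp
  then show ?thesis by (simp add: weight_def)
qed

lemma keys_weight:
  assumes "r \<in> gt N p"
  shows "Poly_Mapping.keys (weight p r) \<subseteq> {..<N}"
  using cut_weight_beyond[OF assms] 
  by (metis in_keys_iff lessThan_iff linorder_not_le lookup_weight[OF assms] subsetI)

section \<open>Patterns and semistandard tableaux\<close>

lemma card_initial_segment:
  assumes "X \<subseteq> {..<k::nat}" "\<And>c c'. c \<in> X \<Longrightarrow> c' < c \<Longrightarrow> c' \<in> X"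
  shows "X = {..<card X}"
proof -
  have fin: "finite X" using assms(1) finite_subset by blast
  have sub: "{..c} \<subseteq> X" if "c \<in> X" for c using assms(2) that by (auto simp: le_less)
  have "X \<subseteq> {..<card X}"
  proof
    fix c assume "c \<in> X"
    from card_mono[OF fin sub[OF this]] show "c \<in> {..<card X}" by simp
  qed
  then show ?thesis using card_subset_eq[of "{..<card X}" X] by simp
qed

definition gt_of :: "nat list \<Rightarrow> (nat \<times> nat \<Rightarrow> nat) \<Rightarrow> nat \<Rightarrow> nat \<Rightarrow> nat" where
  "gt_of p T i m = card {c. c < part p i \<and> T (i, c) < m}"

definition tab_of :: "nat list \<Rightarrow> (nat \<Rightarrow> nat \<Rightarrow> nat) \<Rightarrow> nat \<times> nat \<Rightarrow> nat" where
  "tab_of p r = (\<lambda>x\<in>diagram p. LEAST m. snd x < r (fst x) (Suc m))"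

text \<open>Rows increase weakly, so the entries below \<open>m\<close> fill an initial segment of
  the row, and its length determines it.\<close>

lemma less_gt_of:
  assumes "T \<in> ssyt p" shows "c < gt_of p T i m \<longleftrightarrow> c < part p i \<and> T (i, c) < m"
proof -
  have row: "T (i, c) \<le> T (i, c')" if "c < c'" "c' < part p i" for c c'
    using assms that unfolding ssyt_def by auto
  have "{c. c < part p i \<and> T (i, c) < m} = {..<card {c. c < part p i \<and> T (i, c) < m}}"
    by (rule card_initial_segment[of _ "part p i"]) (use row le_less_trans in fastforce)+
  then show ?thesis unfolding gt_of_def by blast
qed

lemma gt_of_mem:
  assumes "T \<in> ssyt p" "\<And>x. x \<in> diagram p \<Longrightarrow> T x < N" "p \<turnstile> n"
  shows "gt_of p T \<in> gt N p"
proof -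
  have col: "T (i, c) < T (Suc i, c)" if "c < part p (Suc i)" for i c
    using assms(1) that part_antimono[OF assms(3), of i "Suc i"] unfolding ssyt_def
    by (auto simp del: split_paired_All)
  have le: "a \<le> b" if "\<And>c. c < a \<Longrightarrow> c < b" for a b :: nat
    using that by (meson leI less_irrefl)
  have "gt_of p T i 0 = 0" for i by (simp add: gt_of_def)
  moreover have "gt_of p T i m = part p i" if "N \<le> m" for i m
  proof -
    have "{c. c < part p i \<and> T (i, c) < m} = {..<part p i}"
      using assms(2)[of "(i,_)"] that by fastforce
    then show ?thesis by (simp add: gt_of_def)
  qed
  moreover have "gt_of p T i m \<le> gt_of p T i (Suc m)" for i m
    by (rule le) (auto simp: less_gt_of[OF assms(1)])
  moreover have "gt_of p T (Suc i) (Suc m) \<le> gt_of p T i m" for i m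
    by (rule le) (use col part_antimono[OF assms(3), of i "Suc i"] in \<open>fastforce simp: less_gt_of[OF assms(1)]\<close>)
  ultimately show ?thesis by (simp add: gt_def)
qed

lemma tab_of_less:
  assumes "r \<in> gt N p" "(i, c) \<in> diagram p"
  shows "tab_of p r (i, c) < m \<longleftrightarrow> c < r i m"
proof -
  have ex: "c < r i (Suc N)" using assms by (simp add: gtD(2))
  have "c < r i (Suc (tab_of p r (i, c)))"
    using assms(2) LeastI[of "\<lambda>m. c < r i (Suc m)", OF ex] by (simp add: tab_of_def)
  then have "c < r i m" if "tab_of p r (i, c) < m"
    using gt_mono[OF assms(1), of "Suc (tab_of p r (i, c))" m i] that by simp
  moreover have "tab_of p r (i, c) < m" if "c < r i m"
  proof -
    have "m \<noteq> 0" using that gtD(1)[OF assms(1), of i] by (metis not_less0)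
    then obtain m' where m': "m = Suc m'" using not0_implies_Suc by blast
    then have "tab_of p r (i, c) \<le> m'"
      using assms(2) that by (auto simp: tab_of_def intro: Least_le)
    then show ?thesis using m' by simp
  qed
  ultimately show ?thesis by blast
qed

text \<open>Interlacing is strictness of columns: an entry below \<open>Suc m\<close> forces the
  entries above it in its column to be below \<open>m\<close>.\<close>

lemma tab_of_mem:
  assumes r: "r \<in> gt N p" and p: "p \<turnstile> n"
  shows "tab_of p r \<in> ssyt p" "\<And>x. x \<in> diagram p \<Longrightarrow> tab_of p r x < N"
proof -
  have le: "a \<le> b" if "\<And>m. b < m \<Longrightarrow> a < m" for a b :: nat
    using that[of "Suc b"] by simp
  have "tab_of p r (i, j) \<le> tab_of p r (i, j')" if "j < part p i" "j' < part p i" "j < j'" for i j j'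
    by (rule le) (use that in \<open>auto simp: tab_of_less[OF r]\<close>)
  moreover have "tab_of p r (i, j) < tab_of p r (i', j)" if "j < part p i" "j < part p i'" "i < i'" for i i' j
  proof -
    have "j < r i' (Suc (tab_of p r (i', j)))" 
      using that tab_of_less[OF r, of i' j "Suc (tab_of p r (i', j))"] by simp
    also have "\<dots> \<le> r i (tab_of p r (i', j))" by (rule gt_interlace[OF r that(3)])
    finally show ?thesis using that by (simp add: tab_of_less[OF r])
  qed
  ultimately show "tab_of p r \<in> ssyt p" by (auto simp: ssyt_def tab_of_def)
  show "tab_of p r x < N" if "x \<in> diagram p" for x
    using that by (cases x) (auto simp: tab_of_less[OF r] gtD(2)[OF r])
qed

lemma bij_betw_gt_of:
  assumes "p \<turnstile> n"
  shows "bij_betw (gt_of p) {T \<in> ssyt p. \<forall>x\<in>diagram p. T x < N} (gt N p)"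
proof (rule bij_betw_byWitness[where f' = "tab_of p"])
  show "\<forall>T\<in>{T \<in> ssyt p. \<forall>x\<in>diagram p. T x < N}. tab_of p (gt_of p T) = T"
  proof
    fix T assume T: "T \<in> {T \<in> ssyt p. \<forall>x\<in>diagram p. T x < N}"
    then have g: "gt_of p T \<in> gt N p" using gt_of_mem[OF _ _ assms] by simp
    show "tab_of p (gt_of p T) = T"
    proof (rule extensionalityI[of _ "diagram p"])
      fix x assume x: "x \<in> diagram p"
      obtain i c where ic: "x = (i, c)" by force
      have "tab_of p (gt_of p T) x < m \<longleftrightarrow> T x < m" for m
        using x T unfolding ic tab_of_less[OF g x[unfolded ic]] by (simp add: less_gt_of)
      then show "tab_of p (gt_of p T) x = T x" by (meson linorder_neqE_nat less_irrefl)
    qed (use T in \<open>auto simp: tab_of_def ssyt_def\<close>)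
  qed
  show "\<forall>r\<in>gt N p. gt_of p (tab_of p r) = r"
  proof (intro ballI ext)
    fix r i m assume r: "r \<in> gt N p"
    have "c < gt_of p (tab_of p r) i m \<longleftrightarrow> c < r i m" for c
      using tab_of_less[OF r, of i c m] gt_le_part[OF r, of i m]
      by (auto simp: less_gt_of[OF tab_of_mem(1)[OF r assms]])
    then show "gt_of p (tab_of p r) i m = r i m" by (meson linorder_neqE_nat less_irrefl)
  qed
qed (use gt_of_mem[OF _ _ assms] tab_of_mem[OF _ assms] in auto)

lemma finite_diagram [simp]: "finite (diagram p)"
proof -
  have "diagram p = Sigma {..<length p} (\<lambda>i. {..<part p i})"
    by (auto simp: diagram_def part_def)
  then show ?thesis by simp
qed

lemma finite_gt:
  assumes "p \<turnstile> n" shows "finite (gt N p)"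
proof -
  have "finite (PiE (diagram p) (\<lambda>_. {..<N}))" by (intro finite_PiE) auto
  moreover have "{T \<in> ssyt p. \<forall>x\<in>diagram p. T x < N} \<subseteq> PiE (diagram p) (\<lambda>_. {..<N})"
    by (auto simp: ssyt_def PiE_def)
  ultimately show ?thesis using bij_betw_finite[OF bij_betw_gt_of[OF assms]] finite_subset by blast
qed

lemma weight_gt_of:
  assumes T: "T \<in> ssyt p" and N: "\<And>x. x \<in> diagram p \<Longrightarrow> T x < N" and p: "p \<turnstile> n"
  shows "Poly_Mapping.lookup (weight p (gt_of p T)) m = card {x \<in> diagram p. T x = m}"
proof -
  have eq: "{x \<in> diagram p. T x = m} = Sigma {..<length p} (\<lambda>i. {c. c < part p i \<and> T (i, c) = m})"
    by (auto simp: diagram_def part_def)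
  have "card {x \<in> diagram p. T x = m} = (\<Sum>i<length p. card {c. c < part p i \<and> T (i, c) = m})"
    unfolding eq by (rule card_SigmaI) auto
  also have "\<dots> = (\<Sum>i<length p. gt_of p T i (Suc m) - gt_of p T i m)"
  proof (rule sum.cong[OF refl])
    fix i
    have "{c. c < part p i \<and> T (i, c) = m} = 
       {c. c < part p i \<and> T (i, c) < Suc m} - {c. c < part p i \<and> T (i, c) < m}" by auto
    then show "card {c. c < part p i \<and> T (i, c) = m} = gt_of p T i (Suc m) - gt_of p T i m"
      unfolding gt_of_def by (simp add: card_Diff_subset subset_iff)
  qed
  finally show ?thesis
    by (simp add: lookup_weight[OF gt_of_mem[OF T N p]] cut_weight_def)
qed

text \<open>A tableau of content \<open>a\<close> has all its entries in the support of
  \<open>a\<close>, so any bound \<open>N\<close> on the support bounds the entries.\<close>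

lemma schur_eq_card_gt:
  assumes p: "p \<turnstile> n" and a: "Poly_Mapping.keys a \<subseteq> {..<N}"
  shows "schur p a = int (card {r \<in> gt N p. weight p r = a})"
proof -
  let ?A = "{T \<in> ssyt p. \<forall>x\<in>diagram p. T x < N}"
  let ?B = "{T \<in> ssyt p. \<forall>i. card {c \<in> diagram p. T c = i} = Poly_Mapping.lookup a i}"
  have sub: "T x < N" if "T \<in> ?B" "x \<in> diagram p" for T x
  proof -
    have "x \<in> {c \<in> diagram p. T c = T x}" using that by simp
    moreover have "finite {c \<in> diagram p. T c = T x}" by simp
    ultimately have "card {c \<in> diagram p. T c = T x} \<noteq> 0" by (metis card_eq_0_iff empty_iff)
    moreover have "card {c \<in> diagram p. T c = T x} = Poly_Mapping.lookup a (T x)" using that by blast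
    ultimately have "T x \<in> Poly_Mapping.keys a" by (simp only: in_keys_iff not_False_eq_True)
    then show ?thesis using a by auto
  qed
  have w: "weight p (gt_of p T) = a \<longleftrightarrow> T \<in> ?B" if "T \<in> ?A" for T
    using that weight_gt_of[of T p N n] p by (auto simp: poly_mapping_eq_iff fun_eq_iff)
  have "bij_betw (gt_of p) ?B {r \<in> gt N p. weight p r = a}"
    unfolding bij_betw_def
  proof
    have BA: "?B \<subseteq> ?A" using sub by blast
    show "inj_on (gt_of p) ?B"
      using bij_betw_gt_of[OF p, of N] BA unfolding bij_betw_def by (meson inj_on_subset)
    have im: "gt_of p ` ?A = gt N p" using bij_betw_gt_of[OF p, of N] by (simp add: bij_betw_def)
    show "gt_of p ` ?B = {r \<in> gt N p. weight p r = a}"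
    proof (intro equalityI subsetI)
      fix r assume "r \<in> gt_of p ` ?B"
      then obtain T where T: "T \<in> ?B" "r = gt_of p T" by blast
      then have "T \<in> ?A" using BA by blast
      then show "r \<in> {r \<in> gt N p. weight p r = a}" using w T im by blast
    next
      fix r assume r: "r \<in> {r \<in> gt N p. weight p r = a}"
      then obtain T where T: "T \<in> ?A" "r = gt_of p T" using im by blast
      then show "r \<in> gt_of p ` ?B" using w r by blast
    qed
  qed
  then show ?thesis unfolding schur_def by (simp add: bij_betw_same_card)
qed

definition exp_total :: "(nat \<Rightarrow>\<^sub>0 nat) \<Rightarrow> nat" where
  "exp_total a = (\<Sum>i\<in>Poly_Mapping.keys a. Poly_Mapping.lookup a i)"

lemma exp_total_eq_sum: "finite A \<Longrightarrow> Poly_Mapping.keys a \<subseteq> A \<Longrightarrow> exp_total a = (\<Sum>i\<in>A. Poly_Mapping.lookup a i)"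
  unfolding exp_total_def by (rule sum.mono_neutral_left) (auto simp: in_keys_iff)

lemma exp_total_weight:
  assumes r: "r \<in> gt N p" and p: "p \<turnstile> n"
  shows "exp_total (weight p r) = n"
proof -
  have "int (exp_total (weight p r)) = (\<Sum>m<N. int (cut_weight p 0 r m))"
    using keys_weight[OF r] by (simp add: exp_total_eq_sum[of "{..<N}"] lookup_weight[OF r])
  also have "\<dots> = (\<Sum>m<N. (\<Sum>i<length p. int (r i (Suc m))) - (\<Sum>i<length p. int (r i m)))"
    by (simp add: int_cut_weight[OF r])
  also have "\<dots> = (\<Sum>i<length p. int (r i N)) - (\<Sum>i<length p. int (r i 0))"
    by (rule sum_lessThan_telescope)
  also have "\<dots> = int (\<Sum>i<length p. part p i)"
    by (simp add: gtD(1,2)[OF r])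
  also have "\<dots> = int n" using sum_part_partition[OF p order_refl] by simp
  finally show ?thesis by simp
qed

text \<open>Homogeneity; it collapses the later sums over all sizes to a single size.\<close>

lemma schur_eq_0:
  assumes "p \<turnstile> n" "exp_total a \<noteq> n" shows "schur p a = 0"
proof -
  obtain N where N: "Poly_Mapping.keys a \<subseteq> {..<N}"
    using finite_nat_set_iff_bounded[of "Poly_Mapping.keys a"] by auto
  have "{r \<in> gt N p. weight p r = a} = {}" using exp_total_weight[OF _ assms(1)] assms(2) by blast
  then show ?thesis using schur_eq_card_gt[OF assms(1) N] by (metis card.empty of_nat_0)
qed

text \<open>The Bender--Knuth reflection of the letters \<open>k\<close>, \<open>Suc k\<close> in the columns before \<open>j\<close>: each row
  boundary between the two letters is reflected in the interval of its admissible values.\<close>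

definition bk_hi :: "nat \<Rightarrow> nat \<Rightarrow> (nat \<Rightarrow> nat \<Rightarrow> nat) \<Rightarrow> nat \<Rightarrow> nat" where
  "bk_hi j k r i = (if i = 0 then min j (r i (Suc (Suc k))) else min (min j (r i (Suc (Suc k)))) (min j (r (i - 1) k)))"

definition bk_lo :: "nat \<Rightarrow> (nat \<Rightarrow> nat \<Rightarrow> nat) \<Rightarrow> nat \<Rightarrow> nat" where
  "bk_lo k r i = max (r i k) (r (Suc i) (Suc (Suc k)))"

definition bk :: "nat \<Rightarrow> nat \<Rightarrow> (nat \<Rightarrow> nat \<Rightarrow> nat) \<Rightarrow> nat \<Rightarrow> nat \<Rightarrow> nat" where
  "bk j k r i m = (if m = Suc k \<and> r i m \<le> j then bk_lo k r i + bk_hi j k r i - r i m else r i m)"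

lemma bk_bounds:
  assumes "r \<in> gt N p" "r i (Suc k) \<le> j"
  shows "bk_lo k r i \<le> r i (Suc k)" "r i (Suc k) \<le> bk_hi j k r i"
    "bk_lo k r i \<le> bk j k r i (Suc k)" "bk j k r i (Suc k) \<le> bk_hi j k r i"
proof -
  show *: "bk_lo k r i \<le> r i (Suc k)" using gtD(3,4)[OF assms(1)] by (auto simp: bk_lo_def)
  show **: "r i (Suc k) \<le> bk_hi j k r i"
    using gtD(3)[OF assms(1), of i "Suc k"] gtD(4)[OF assms(1), of "i - 1" k] assms(2)
    by (auto simp: bk_hi_def)
  show "bk_lo k r i \<le> bk j k r i (Suc k)" "bk j k r i (Suc k) \<le> bk_hi j k r i"
    using * ** assms(2) by (auto simp: bk_def)
qed

lemma bk_other: "m \<noteq> Suc k \<Longrightarrow> bk j k r i m = r i m"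
  by (simp add: bk_def)

lemma bk_between:
  assumes "r \<in> gt N p" 
  shows "r i k \<le> bk j k r i (Suc k)" "bk j k r i (Suc k) \<le> r i (Suc (Suc k))"
    "r (Suc i) (Suc (Suc k)) \<le> bk j k r i (Suc k)" "bk j k r (Suc i) (Suc k) \<le> r i k"
proof -
  show "r i k \<le> bk j k r i (Suc k)" "r (Suc i) (Suc (Suc k)) \<le> bk j k r i (Suc k)"
    using bk_bounds(3)[OF assms, of i k j] gtD(3,4)[OF assms]
    by (cases "r i (Suc k) \<le> j"; simp add: bk_lo_def bk_def)+
  show "bk j k r i (Suc k) \<le> r i (Suc (Suc k))"
    using bk_bounds(4)[OF assms, of i k j] gtD(3)[OF assms]
    by (cases "r i (Suc k) \<le> j") (auto simp: bk_hi_def bk_def split: if_splits)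
  show "bk j k r (Suc i) (Suc k) \<le> r i k"
    using bk_bounds(4)[OF assms, of "Suc i" k j] gtD(4)[OF assms]
    by (cases "r (Suc i) (Suc k) \<le> j") (auto simp: bk_hi_def bk_def)
qed

lemma bk_mem:
  assumes "r \<in> gt N p" "Suc k < N"
  shows "bk j k r \<in> gt N p"
  unfolding gt_def mem_Collect_eq
proof (intro conjI allI impI)
  fix i m
  show "bk j k r i 0 = 0" by (simp add: bk_other gtD(1)[OF assms(1)])
  show "bk j k r i m = part p i" if "N \<le> m" 
    using that assms(2) by (simp add: bk_other gtD(2)[OF assms(1)])
  show "bk j k r i m \<le> bk j k r i (Suc m)"
    using gtD(3)[OF assms(1)] bk_between[OF assms(1)]
    by (cases "m = k"; cases "m = Suc k") (auto simp: bk_other)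
  show "bk j k r (Suc i) (Suc m) \<le> bk j k r i m"
    using gtD(4)[OF assms(1)] bk_between[OF assms(1)]
    by (cases "m = k"; cases "m = Suc k") (auto simp: bk_other)
qed

lemma bk_le_iff:
  assumes "r \<in> gt N p" 
  shows "bk j k r i m \<le> j \<longleftrightarrow> r i m \<le> j"
proof (cases "m = Suc k \<and> r i m \<le> j")
  case True
  then have m: "m = Suc k" and "r i (Suc k) \<le> j" by auto
  then have "bk j k r i m \<le> bk_hi j k r i" unfolding m by (intro bk_bounds(4)[OF assms])
  also have "\<dots> \<le> j" by (auto simp: bk_hi_def)
  finally show ?thesis using True by blast
qed (auto simp: bk_def)

text \<open>A reflection in an interval is an involution. The interval depends only on the levels
  \<open>k\<close> and \<open>Suc (Suc k)\<close>, which stay fixed, and by \<open>bk_le_iff\<close>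
  the same rows are reflected again.\<close>

lemma bk_bk:
  assumes "r \<in> gt N p"
  shows "bk j k (bk j k r) = r"
proof (intro ext)
  fix i m
  have "bk_lo k (bk j k r) i = bk_lo k r i" by (simp add: bk_lo_def bk_other)
  moreover have "bk_hi j k (bk j k r) i = bk_hi j k r i" by (simp add: bk_hi_def bk_other)
  ultimately show "bk j k (bk j k r) i m = r i m"
    using bk_le_iff[OF assms, of j k i "Suc k"] bk_bounds[OF assms, of i k j]
    by (cases "m = Suc k \<and> r i m \<le> j") (auto simp: bk_def)
qed

text \<open>Boundaries move only among values at most \<open>j\<close>, so the columns from
  \<open>j\<close> on do not change.\<close>

lemma max_bk:
  assumes "r \<in> gt N p" "j \<le> j'"
  shows "max (bk j k r i m) j' = max (r i m) j'"
proof (cases "r i m \<le> j")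
  case True
  then have "bk j k r i m \<le> j" using bk_le_iff[OF assms(1)] by simp
  then show ?thesis using True assms(2) by simp
qed (simp add: bk_def)

lemma cut_weight_bk:
  assumes "r \<in> gt N p" "j \<le> j'"
  shows "cut_weight p j' (bk j k r) m = cut_weight p j' r m"
  by (simp add: cut_weight_def max_bk[OF assms])

text \<open>The lower end in row \<open>i\<close> and the upper end in row \<open>Suc i\<close> are
  the maximum and the minimum of the same two numbers, so the ends of all intervals together add up
  to the sums of \<open>x\<close> and \<open>y\<close>.\<close>

lemma sum_reflection:
  fixes x y :: "nat \<Rightarrow> nat"
  defines "h \<equiv> \<lambda>i. if i = 0 then y i else min (y i) (x (i - 1))"
  shows "(\<Sum>i<L. max (x i) (y (Suc i)) + h i) + h L = (\<Sum>i<L. x i) + (\<Sum>i<L. y i) + y L"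
proof (induction L)
  case 0 then show ?case by (simp add: h_def)
next
  case (Suc L)
  have "max (x L) (y (Suc L)) + h (Suc L) = x L + y (Suc L)" by (simp add: h_def)
  then show ?case using Suc by simp
qed

text \<open>The hypothesis says that column \<open>j\<close> contains no entry \<open>k\<close>. A
  row whose boundary lies beyond \<open>j\<close> then has both neighbouring levels beyond
  \<open>j\<close> as well, so each truncated term in it equals \<open>j\<close>; the other rows are
  reflected.\<close>

lemma sum_min_bk:
  assumes r: "r \<in> gt N p" and j: "\<And>i. \<not> (r i k \<le> j \<and> j < r i (Suc k))"
  shows "(\<Sum>i<length p. min j (bk j k r i (Suc k))) + (\<Sum>i<length p. min j (r i (Suc k))) =
    (\<Sum>i<length p. min j (r i k)) + (\<Sum>i<length p. min j (r i (Suc (Suc k))))"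
proof -
  have *: "min j (bk j k r i (Suc k)) + min j (r i (Suc k)) = 
      max (min j (r i k)) (min j (r (Suc i) (Suc (Suc k)))) + bk_hi j k r i" for i
  proof (cases "r i (Suc k) \<le> j")
    case True
    then have "bk j k r i (Suc k) \<le> j" using bk_le_iff[OF r] by simp
    moreover have "bk_lo k r i \<le> j" using bk_bounds(1)[OF r True] True by simp
    ultimately show ?thesis 
      using bk_bounds[OF r True] True by (auto simp: bk_def bk_lo_def)
  next
    case False
    have "j < r (i - 1) k" if "i \<noteq> 0" 
      using gtD(4)[OF r, of "i - 1" k] False that by simp
    then show ?thesis
      using False j[of i] gtD(3)[OF r, of i "Suc k"] by (auto simp: bk_def bk_hi_def)
  qed
  have "bk_hi j k r (length p) = 0" by (simp add: bk_hi_def gt_beyond[OF r])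
  then show ?thesis
    unfolding sum.distrib[symmetric] *
    using sum_reflection[of "\<lambda>i. min j (r i k)" "\<lambda>i. min j (r i (Suc (Suc k)))" "length p"]
    by (simp add: bk_hi_def gt_beyond[OF r] sum.distrib)
qed

text \<open>Left of column \<open>j\<close> the letters \<open>k\<close> and \<open>Suc k\<close>
  exchange their multiplicities, from \<open>j\<close> on they keep them. The additive form avoids
  subtraction of natural numbers.\<close>

lemma cut_weight_0_bk:
  assumes r: "r \<in> gt N p" and j: "\<And>i. \<not> (r i k \<le> j \<and> j < r i (Suc k))" and k: "Suc k < N"
  shows "cut_weight p 0 (bk j k r) k + cut_weight p j r (Suc k) = cut_weight p 0 r (Suc k) + cut_weight p j r k"
    "cut_weight p 0 (bk j k r) (Suc k) + cut_weight p j r k = cut_weight p 0 r k + cut_weight p j r (Suc k)"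
    "m \<noteq> k \<Longrightarrow> m \<noteq> Suc k \<Longrightarrow> cut_weight p 0 (bk j k r) m = cut_weight p 0 r m"
proof -
  let ?S = "\<lambda>r m. \<Sum>i<length p. int (r i m)" and ?X = "\<lambda>r m. \<Sum>i<length p. int (max (r i m) j)"
  let ?M = "\<lambda>r m. \<Sum>i<length p. int (min j (r i m))"
  have split: "?S r m = ?X r m + ?M r m - int (length p * j)" for r m
  proof -
    have "?S r m = (\<Sum>i<length p. int (max (r i m) j) + int (min j (r i m)) - int j)"
      by (rule sum.cong) auto
    then show ?thesis by (simp add: sum.distrib sum_subtractf)
  qed
  have X: "?X (bk j k r) m = ?X r m" for m
    by (simp add: max_bk[OF r])
  have M: "?M (bk j k r) (Suc k) + ?M r (Suc k) = ?M r k + ?M r (Suc (Suc k))"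
    using arg_cong[OF sum_min_bk[OF r j], of int] by simp
  have c0: "int (cut_weight p 0 s m) = ?S s (Suc m) - ?S s m" if "s \<in> gt N p" for s m
    using int_cut_weight[OF that, of 0 m] by simp
  note cj = int_cut_weight[OF r, of j]
  note r' = bk_mem[OF r k, of j]
  have S': "?S (bk j k r) m = ?S r m" if "m \<noteq> Suc k" for m
    using that by (simp add: bk_other)
  have S: "?S (bk j k r) (Suc k) + ?S r (Suc k) + ?X r k + ?X r (Suc (Suc k)) = ?S r k + ?S r (Suc (Suc k)) + 2 * ?X r (Suc k)"
    using split[of "bk j k r" "Suc k"] split[of r "Suc k"] split[of r k] split[of r "Suc (Suc k)"] M X[of "Suc k"]
    by linarith
  show "cut_weight p 0 (bk j k r) k + cut_weight p j r (Suc k) = cut_weight p 0 r (Suc k) + cut_weight p j r k"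
    using c0[OF r', of k] c0[OF r, of "Suc k"] cj[of k] cj[of "Suc k"] S S'[of k] by linarith
  show "cut_weight p 0 (bk j k r) (Suc k) + cut_weight p j r k = cut_weight p 0 r k + cut_weight p j r (Suc k)"
    using c0[OF r', of "Suc k"] c0[OF r, of "k"] cj[of k] cj[of "Suc k"] S S'[of "Suc (Suc k)"] by linarith
  show "m \<noteq> k \<Longrightarrow> m \<noteq> Suc k \<Longrightarrow> cut_weight p 0 (bk j k r) m = cut_weight p 0 r m"
    using c0[OF r', of m] c0[OF r, of m] S'[of m] S'[of "Suc m"] by linarith
qed

section \<open>Symmetry of Schur polynomials\<close>

lemma lookup_map_key_permutes:
  "w permutes S \<Longrightarrow> Poly_Mapping.lookup (Poly_Mapping.map_key w v) i = Poly_Mapping.lookup v (w i)"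
  by (simp add: map_key.rep_eq permutes_inj)

lemma map_key_compose_permutes:
  "w permutes S \<Longrightarrow> u permutes S \<Longrightarrow> Poly_Mapping.map_key w (Poly_Mapping.map_key u v) = Poly_Mapping.map_key (u \<circ> w) v"
  by (simp add: map_key_compose permutes_inj)

lemma transpose_permutes: "Suc k < N \<Longrightarrow> transpose k (Suc k) permutes {..<N}"
  by (simp add: permutes_swap_id)

text \<open>With \<open>j\<close> the full width nothing lies to the right of the cut: this is the
  classical Bender--Knuth involution.\<close>

lemma weight_bk_full:
  assumes r: "r \<in> gt N p" and p: "p \<turnstile> n" and k: "Suc k < N"
  shows "weight p (bk (part p 0) k r) = Poly_Mapping.map_key (transpose k (Suc k)) (weight p r)"
proof -
  let ?j = "part p 0"
  have le: "r i m \<le> ?j" for i m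
    using gt_le_part[OF r, of i m] part_antimono[OF p, of 0 i] by simp
  have c: "cut_weight p ?j r m = 0" for m
    using le by (simp add: cut_weight_def max_absorb2)
  have j: "\<not> (r i k \<le> ?j \<and> ?j < r i (Suc k))" for i
    using le[of i "Suc k"] by simp
  show ?thesis
  proof (rule poly_mapping_eqI)
    fix m
    show "Poly_Mapping.lookup (weight p (bk ?j k r)) m = Poly_Mapping.lookup (Poly_Mapping.map_key (transpose k (Suc k)) (weight p r)) m"
      using cut_weight_0_bk[OF r j k] c
      by (auto simp: lookup_weight[OF r] lookup_weight[OF bk_mem[OF r k]] lookup_map_key_permutes[OF transpose_permutes[OF k]] transpose_def)
  qed
qed

text \<open>Adjacent transpositions are realised by Bender--Knuth involutions and generate all
  permutations. The function \<open>g\<close> is arbitrary so that monomials and indicators of a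
  single coefficient are both covered.\<close>

lemma sum_weight_symmetric:
  fixes g :: "(nat \<Rightarrow>\<^sub>0 nat) \<Rightarrow> 'a::comm_monoid_add"
  assumes p: "p \<turnstile> n" and w: "w permutes {..<N}"
  shows "(\<Sum>r\<in>gt N p. g (Poly_Mapping.map_key w (weight p r))) = (\<Sum>r\<in>gt N p. g (weight p r))"
proof -
  define P where "P w \<longleftrightarrow> (\<forall>g :: (nat \<Rightarrow>\<^sub>0 nat) \<Rightarrow> 'a. (\<Sum>r\<in>gt N p. g (Poly_Mapping.map_key w (weight p r))) = (\<Sum>r\<in>gt N p. g (weight p r)))" for w
  have comp: "P (u \<circ> w)" if "P u" "P w" "w permutes {..<N}" "u permutes {..<N}" for u w
    unfolding P_def
  proof
    fix g :: "(nat \<Rightarrow>\<^sub>0 nat) \<Rightarrow> 'a"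
    have "(\<Sum>r\<in>gt N p. g (Poly_Mapping.map_key (u \<circ> w) (weight p r))) =
      (\<Sum>r\<in>gt N p. (g \<circ> Poly_Mapping.map_key w) (Poly_Mapping.map_key u (weight p r)))"
      using that by (simp add: map_key_compose_permutes)
    also have "\<dots> = (\<Sum>r\<in>gt N p. g (Poly_Mapping.map_key w (weight p r)))"
      using that(1)[unfolded P_def, THEN spec, of "g \<circ> Poly_Mapping.map_key w"] by simp
    also have "\<dots> = (\<Sum>r\<in>gt N p. g (weight p r))" using that(2) by (simp add: P_def)
    finally show "(\<Sum>r\<in>gt N p. g (Poly_Mapping.map_key (u \<circ> w) (weight p r))) = (\<Sum>r\<in>gt N p. g (weight p r))" .
  qed
  have adj: "P (transpose k (Suc k))" if k: "Suc k < N" for k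
    unfolding P_def
  proof
    fix g :: "(nat \<Rightarrow>\<^sub>0 nat) \<Rightarrow> 'a"
    show "(\<Sum>r\<in>gt N p. g (Poly_Mapping.map_key (transpose k (Suc k)) (weight p r))) = (\<Sum>r\<in>gt N p. g (weight p r))"
      by (rule sum.reindex_bij_witness[where i = "bk (part p 0) k" and j = "bk (part p 0) k"])
        (auto simp: bk_bk bk_mem k weight_bk_full[OF _ p k])
  qed
  have id: "P id" by (simp add: P_def id_def map_key_id)
  have tr: "P (transpose a (a + d))" if "a + d < N" for a d
    using that
  proof (induction d)
    case 0
    have "transpose a (a + 0) = id" by (simp add: fun_eq_iff)
    then show ?case using id by (simp only:)
  next
    case (Suc d)
    let ?t = "transpose (a + d) (Suc (a + d))" and ?u = "transpose a (a + d)"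
    show ?case
    \<comment> \<open>For \<open>d = 0\<close> the conjugation used in the other case would collapse
      to \<open>?t\<close> composed with itself, the identity.\<close>
    proof (cases "d = 0")
      case True then show ?thesis using adj Suc by simp
    next
      case False
      have eq: "transpose a (a + Suc d) = ?t \<circ> (?u \<circ> ?t)"
        using False by (auto simp: fun_eq_iff transpose_def)
      have perm: "?t permutes {..<N}" "?u permutes {..<N}"
        using Suc by (auto intro!: permutes_swap_id)
      have "P ?t" "P ?u" using adj Suc by auto
      then show ?thesis unfolding eq by (intro comp permutes_compose perm)
    qed
  qed
  have tr': "P (transpose a b)" if "a < N" "b < N" for a b
  proof (cases "a \<le> b")
    case True then show ?thesis using tr[of a "b - a"] that by simp
  next
    case False then show ?thesis using tr[of b "a - b"] that by (simp add: transpose_commute)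
  qed
  have "P w" using w finite_lessThan[of N]
  proof (induction w rule: permutes_induct)
    case (swap a b q)
    then have "transpose a b permutes {..<N}" by (simp add: permutes_swap_id)
    then show ?case using swap(1,2) by (intro comp tr' swap(4,5)) auto
  qed (rule id)
  then show ?thesis by (simp add: P_def)
qed

section \<open>Alternants and the Littlewood--Richardson rule\<close>

type_synonym mpoly = "(nat \<Rightarrow>\<^sub>0 nat) \<Rightarrow>\<^sub>0 int"

definition alternant :: "nat \<Rightarrow> (nat \<Rightarrow>\<^sub>0 nat) \<Rightarrow> mpoly" where
  "alternant N v = (\<Sum>w | w permutes {..<N}. Poly_Mapping.single (Poly_Mapping.map_key w v) (sign w))"

definition schur_poly :: "nat \<Rightarrow> nat list \<Rightarrow> mpoly" where
  "schur_poly N p = (\<Sum>r\<in>gt N p. Poly_Mapping.single (weight p r) 1)"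

lemma finite_permutes [simp]: "finite {w. w permutes {..<N::nat}}"
  by (simp add: finite_permutations)

lemma alternant_transpose:
  assumes "Suc k < N"
  shows "alternant N (Poly_Mapping.map_key (transpose k (Suc k)) v) = - alternant N v"
proof -
  let ?t = "transpose k (Suc k)"
  note t = transpose_permutes[OF assms]
  have "alternant N v = (\<Sum>w | w permutes {..<N}. Poly_Mapping.single (Poly_Mapping.map_key (?t \<circ> w) v) (sign (?t \<circ> w)))"
    unfolding alternant_def by (rule setum_permutations_compose_left[OF t])
  also have "\<dots> = (\<Sum>w | w permutes {..<N}. - Poly_Mapping.single (Poly_Mapping.map_key w (Poly_Mapping.map_key ?t v)) (sign w))"
  proof (rule sum.cong[OF refl])
    fix w assume "w \<in> {w. w permutes {..<N}}"
    then have w: "w permutes {..<N}" by simp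
    have "sign (?t \<circ> w) = - sign w"
      using permutation_permutes[THEN iffD2, OF exI[of _ "{..<N}"]] t w by (simp add: sign_compose sign_swap_id)
    then show "Poly_Mapping.single (Poly_Mapping.map_key (?t \<circ> w) v) (sign (?t \<circ> w)) = - Poly_Mapping.single (Poly_Mapping.map_key w (Poly_Mapping.map_key ?t v)) (sign w)"
      by (simp add: map_key_compose_permutes[OF w t] single_uminus)
  qed
  also have "\<dots> = - alternant N (Poly_Mapping.map_key ?t v)" by (simp add: alternant_def sum_negf)
  finally show ?thesis by simp
qed

lemma lookup_schur_poly:
  assumes "p \<turnstile> n"
  shows "Poly_Mapping.lookup (schur_poly N p) a = (if Poly_Mapping.keys a \<subseteq> {..<N} then schur p a else 0)"
proof -
  have *: "Poly_Mapping.lookup (schur_poly N p) a = int (card {r \<in> gt N p. weight p r = a})"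
    using finite_gt[OF assms] 
    by (simp add: schur_poly_def lookup_sum lookup_single when_def sum.If_cases Int_def eq_commute[of a])
  show ?thesis
  proof (cases "Poly_Mapping.keys a \<subseteq> {..<N}")
    case True then show ?thesis by (simp add: * schur_eq_card_gt[OF assms True])
  next
    case False
    then have "{r \<in> gt N p. weight p r = a} = {}" using keys_weight by blast
    then show ?thesis unfolding * using False by (simp only: card.empty) simp
  qed
qed

text \<open>By symmetry the Schur polynomial may be rewritten, for each term of the alternant, with
  weights permuted by the same \<open>w\<close>; then both exponents sit under one
  \<open>map_key w\<close>.\<close>

lemma alternant_mult_schur_poly:
  assumes "p \<turnstile> n"
  shows "alternant N v * schur_poly N p = (\<Sum>r\<in>gt N p. alternant N (v + weight p r))"
proof -
  have "alternant N v * schur_poly N p = 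
     (\<Sum>w | w permutes {..<N}. \<Sum>r\<in>gt N p. Poly_Mapping.single (Poly_Mapping.map_key w v + Poly_Mapping.map_key w (weight p r)) (sign w))"
    unfolding alternant_def sum_distrib_right
  proof (rule sum.cong[OF refl])
    fix w assume "w \<in> {w. w permutes {..<N}}"
    then have w: "w permutes {..<N}" by simp
    have "schur_poly N p = (\<Sum>r\<in>gt N p. Poly_Mapping.single (Poly_Mapping.map_key w (weight p r)) 1)"
      unfolding schur_poly_def
      by (rule sum_weight_symmetric[OF assms w, of "\<lambda>u. Poly_Mapping.single u 1", symmetric])
    then show "Poly_Mapping.single (Poly_Mapping.map_key w v) (sign w) * schur_poly N p = (\<Sum>r\<in>gt N p. Poly_Mapping.single (Poly_Mapping.map_key w v + Poly_Mapping.map_key w (weight p r)) (sign w))"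
      by (simp add: sum_distrib_left mult_single)
  qed
  also have "\<dots> = (\<Sum>r\<in>gt N p. alternant N (v + weight p r))"
    unfolding alternant_def
    by (subst sum.swap) (intro sum.cong refl, auto simp: map_key_plus permutes_inj)
  finally show ?thesis .
qed

section \<open>Dominance and the sign-reversing involution\<close>

definition part_exp :: "nat list \<Rightarrow> nat \<Rightarrow>\<^sub>0 nat" where
  "part_exp p = Abs_poly_mapping (part p)"

text \<open>The usual staircase with its first \<open>N\<close> exponents raised by one, which only
  multiplies alternants by a symmetric monomial.\<close>

definition staircase :: "nat \<Rightarrow> nat \<Rightarrow>\<^sub>0 nat" where
  "staircase N = Abs_poly_mapping (\<lambda>i. N - i)"

lemma lookup_part_exp [simp]: "Poly_Mapping.lookup (part_exp p) = part p"
proof -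
  have "{i. part p i \<noteq> 0} \<subseteq> {..<length p}" by (auto simp: part_def split: if_splits)
  then have "finite {i. part p i \<noteq> 0}" by (rule finite_subset) simp
  then show ?thesis by (simp add: part_exp_def)
qed

lemma lookup_staircase [simp]: "Poly_Mapping.lookup (staircase N) i = N - i"
proof -
  have "{i. N - i \<noteq> 0} \<subseteq> {..<N}" by auto
  then have "finite {i. N - i \<noteq> 0}" by (rule finite_subset) simp
  then show ?thesis by (simp add: staircase_def)
qed

lemma part_exp_eq_iff: "p \<turnstile> n \<Longrightarrow> q \<turnstile> m \<Longrightarrow> part_exp p = part_exp q \<longleftrightarrow> p = q"
  using partition_eqI by (auto simp: poly_mapping_eq_iff)

definition violation :: "nat list \<Rightarrow> nat list \<Rightarrow> (nat \<Rightarrow> nat \<Rightarrow> nat) \<Rightarrow> nat \<Rightarrow> nat \<Rightarrow> bool" where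
  "violation p q r j k \<longleftrightarrow> part p k + cut_weight q j r k < part p (Suc k) + cut_weight q j r (Suc k)"

text \<open>Adding the contents of the columns of the tableau to \<open>p\<close>, from right to left, yields
  partitions throughout.\<close>

definition dominant :: "nat list \<Rightarrow> nat list \<Rightarrow> (nat \<Rightarrow> nat \<Rightarrow> nat) \<Rightarrow> bool" where
  "dominant p q r \<longleftrightarrow> (\<forall>j k. \<not> violation p q r j k)"

lemma cut_weight_Suc:
  "cut_weight q j r m = cut_weight q (Suc j) r m + card {i. i < length q \<and> r i m \<le> j \<and> j < r i (Suc m)}"
proof -
  have "cut_weight q j r m = (\<Sum>i<length q. (max (r i (Suc m)) (Suc j) - max (r i m) (Suc j)) + (if r i m \<le> j \<and> j < r i (Suc m) then 1 else 0))"
    unfolding cut_weight_def by (rule sum.cong) (auto simp: max_def)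
  also have "\<dots> = cut_weight q (Suc j) r m + card ({..<length q} \<inter> {i. r i m \<le> j \<and> j < r i (Suc m)})"
    by (simp add: sum.distrib cut_weight_def sum.If_cases)
  finally show ?thesis by (simp add: Int_def)
qed

lemma card_column_le_1:
  assumes "r \<in> gt N q"
  shows "card {i. i < length q \<and> r i m \<le> j \<and> j < r i (Suc m)} \<le> 1"
proof -
  have "i = i'" if "r i m \<le> j" "j < r i (Suc m)" "r i' m \<le> j" "j < r i' (Suc m)" for i i'
    using gt_interlace[OF assms, of i i' m] gt_interlace[OF assms, of i' i m] that
    by (cases i i' rule: linorder_cases) auto
  then show ?thesis by (intro card_le_Suc0_iff_eq[THEN iffD2, unfolded One_nat_def[symmetric]]) auto
qed

lemma cut_weight_eq_0: 
  assumes "r \<in> gt N q" "q \<turnstile> n" "part q 0 \<le> j" shows "cut_weight q j r m = 0"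
proof -
  have "r i m \<le> j" for i m
    using gt_le_part[OF assms(1), of i m] part_antimono[OF assms(2), of 0 i] assms(3) by simp
  then show ?thesis by (simp add: cut_weight_def max_absorb2)
qed

text \<open>A strict column holds each letter at most once, so moving the cut from
  \<open>Suc j\<close> to \<open>j\<close> changes every count by at most one. A violation that is
  new at \<open>j\<close> therefore comes from a column with \<open>Suc k\<close> but without
  \<open>k\<close>, and it fails by exactly one.\<close>

lemma violation_facts:
  assumes r: "r \<in> gt N q" and p: "p \<turnstile> n" and len: "length p \<le> N"
    and v: "violation p q r j k" and nv: "\<not> violation p q r (Suc j) k"
  shows "Suc k < N" "\<And>i. \<not> (r i k \<le> j \<and> j < r i (Suc k))"
    "part p k + cut_weight q j r k + 1 = part p (Suc k) + cut_weight q j r (Suc k)"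
proof -
  show "Suc k < N"
  proof (rule ccontr)
    assume "\<not> Suc k < N"
    then have "part p (Suc k) = 0" "cut_weight q j r (Suc k) = 0"
      using len cut_weight_beyond[OF r, of "Suc k"] by (auto simp: part_beyond)
    then show False using v by (simp add: violation_def)
  qed
  let ?C = "\<lambda>m. {i. i < length q \<and> r i m \<le> j \<and> j < r i (Suc m)}"
  have C: "card (?C k) = 0" "card (?C (Suc k)) = 1"
    "part p k + cut_weight q j r k + 1 = part p (Suc k) + cut_weight q j r (Suc k)"
    using v nv card_column_le_1[OF r, of "Suc k" j]
    unfolding violation_def cut_weight_Suc[of q j] by linarith+
  show "part p k + cut_weight q j r k + 1 = part p (Suc k) + cut_weight q j r (Suc k)" by fact
  have "?C k = {}" using C(1) by simp
  then show "\<not> (r i k \<le> j \<and> j < r i (Suc k))" for i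
    using gt_beyond[OF r, of i "Suc k"] by (cases "i < length q") auto
qed

text \<open>The involution takes the last column \<open>J\<close> at which dominance fails and the least letter \<open>K\<close>
  for which it fails there, and reflects the letters \<open>K\<close>, \<open>Suc K\<close> before column \<open>J\<close>. After the
  staircase is added, the exponents from column \<open>J\<close> on agree at \<open>K\<close> and \<open>Suc K\<close>, so the
  reflection transposes the total exponent.\<close>

lemma sum_not_dominant:
  assumes p: "p \<turnstile> n" and q: "q \<turnstile> m" and len: "length p \<le> N"
  shows "(\<Sum>r\<in>{r \<in> gt N q. \<not> dominant p q r}. alternant N (part_exp p + staircase N + weight q r)) = 0"
proof -
  define J where "J r = (GREATEST j. \<exists>k. violation p q r j k)" for r
  define K where "K r = (LEAST k. violation p q r (J r) k)" for r
  define \<phi> where "\<phi> r = bk (J r) (K r) r" for r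
  let ?B = "{r \<in> gt N q. \<not> dominant p q r}"
  have bound: "j \<le> part q 0" if "r \<in> gt N q" "violation p q r j k" for r j k
  proof (rule ccontr)
    assume "\<not> j \<le> part q 0"
    then have "cut_weight q j r i = 0" for i by (simp add: cut_weight_eq_0[OF that(1) q])
    then show False using that(2) part_antimono[OF p, of k "Suc k"] by (simp add: violation_def)
  qed
  have J: "violation p q r (J r) (K r)" "\<And>j k. violation p q r j k \<Longrightarrow> j \<le> J r" if rB: "r \<in> ?B" for r
  proof -
    obtain j k where jk: "violation p q r j k" using rB unfolding dominant_def by blast
    have "\<exists>k. violation p q r (J r) k"
      unfolding J_def using GreatestI_nat[of "\<lambda>j. \<exists>k. violation p q r j k" j "part q 0"] jk bound rB by blast
    then show "violation p q r (J r) (K r)" unfolding K_def by (rule LeastI_ex)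
    show "\<And>j k. violation p q r j k \<Longrightarrow> j \<le> J r"
      unfolding J_def using Greatest_le_nat[of "\<lambda>j. \<exists>k. violation p q r j k" _ "part q 0"] bound rB by blast
  qed
  have F: "Suc (K r) < N" "\<And>i. \<not> (r i (K r) \<le> J r \<and> J r < r i (Suc (K r)))"
    "part p (K r) + cut_weight q (J r) r (K r) + 1 = part p (Suc (K r)) + cut_weight q (J r) r (Suc (K r))"
    if "r \<in> ?B" for r
  proof -
    have "\<not> violation p q r (Suc (J r)) (K r)" using J(2)[OF that, of "Suc (J r)" "K r"] by auto
    then show "Suc (K r) < N" "\<And>i. \<not> (r i (K r) \<le> J r \<and> J r < r i (Suc (K r)))"
      "part p (K r) + cut_weight q (J r) r (K r) + 1 = part p (Suc (K r)) + cut_weight q (J r) r (Suc (K r))"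
      using violation_facts[OF _ p len J(1)[OF that]] that by auto
  qed
  \<comment> \<open>The reflection acts only before column \<open>J r\<close>, so it does not affect
    the violations that determine \<open>J\<close> and \<open>K\<close>; hence it can be
    undone.\<close>
  have same: "violation p q (\<phi> r) j k \<longleftrightarrow> violation p q r j k" if "r \<in> ?B" "J r \<le> j" for r j k
    using that by (simp add: violation_def \<phi>_def cut_weight_bk[of r N q])
  have mem: "\<phi> r \<in> ?B" if "r \<in> ?B" for r
    using same[OF that order_refl] J(1)[OF that] bk_mem[OF _ F(1)[OF that]] that
    by (auto simp: \<phi>_def dominant_def)
  have J': "J (\<phi> r) = J r" if "r \<in> ?B" for r
  proof (rule antisym)
    show "J r \<le> J (\<phi> r)" 
      using J(2)[OF mem[OF that]] same[OF that order_refl] J(1)[OF that] by blast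
    then show "J (\<phi> r) \<le> J r"
      using J(1)[OF mem[OF that]] same[OF that] J(2)[OF that] by blast
  qed
  have K': "K (\<phi> r) = K r" if "r \<in> ?B" for r
    using same[OF that order_refl] by (simp add: K_def J'[OF that])
  have inv: "\<phi> (\<phi> r) = r" if "r \<in> ?B" for r
  proof -
    have "\<phi> (\<phi> r) = bk (J r) (K r) (\<phi> r)" by (simp only: \<phi>_def[of "\<phi> r"] J'[OF that] K'[OF that])
    then show ?thesis using bk_bk[of r N q] that by (simp add: \<phi>_def)
  qed
  have neg: "alternant N (part_exp p + staircase N + weight q (\<phi> r)) = - alternant N (part_exp p + staircase N + weight q r)"
    if rB: "r \<in> ?B" for r
  proof -
    let ?v = "part_exp p + staircase N + weight q r" and ?t = "transpose (K r) (Suc (K r))"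
    have r: "r \<in> gt N q" using rB by simp
    note f = F[OF rB]
    have cw: "cut_weight q 0 (\<phi> r) (K r) + cut_weight q (J r) r (Suc (K r)) = cut_weight q 0 r (Suc (K r)) + cut_weight q (J r) r (K r)"
      "cut_weight q 0 (\<phi> r) (Suc (K r)) + cut_weight q (J r) r (K r) = cut_weight q 0 r (K r) + cut_weight q (J r) r (Suc (K r))"
      "m \<noteq> K r \<Longrightarrow> m \<noteq> Suc (K r) \<Longrightarrow> cut_weight q 0 (\<phi> r) m = cut_weight q 0 r m" for m
      using cut_weight_0_bk[OF r f(2) f(1)] by (auto simp: \<phi>_def)
    have \<phi>r: "\<phi> r \<in> gt N q" using mem[OF rB] by simp
    have "part_exp p + staircase N + weight q (\<phi> r) = Poly_Mapping.map_key ?t ?v"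
    proof (rule poly_mapping_eqI)
      fix m
      have N: "N - K r = Suc (N - Suc (K r))" using f(1) by simp
      have "part p m + (N - m) + cut_weight q 0 (\<phi> r) m = part p (?t m) + (N - ?t m) + cut_weight q 0 r (?t m)"
      proof (cases "m = K r \<or> m = Suc (K r)")
        case True
        then show ?thesis
        proof
          assume m: "m = K r"
          then have t: "?t m = Suc (K r)" by simp
          show ?thesis unfolding t unfolding m N using cw(1) f(3) by linarith
        next
          assume m: "m = Suc (K r)"
          then have t: "?t m = K r" by simp
          show ?thesis unfolding t unfolding m N using cw(2) f(3) by linarith
        qed
      qed (simp add: cw(3))
      then show "Poly_Mapping.lookup (part_exp p + staircase N + weight q (\<phi> r)) m = Poly_Mapping.lookup (Poly_Mapping.map_key ?t ?v) m"
        by (simp only: lookup_map_key_permutes[OF transpose_permutes[OF f(1)]] lookup_add lookup_part_exp lookup_staircase lookup_weight[OF r] lookup_weight[OF \<phi>r])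
    qed
    then show ?thesis by (simp add: alternant_transpose[OF f(1)])
  qed
  let ?X = "\<Sum>r\<in>?B. alternant N (part_exp p + staircase N + weight q r)"
  have "?X = (\<Sum>r\<in>?B. alternant N (part_exp p + staircase N + weight q (\<phi> r)))"
    by (rule sum.reindex_bij_witness[where i = \<phi> and j = \<phi>]) (use inv mem in auto)
  also have "\<dots> = (\<Sum>r\<in>?B. - alternant N (part_exp p + staircase N + weight q r))"
    using neg by (rule sum.cong[OF refl])
  also have "\<dots> = - ?X" by (rule sum_negf)
  finally show ?thesis by simp
qed

lemma alternant_part_mult_schur_poly:
  assumes p: "p \<turnstile> n" and q: "q \<turnstile> m" and len: "length p \<le> N"
  shows "alternant N (part_exp p + staircase N) * schur_poly N q =
    (\<Sum>r\<in>{r \<in> gt N q. dominant p q r}. alternant N (part_exp p + staircase N + weight q r))"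
proof -
  have "{r \<in> gt N q. dominant p q r} = gt N q - {r \<in> gt N q. \<not> dominant p q r}" by blast
  then show ?thesis
    using sum_not_dominant[OF p q len] finite_gt[OF q]
    by (simp add: alternant_mult_schur_poly[OF q] sum_diff)
qed

section \<open>The bialternant formula and linear independence\<close>

definition superstandard :: "nat list \<Rightarrow> nat \<Rightarrow> nat \<Rightarrow> nat" where
  "superstandard q i m = (if i < m then part q i else 0)"

lemma Nil_partition: "[] \<turnstile> 0"
  by (simp add: partition_of_def)

lemma part_Nil [simp]: "part [] i = 0"
  by (simp add: part_def)

lemma superstandard_mem:
  assumes "q \<turnstile> m" "length q \<le> N" shows "superstandard q \<in> gt N q"
  using assms part_antimono[OF assms(1)] by (auto simp: gt_def superstandard_def part_beyond)

lemma cut_weight_superstandard: "cut_weight q j (superstandard q) m = part q m - j"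
proof -
  have "cut_weight q j (superstandard q) m = (\<Sum>i<length q. if i = m then part q m - j else 0)"
    unfolding cut_weight_def by (rule sum.cong) (auto simp: superstandard_def)
  then show ?thesis by (simp add: sum.delta part_beyond)
qed

text \<open>\<open>superstandard q\<close> fills row \<open>i\<close> with the letter
  \<open>i\<close>. In the first row \<open>i\<close> that differs, the last cell carries some
  \<open>Suc k\<close> with \<open>k\<close> at least \<open>i\<close>. From its column on there is
  no \<open>k\<close>: the rows above are constant with smaller letters, and the rows from
  \<open>i\<close> on have their letters up to \<open>k\<close> further left. So dominance fails in
  that column.\<close>

lemma dominant_Nil_iff:
  assumes q: "q \<turnstile> m" and len: "length q \<le> N" and r: "r \<in> gt N q"
  shows "dominant [] q r \<longleftrightarrow> r = superstandard q"
proof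
  assume "r = superstandard q"
  then show "dominant [] q r"
    using part_antimono[OF q] by (simp add: dominant_def violation_def cut_weight_superstandard not_less diff_le_mono)
next
  assume d: "dominant [] q r"
  have "\<forall>k>i. r i k = part q i" for i
  proof (induction i rule: less_induct)
    case (less i)
    show ?case
    proof (rule ccontr)
      assume "\<not> (\<forall>k>i. r i k = part q i)"
      then obtain k0 where k0: "i < k0" "r i k0 \<noteq> part q i" by blast
      define l where "l = (GREATEST l. r i l \<noteq> part q i)"
      have b: "l \<le> N" if "r i l \<noteq> part q i" for l
        using gtD(2)[OF r, of l i] that by (meson nat_le_linear)
      have l: "r i l \<noteq> part q i" "r i (Suc l) = part q i" "k0 \<le> l"
        using GreatestI_nat[of "\<lambda>l. r i l \<noteq> part q i" k0 N] Greatest_le_nat[of "\<lambda>l. r i l \<noteq> part q i" _ N] b k0(2)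
        unfolding l_def by (blast, metis Suc_n_not_le_n, blast)
      obtain k where k: "l = Suc k" "i \<le> k" using l(3) k0(1) by (cases l) auto
      define j where "j = part q i - 1"
      have lt: "r i l < part q i" using l(1) gt_le_part[OF r, of i l] by simp
      then have il: "i < length q" using part_pos[OF q, of i] by simp
      have "max (r i' (Suc k)) j - max (r i' k) j = 0" for i'
      proof (cases "i' < i")
        case True then show ?thesis using less.IH[OF True] k(2) by simp
      next
        case False
        then have "r i' (Suc k) \<le> j" using gt_antimono_row[OF r, of i i' "Suc k"] lt k(1) by (simp add: j_def)
        then show ?thesis by simp
      qed
      then have "cut_weight q j r k = 0" by (simp add: cut_weight_def)
      moreover have "0 < cut_weight q j r (Suc k)"
        unfolding cut_weight_def
      proof (rule sum_pos2)
        show "0 < max (r i (Suc (Suc k))) j - max (r i (Suc k)) j"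
          using l(2) lt k(1) by (simp add: j_def)
      qed (use il in auto)
      ultimately have "violation [] q r j k" by (simp add: violation_def)
      then show False using d by (simp add: dominant_def)
    qed
  qed
  then show "r = superstandard q"
    using gt_diag[OF r] by (auto simp: superstandard_def fun_eq_iff)
qed

lemma weight_superstandard:
  assumes q: "q \<turnstile> m" and len: "length q \<le> N" 
  shows "weight q (superstandard q) = part_exp q"
  by (rule poly_mapping_eqI) (simp add: lookup_weight[OF superstandard_mem[OF assms]] cut_weight_superstandard)

text \<open>The case \<open>p = []\<close> of the product expansion, in which a single tableau
  survives.\<close>

lemma bialternant:
  assumes q: "q \<turnstile> m" and len: "length q \<le> N" 
  shows "alternant N (staircase N) * schur_poly N q = alternant N (part_exp q + staircase N)"
proof -
  have pe: "part_exp [] = 0" by (rule poly_mapping_eqI) simp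
  have "{r \<in> gt N q. dominant [] q r} = {superstandard q}"
    using dominant_Nil_iff[OF assms] superstandard_mem[OF assms] by blast
  then show ?thesis
    using alternant_part_mult_schur_poly[OF Nil_partition q, of N]
    by (simp add: pe weight_superstandard[OF assms] add.commute)
qed

lemma permutes_strict_mono_id:
  assumes w: "w permutes {..<N::nat}" and mono: "\<And>i j. i < j \<Longrightarrow> j < N \<Longrightarrow> w i < w j"
  shows "w = id"
proof -
  have "w i = i" if "i < N" for i
    using that
  proof (induction i rule: less_induct)
    case (less i)
    have iN: "w i < N" using permutes_in_image[OF w, of i] less by simp
    have "\<not> w i < i"
    proof
      assume "w i < i"
      then have "w (w i) = w i" using less by simp
      then show False using \<open>w i < i\<close> permutes_inj[OF w] by (metis injD less_irrefl)
    qed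
    moreover have "\<not> i < w i"
    proof
      assume i: "i < w i"
      obtain i' where i': "w i' = i" using permutes_surj[OF w] by (metis surjD)
      then have "i' < N" using permutes_in_image[OF w, of i'] less by simp
      then show False using i i' mono[of i i'] less.IH[of i'] by (cases i i' rule: linorder_cases) auto
    qed
    ultimately show ?case by simp
  qed
  then show ?thesis using w unfolding permutes_def by (intro ext) (metis id_apply lessThan_iff)
qed

text \<open>Both exponents decrease strictly on the first \<open>N\<close> positions, so a
  permutation that matches them is increasing, hence the identity. Leading exponents thus separate
  partitions.\<close>

lemma lookup_alternant:
  assumes p: "p \<turnstile> n" and q: "q \<turnstile> m"
  shows "Poly_Mapping.lookup (alternant N (part_exp p + staircase N)) (part_exp q + staircase N) = (if p = q then 1 else 0)"
proof -
  have dec: "Poly_Mapping.lookup (part_exp s + staircase N) j < Poly_Mapping.lookup (part_exp s + staircase N) i"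
    if "i < j" "j < N" "s \<turnstile> l" for i j s l
    using that part_antimono[OF that(3), of i j] by (simp add: lookup_add)
  have "w = id" if w: "w permutes {..<N}" and eq: "Poly_Mapping.map_key w (part_exp p + staircase N) = part_exp q + staircase N" for w
  proof (rule permutes_strict_mono_id[OF w])
    fix i j assume ij: "i < j" "j < N"
    have wN: "w i < N" "w j < N" using permutes_in_image[OF w] ij by auto
    have "w i \<noteq> w j" using permutes_inj[OF w] ij by (metis injD less_irrefl)
    moreover have "\<not> w j < w i"
      using dec[OF _ wN(1) p, of "w j"] dec[OF ij q] unfolding eq[symmetric] lookup_map_key_permutes[OF w] by auto
    ultimately show "w i < w j" by simp
  qed
  moreover have "Poly_Mapping.map_key id (part_exp p + staircase N) = part_exp q + staircase N \<longleftrightarrow> p = q"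
    using part_exp_eq_iff[OF p q] by (simp add: id_def map_key_id)
  ultimately have "{w. w permutes {..<N} \<and> Poly_Mapping.map_key w (part_exp p + staircase N) = part_exp q + staircase N} = (if p = q then {id} else {})"
    using permutes_id[of "{..<N}"] by (auto simp del: id_apply)
  moreover have "Poly_Mapping.lookup (alternant N (part_exp p + staircase N)) (part_exp q + staircase N) =
    (\<Sum>w | w permutes {..<N} \<and> Poly_Mapping.map_key w (part_exp p + staircase N) = part_exp q + staircase N. sign w)"
    by (simp add: alternant_def lookup_sum lookup_single when_def sum.If_cases Int_def)
  ultimately show ?thesis by simp
qed

lemma alternant_staircase_neq_0: "alternant N (staircase N) \<noteq> 0"
proof -
  have pe: "part_exp [] = 0" by (rule poly_mapping_eqI) simp
  have "Poly_Mapping.lookup (alternant N (staircase N)) (staircase N) = 1"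
    using lookup_alternant[OF Nil_partition Nil_partition, of N] by (simp add: pe)
  then show ?thesis by auto
qed

lemma lookup_of_int_mult: "Poly_Mapping.lookup (of_int c * (f :: mpoly)) a = c * Poly_Mapping.lookup f a"
proof -
  have "of_int c = (Poly_Mapping.single 0 c :: mpoly)"
    by (metis single_of_int of_int_eq_id id_apply)
  then have "of_int c * f = Poly_Mapping.map ((*) c) f"
    by (simp only: mult_map_scale_conv_mult)
  then show ?thesis by (simp only: map.rep_eq) (simp add: when_def)
qed

text \<open>Multiplication by the staircase alternant turns the relation into one between
  alternants, whose leading exponents differ.\<close>

lemma schur_poly_independent:
  assumes fin: "finite X" and X: "\<And>p. p \<in> X \<Longrightarrow> \<exists>n. p \<turnstile> n" "\<And>p. p \<in> X \<Longrightarrow> length p \<le> N"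
    and 0: "(\<Sum>p\<in>X. of_int (c p) * schur_poly N p) = 0" and q: "q \<in> X"
  shows "c q = 0"
proof -
  have "0 = alternant N (staircase N) * (\<Sum>p\<in>X. of_int (c p) * schur_poly N p)" by (simp add: 0)
  also have "\<dots> = (\<Sum>p\<in>X. of_int (c p) * (alternant N (staircase N) * schur_poly N p))"
    by (simp add: sum_distrib_left algebra_simps)
  also have "\<dots> = (\<Sum>p\<in>X. of_int (c p) * alternant N (part_exp p + staircase N))"
    using X bialternant by (intro sum.cong refl) metis
  finally have *: "0 = (\<Sum>p\<in>X. of_int (c p) * alternant N (part_exp p + staircase N))" .
  have "0 = (\<Sum>p\<in>X. Poly_Mapping.lookup (of_int (c p) * alternant N (part_exp p + staircase N)) (part_exp q + staircase N))"
    using arg_cong[OF *, of "\<lambda>f. Poly_Mapping.lookup f (part_exp q + staircase N)"] 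
    by (simp only: lookup_sum lookup_zero)
  also have "\<dots> = (\<Sum>p\<in>X. c p * Poly_Mapping.lookup (alternant N (part_exp p + staircase N)) (part_exp q + staircase N))"
    by (simp only: lookup_of_int_mult)
  also have "\<dots> = (\<Sum>p\<in>X. if p = q then c p else 0)"
  proof (rule sum.cong[OF refl])
    fix p assume "p \<in> X"
    then obtain n m where "p \<turnstile> n" "q \<turnstile> m" using X(1) q by metis
    then show "c p * Poly_Mapping.lookup (alternant N (part_exp p + staircase N)) (part_exp q + staircase N) = (if p = q then c p else 0)"
      by (simp add: lookup_alternant)
  qed
  also have "\<dots> = c q" using q fin by simp
  finally show ?thesis by simp
qed

section \<open>The Littlewood--Richardson rule\<close>

lemma exp_total_add: "exp_total (a + b) = exp_total a + exp_total b"
proof -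
  let ?A = "Poly_Mapping.keys a \<union> Poly_Mapping.keys b \<union> Poly_Mapping.keys (a + b)"
  have "finite ?A" by simp
  then have "exp_total x = (\<Sum>i\<in>?A. Poly_Mapping.lookup x i)" if "x \<in> {a, b, a + b}" for x
    using that by (intro exp_total_eq_sum) auto
  then show ?thesis by (simp add: lookup_add sum.distrib)
qed

lemma exp_total_part_exp:
  assumes "p \<turnstile> n" shows "exp_total (part_exp p) = n"
proof -
  have "Poly_Mapping.keys (part_exp p) \<subseteq> {..<length p}"
    by (auto simp: in_keys_iff part_def split: if_splits)
  then show ?thesis
    using exp_total_eq_sum[of "{..<length p}" "part_exp p"] sum_part_partition[OF assms order_refl] by simp
qed

text \<open>The Littlewood--Richardson count; its dependence on the number of variables
  \<open>N\<close> disappears in \<open>lr_num_stable\<close>.\<close>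

definition lr_num :: "nat \<Rightarrow> nat list \<Rightarrow> nat list \<Rightarrow> nat list \<Rightarrow> nat" where
  "lr_num N p q s = card {r \<in> gt N q. dominant p q r \<and> part_exp p + weight q r = part_exp s}"

lemma lr_num_partition:
  assumes "p \<turnstile> k" "q \<turnstile> l" "s \<turnstile> n" "lr_num N p q s \<noteq> 0"
  shows "n = k + l"
proof -
  from assms(4) have "{r \<in> gt N q. dominant p q r \<and> part_exp p + weight q r = part_exp s} \<noteq> {}"
    unfolding lr_num_def using card.empty by metis
  then obtain r where r: "r \<in> gt N q" "part_exp p + weight q r = part_exp s" by blast
  then show ?thesis
    using exp_total_part_exp[OF assms(1)] exp_total_part_exp[OF assms(3)] exp_total_weight[OF r(1) assms(2)] exp_total_add[of "part_exp p" "weight q r"]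
    by simp
qed

text \<open>Dominance at column \<open>0\<close> makes the total exponent a partition, so each
  surviving alternant belongs to a Schur polynomial. Grouping by that partition and cancelling the
  staircase alternant leaves the product.\<close>

lemma schur_poly_mult_lr_num:
  assumes p: "p \<turnstile> k" and q: "q \<turnstile> l" and N: "k + l \<le> N"
  shows "schur_poly N p * schur_poly N q = (\<Sum>s\<in>partitions_upto (k + l). of_int (int (lr_num N p q s)) * schur_poly N s)"
proof -
  let ?G = "{r \<in> gt N q. dominant p q r}" and ?P = "partitions_upto (k + l)"
  let ?h = "\<lambda>r. part_exp p + weight q r" and ?a = "alternant N (staircase N)"
  have len: "length p \<le> N" using partition_length_le[OF p] N by simp
  have ex: "\<exists>s. s \<turnstile> k + l \<and> part_exp s = ?h r" if r: "r \<in> ?G" for r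
  proof -
    have rg: "r \<in> gt N q" using r by simp
    let ?g = "\<lambda>i. Poly_Mapping.lookup (?h r) i"
    have g: "?g i = part p i + cut_weight q 0 r i" for i by (simp add: lookup_add lookup_weight[OF rg])
    have anti: "?g (Suc i) \<le> ?g i" for i
      using r unfolding g by (auto simp: dominant_def violation_def not_less)
    have g0: "?g N = 0" unfolding g using len by (simp add: part_beyond cut_weight_beyond[OF rg])
    obtain s where s: "s \<turnstile> (\<Sum>i<N. ?g i)" "part s = ?g" using partition_exI[of ?g N, OF anti g0] .
    have "(\<Sum>i<N. ?g i) = k + l"
      using exp_total_eq_sum[of "{..<N}" "weight q r"] keys_weight[OF rg] exp_total_weight[OF rg q] sum_part_partition[OF p len]
      by (simp add: lookup_add sum.distrib)
    moreover have "part_exp s = ?h r" by (rule poly_mapping_eqI) (simp add: s(2))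
    ultimately show ?thesis using s(1) by auto
  qed
  define sh where "sh r = (SOME s. s \<turnstile> k + l \<and> part_exp s = ?h r)" for r
  have sh: "sh r \<turnstile> k + l" "part_exp (sh r) = ?h r" if "r \<in> ?G" for r
    using someI_ex[OF ex[OF that]] by (auto simp: sh_def)
  have shs: "sh r = s \<longleftrightarrow> ?h r = part_exp s" if r: "r \<in> ?G" and s: "s \<in> ?P" for r s
    using sh[OF r] s part_exp_eq_iff[OF sh(1)[OF r]] by (auto simp: partitions_upto_def)
  have "?a * (schur_poly N p * schur_poly N q) = (\<Sum>r\<in>?G. alternant N (part_exp p + staircase N + weight q r))"
    using partition_length_le[OF p] N
    by (simp add: mult.assoc[symmetric] bialternant[OF p len] alternant_part_mult_schur_poly[OF p q len])
  also have "\<dots> = (\<Sum>r\<in>?G. alternant N (?h r + staircase N))" by (simp add: ac_simps)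
  also have "\<dots> = (\<Sum>s\<in>?P. \<Sum>r\<in>{r \<in> ?G. sh r = s}. alternant N (?h r + staircase N))"
    using sh finite_gt[OF q] by (intro sum.group[symmetric]) (auto intro: partitions_uptoI)
  also have "\<dots> = (\<Sum>s\<in>?P. of_int (int (lr_num N p q s)) * alternant N (part_exp s + staircase N))"
  proof (rule sum.cong[OF refl])
    fix s assume s: "s \<in> ?P"
    have eq: "{r \<in> ?G. sh r = s} = {r \<in> gt N q. dominant p q r \<and> ?h r = part_exp s}"
      using shs[OF _ s] by blast
    show "(\<Sum>r\<in>{r \<in> ?G. sh r = s}. alternant N (?h r + staircase N)) = of_int (int (lr_num N p q s)) * alternant N (part_exp s + staircase N)"
      unfolding eq lr_num_def by simp
  qed
  also have "\<dots> = (\<Sum>s\<in>?P. of_int (int (lr_num N p q s)) * (?a * schur_poly N s))"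
  proof (rule sum.cong[OF refl])
    fix s assume "s \<in> ?P"
    then obtain n where "s \<turnstile> n" "n \<le> k + l" by (auto simp: partitions_upto_def)
    then show "of_int (int (lr_num N p q s)) * alternant N (part_exp s + staircase N) = of_int (int (lr_num N p q s)) * (?a * schur_poly N s)"
      using bialternant[of s n N] partition_length_le[of s n] N by simp
  qed
  also have "\<dots> = ?a * (\<Sum>s\<in>?P. of_int (int (lr_num N p q s)) * schur_poly N s)"
    by (simp only: sum_distrib_left mult.left_commute)
  finally show ?thesis using alternant_staircase_neq_0[of N] by simp
qed

text \<open>Over an infinite index set the sum in \<open>mseries_mult\<close> would default to
  \<open>0\<close>. Both summands of \<open>a\<close> are supported on its keys and bounded by its
  degree.\<close>

lemma finite_exp_add: "finite {(b, c). b + c = (a :: nat \<Rightarrow>\<^sub>0 nat)}"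
proof -
  let ?F = "{f :: nat \<Rightarrow> nat. \<forall>x. (x \<in> Poly_Mapping.keys a \<longrightarrow> f x \<in> {..exp_total a}) \<and> (x \<notin> Poly_Mapping.keys a \<longrightarrow> f x = 0)}"
  have fin: "finite ?F" by (rule finite_set_of_finite_funs) auto
  have le: "Poly_Mapping.lookup a x \<le> exp_total a" for x
    unfolding exp_total_def by (cases "x \<in> Poly_Mapping.keys a") (auto intro: member_le_sum simp: in_keys_iff)
  have sub: "(\<lambda>(b, c). (Poly_Mapping.lookup b, Poly_Mapping.lookup c)) ` {(b, c). b + c = a} \<subseteq> ?F \<times> ?F"
  proof -
    have "Poly_Mapping.lookup b \<in> ?F \<and> Poly_Mapping.lookup c \<in> ?F" if "b + c = a" for b c
    proof -
      have eq: "Poly_Mapping.lookup a x = Poly_Mapping.lookup b x + Poly_Mapping.lookup c x" for x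
        using that by (auto simp: lookup_add)
      have "Poly_Mapping.lookup b x \<le> exp_total a \<and> Poly_Mapping.lookup c x \<le> exp_total a" for x
        using le[of x] eq[of x] by linarith
      then show ?thesis using eq by (auto simp: in_keys_iff)
    qed
    then show ?thesis by auto
  qed
  have "inj_on (\<lambda>(b, c). (Poly_Mapping.lookup b, Poly_Mapping.lookup c)) {(b, c). b + c = a}"
    by (rule inj_onI) (clarsimp simp: poly_mapping.lookup_inject)
  then show ?thesis using finite_subset[OF sub] fin by (blast intro: finite_imageD finite_cartesian_product)
qed

lemma lookup_mult_eq_mseries_mult:
  "Poly_Mapping.lookup (f * g :: mpoly) a = mseries_mult (Poly_Mapping.lookup f) (Poly_Mapping.lookup g) a"
proof -
  have "Poly_Mapping.lookup (f * g) a = (\<Sum>(b, c). Poly_Mapping.lookup f b * Poly_Mapping.lookup g c when a = b + c)"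
    unfolding times_poly_mapping.rep_eq by (rule prod_fun_unfold_prod) auto
  also have "\<dots> = (\<Sum>(b, c)\<in>{(b, c). b + c = a}. Poly_Mapping.lookup f b * Poly_Mapping.lookup g c when a = b + c)"
    by (rule Sum_any.expand_superset[OF finite_exp_add]) auto
  also have "\<dots> = mseries_mult (Poly_Mapping.lookup f) (Poly_Mapping.lookup g) a"
    unfolding mseries_mult_def by (rule sum.cong) auto
  finally show ?thesis .
qed

lemma keys_add_nat: "Poly_Mapping.keys (b + c) = Poly_Mapping.keys b \<union> Poly_Mapping.keys (c :: nat \<Rightarrow>\<^sub>0 nat)"
  by (auto simp: in_keys_iff lookup_add)

text \<open>Exponents cannot cancel: the two factors of a monomial in the first \<open>N\<close>
  variables use only these variables, so truncation to them respects products.\<close>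

lemma lookup_schur_poly_mult:
  assumes "p \<turnstile> k" "q \<turnstile> l" "Poly_Mapping.keys a \<subseteq> {..<N}"
  shows "Poly_Mapping.lookup (schur_poly N p * schur_poly N q) a = mseries_mult (schur p) (schur q) a"
  unfolding lookup_mult_eq_mseries_mult unfolding mseries_mult_def
  using assms(3) by (intro sum.cong refl) (auto simp: lookup_schur_poly[OF assms(1)] lookup_schur_poly[OF assms(2)] keys_add_nat)

lemma lookup_schur_poly_sum:
  assumes "\<And>p. p \<in> X \<Longrightarrow> \<exists>n. p \<turnstile> n"
  shows "Poly_Mapping.lookup (\<Sum>p\<in>X. of_int (c p) * schur_poly N p) a = (if Poly_Mapping.keys a \<subseteq> {..<N} then \<Sum>p\<in>X. c p * schur p a else 0)"
proof -
  have "Poly_Mapping.lookup (of_int (c p) * schur_poly N p) a = (if Poly_Mapping.keys a \<subseteq> {..<N} then c p * schur p a else 0)" if pX: "p \<in> X" for p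
  proof -
    obtain n where "p \<turnstile> n" using assms[OF pX] by blast
    then show ?thesis by (simp add: lookup_of_int_mult lookup_schur_poly)
  qed
  then show ?thesis by (simp add: lookup_sum)
qed

text \<open>Comparing monomials in the first \<open>N\<close> variables is enough for partitions
  with at most \<open>N\<close> parts. All later comparisons of coefficients rest on this.\<close>

lemma schur_independent:
  assumes "finite X" "\<And>p. p \<in> X \<Longrightarrow> \<exists>n. p \<turnstile> n" "\<And>p. p \<in> X \<Longrightarrow> length p \<le> N"
    and 0: "\<And>a. Poly_Mapping.keys a \<subseteq> {..<N} \<Longrightarrow> (\<Sum>p\<in>X. c p * schur p a) = (\<Sum>p\<in>X. d p * schur p a)" and "q \<in> X"
  shows "c q = d q"
proof -
  have "(\<Sum>p\<in>X. of_int (c p - d p) * schur_poly N p) = 0"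
    by (rule poly_mapping_eqI)
      (use 0 in \<open>auto simp: lookup_schur_poly_sum[OF assms(2)] left_diff_distrib sum_subtractf simp del: of_int_diff\<close>)
  from schur_poly_independent[OF assms(1-3) this assms(5)] show ?thesis by simp
qed

lemma partitions_upto_props:
  "p \<in> partitions_upto n \<Longrightarrow> \<exists>k. p \<turnstile> k" "p \<in> partitions_upto n \<Longrightarrow> n \<le> N \<Longrightarrow> length p \<le> N"
  using partition_length_le by (fastforce simp: partitions_upto_def)+

lemma lookup_schur_poly_sum_upto:
  assumes "Poly_Mapping.keys a \<subseteq> {..<N}"
  shows "Poly_Mapping.lookup (\<Sum>p\<in>partitions_upto n. of_int (c p) * schur_poly N p) a = (\<Sum>p\<in>partitions_upto n. c p * schur p a)"
  using lookup_schur_poly_sum[of "partitions_upto n" c N a] partitions_upto_props(1) assms by simp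

lemma mseries_mult_lr_num:
  assumes p: "p \<turnstile> k" and q: "q \<turnstile> l" and N: "k + l \<le> N" and a: "Poly_Mapping.keys a \<subseteq> {..<N}"
  shows "mseries_mult (schur p) (schur q) a = (\<Sum>s\<in>partitions_upto (k + l). int (lr_num N p q s) * schur s a)"
  unfolding lookup_schur_poly_mult[OF p q a, symmetric] schur_poly_mult_lr_num[OF p q N]
  by (rule lookup_schur_poly_sum_upto[OF a])

text \<open>Both counts expand the same product, and on monomials in the first \<open>k + l\<close>
  variables independence already forces them to agree.\<close>

lemma lr_num_stable:
  assumes "p \<turnstile> k" "q \<turnstile> l" "k + l \<le> N" "s \<in> partitions_upto (k + l)"
  shows "int (lr_num N p q s) = int (lr_num (k + l) p q s)"
proof (rule schur_independent[of "partitions_upto (k + l)" "k + l"])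
  fix a :: "nat \<Rightarrow>\<^sub>0 nat" assume a: "Poly_Mapping.keys a \<subseteq> {..<k + l}"
  moreover have "Poly_Mapping.keys a \<subseteq> {..<N}" using a assms(3) by auto
  ultimately show "(\<Sum>s\<in>partitions_upto (k + l). int (lr_num N p q s) * schur s a) = (\<Sum>s\<in>partitions_upto (k + l). int (lr_num (k + l) p q s) * schur s a)"
    using mseries_mult_lr_num[OF assms(1-3)] mseries_mult_lr_num[OF assms(1,2) order_refl] by metis
qed (use assms partitions_upto_props in auto)

text \<open>This resolves the definite description. The counts give an expansion; a competing one
  has finite support, so all partitions involved fit into some number \<open>M\<close> of variables,
  where independence applies.\<close>

lemma lr_coeff_eq:
  assumes p: "p \<turnstile> k" and q: "q \<turnstile> l" and N: "k + l \<le> N"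
  shows "lr_coeff p q s = (if s \<in> partitions_upto (k + l) then int (lr_num N p q s) else 0)"
proof -
  define c where "c s = (if s \<in> partitions_upto (k + l) then int (lr_num (k + l) p q s) else 0)" for s
  have expand: "(\<Sum>s | d s \<noteq> 0. d s * schur s a) = (\<Sum>s\<in>X. d s * schur s a)" if "finite X" "{s. d s \<noteq> 0} \<subseteq> X" for d :: "nat list \<Rightarrow> int" and X a
    by (rule sum.mono_neutral_left[OF that]) simp
  have c_sub: "{s. c s \<noteq> 0} \<subseteq> partitions_upto (k + l)" by (auto simp: c_def)
  have c: "mseries_mult (schur p) (schur q) a = (\<Sum>s | c s \<noteq> 0. c s * schur s a)" for a
  proof -
    obtain M where M: "Poly_Mapping.keys a \<subseteq> {..<M}"
      using finite_nat_set_iff_bounded[of "Poly_Mapping.keys a"] by auto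
    then have a: "Poly_Mapping.keys a \<subseteq> {..<max M (k + l)}" by auto
    show ?thesis
      unfolding expand[OF finite_partitions_upto c_sub] mseries_mult_lr_num[OF p q max.cobounded2 a]
    proof (rule sum.cong[OF refl])
      fix s assume "s \<in> partitions_upto (k + l)"
      then show "int (lr_num (max M (k + l)) p q s) * schur s a = c s * schur s a"
        using lr_num_stable[OF p q max.cobounded2, of s M] by (simp add: c_def)
    qed
  qed
  have "lr_coeff p q = c"
    unfolding lr_coeff_def
  proof (rule the_equality, intro conjI)
    show "finite {s. c s \<noteq> 0}" by (rule finite_subset[OF c_sub]) simp
    show "\<forall>s. c s \<noteq> 0 \<longrightarrow> (\<exists>n. s \<turnstile> n)" by (auto simp: c_def partitions_upto_def)
    show "\<forall>a. mseries_mult (schur p) (schur q) a = (\<Sum>s | c s \<noteq> 0. c s * schur s a)" using c by blast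
  next
    fix d assume d: "finite {s. d s \<noteq> 0} \<and> (\<forall>s. d s \<noteq> 0 \<longrightarrow> (\<exists>n. s \<turnstile> n)) \<and>
      (\<forall>a. mseries_mult (schur p) (schur q) a = (\<Sum>s | d s \<noteq> 0. d s * schur s a))"
    let ?X = "{s. d s \<noteq> 0} \<union> partitions_upto (k + l)"
    have fin: "finite ?X" using d by simp
    obtain M where M: "\<And>s. s \<in> ?X \<Longrightarrow> length s \<le> M"
      using finite_nat_set_iff_bounded_le[of "length ` ?X"] fin by auto
    have "d s = c s" if s: "s \<in> ?X" for s
    proof (rule schur_independent[OF fin _ M _ s])
      show "\<exists>n. s \<turnstile> n" if "s \<in> ?X" for s using that d partitions_upto_props(1) by blast
      fix a :: "nat \<Rightarrow>\<^sub>0 nat"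
      have "(\<Sum>s\<in>?X. d s * schur s a) = (\<Sum>s | d s \<noteq> 0. d s * schur s a)"
        by (rule expand[OF fin, symmetric]) blast
      also have "\<dots> = (\<Sum>s | c s \<noteq> 0. c s * schur s a)" using d c by metis
      also have "\<dots> = (\<Sum>s\<in>?X. c s * schur s a)" by (rule expand[OF fin]) (use c_sub in blast)
      finally show "(\<Sum>s\<in>?X. d s * schur s a) = (\<Sum>s\<in>?X. c s * schur s a)" .
    qed
    moreover have "d s = c s" if "s \<notin> ?X" for s using that by (simp add: c_def)
    ultimately show "d = c" by blast
  qed
  then show ?thesis using lr_num_stable[OF p q N, of s] by (simp add: c_def)
qed

lemma lr_coeff_nonneg: "p \<turnstile> k \<Longrightarrow> q \<turnstile> l \<Longrightarrow> 0 \<le> lr_coeff p q s"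
  by (simp add: lr_coeff_eq[OF _ _ order_refl])

lemma lr_coeff_partition:
  assumes "p \<turnstile> k" "q \<turnstile> l" "lr_coeff p q s \<noteq> 0" shows "s \<turnstile> k + l"
proof -
  from assms(3) obtain n where n: "s \<turnstile> n" "lr_num (k + l) p q s \<noteq> 0"
    by (auto simp: lr_coeff_eq[OF assms(1,2) order_refl] partitions_upto_def split: if_splits)
  then show ?thesis using lr_num_partition[OF assms(1,2) n(1,2)] by simp
qed

lemma schur_poly_mult:
  assumes "p \<turnstile> k" "q \<turnstile> l" "k + l \<le> N" "k + l \<le> m"
  shows "schur_poly N p * schur_poly N q = (\<Sum>s\<in>partitions_upto m. of_int (lr_coeff p q s) * schur_poly N s)"
proof -
  have "schur_poly N p * schur_poly N q = (\<Sum>s\<in>partitions_upto (k + l). of_int (lr_coeff p q s) * schur_poly N s)"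
    unfolding schur_poly_mult_lr_num[OF assms(1-3)] by (simp add: lr_coeff_eq[OF assms(1-3)])
  also have "\<dots> = (\<Sum>s\<in>partitions_upto m. of_int (lr_coeff p q s) * schur_poly N s)"
    using partitions_upto_mono[OF assms(4)] by (intro sum.mono_neutral_left) (auto simp: lr_coeff_eq[OF assms(1-3)])
  finally show ?thesis .
qed

lemma schur_mult:
  assumes "p \<turnstile> k" "q \<turnstile> l" "k + l \<le> m"
  shows "mseries_mult (schur p) (schur q) a = (\<Sum>s\<in>partitions_upto m. lr_coeff p q s * schur s a)"
proof -
  obtain M where M: "Poly_Mapping.keys a \<subseteq> {..<M}"
    using finite_nat_set_iff_bounded[of "Poly_Mapping.keys a"] by auto
  then have a: "Poly_Mapping.keys a \<subseteq> {..<max M (k + l)}" by auto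
  show ?thesis
    unfolding lookup_schur_poly_mult[OF assms(1,2) a, symmetric] schur_poly_mult[OF assms(1,2) max.cobounded2 assms(3)]
    by (rule lookup_schur_poly_sum_upto[OF a])
qed

section \<open>The Pieri rule and the coproduct\<close>

text \<open>The shape of the complete homogeneous function of degree \<open>r\<close>; since
  partitions have no zero parts, degree \<open>0\<close> is the empty list.\<close>

definition row_part :: "nat \<Rightarrow> nat list" where
  "row_part r = (if r = 0 then [] else [r])"

definition horizontal_strip :: "nat list \<Rightarrow> nat list \<Rightarrow> bool" where
  "horizontal_strip p q \<longleftrightarrow> (\<forall>i. part p i \<le> part q i \<and> part q (Suc i) \<le> part p i)"

lemma row_partition: "row_part r \<turnstile> r"
  by (auto simp: row_part_def partition_of_def)

lemma part_row: "part (row_part r) i = (if i = 0 then r else 0)"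
  by (auto simp: row_part_def part_def)

lemma cut_weight_row:
  assumes "g \<in> gt N (row_part r)"
  shows "cut_weight (row_part r) j g m = max (g 0 (Suc m)) j - max (g 0 m) j"
proof (cases "r = 0")
  case True
  have "g 0 m' = 0" for m' using gt_le_part[OF assms, of 0 m'] True by (simp add: part_row)
  then show ?thesis using True by (simp add: cut_weight_def row_part_def)
qed (simp add: cut_weight_def row_part_def)

text \<open>A one-row tableau is determined by its content, here the difference of \<open>s\<close>
  and \<open>p\<close>. Cutting the row where its letters above \<open>i\<close> begin leaves every
  \<open>Suc i\<close> and no \<open>i\<close> to the right, and dominance there is the strip
  condition.\<close>

lemma pieri_count:
  assumes p: "p \<turnstile> k" and s: "s \<turnstile> k + r" and N: "k + r \<le> N"
  shows "{g \<in> gt N (row_part r). dominant p (row_part r) g \<and> part_exp p + weight (row_part r) g = part_exp s} =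
    (if horizontal_strip p s then {\<lambda>i m. if i = 0 then \<Sum>m'<m. part s m' - part p m' else 0} else {})"
    (is "?G = (if _ then {?g0} else {})")
proof -
  have lenp: "length p \<le> N" using partition_length_le[OF p] N by simp
  have lens: "length s \<le> N" using partition_length_le[OF s] N by simp
  have G: "part p m + (g 0 (Suc m) - g 0 m) = part s m" if "g \<in> ?G" for g m
  proof -
    have g: "g \<in> gt N (row_part r)" and eq: "part_exp p + weight (row_part r) g = part_exp s" using that by auto
    from arg_cong[OF eq, of "\<lambda>v. Poly_Mapping.lookup v m"] show ?thesis
      by (simp add: lookup_add lookup_weight[OF g] cut_weight_row[OF g])
  qed
  have uniq: "g = ?g0" if gG: "g \<in> ?G" for g
  proof (intro ext)
    fix i m
    have g: "g \<in> gt N (row_part r)" using gG by simp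
    show "g i m = ?g0 i m"
    proof (cases "i = 0")
      case True
      have "g 0 m = (\<Sum>m'<m. part s m' - part p m')"
      proof (induction m)
        case 0 then show ?case by (simp add: gtD(1)[OF g])
      next
        case (Suc m) then show ?case using G[OF gG, of m] gtD(3)[OF g, of 0 m] by simp
      qed
      then show ?thesis using True by simp
    next
      case False then show ?thesis using gt_le_part[OF g, of i m] by (simp add: part_row)
    qed
  qed
  have hs: "horizontal_strip p s" if gG: "g \<in> ?G" for g
    unfolding horizontal_strip_def
  proof (intro allI conjI)
    fix i
    have g: "g \<in> gt N (row_part r)" using gG by simp
    show "part p i \<le> part s i" using G[OF gG, of i] by simp
    have "\<not> violation p (row_part r) g (g 0 (Suc i)) i" using gG by (simp add: dominant_def)
    then show "part s (Suc i) \<le> part p i"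
      using G[OF gG, of "Suc i"] gtD(3)[OF g, of 0 i] gtD(3)[OF g, of 0 "Suc i"]
      by (simp add: violation_def cut_weight_row[OF g] not_less)
  qed
  have "?g0 \<in> ?G" if hs: "horizontal_strip p s"
  proof -
    have le: "part p i \<le> part s i" and il: "part s (Suc i) \<le> part p i" for i
      using hs by (auto simp: horizontal_strip_def)
    have N': "(\<Sum>m'<m. part s m' - part p m') = r" if "N \<le> m" for m
    proof -
      have "(\<Sum>m'<m. part s m' - part p m') = (\<Sum>m'<m. part s m') - (\<Sum>m'<m. part p m')"
        using le by (intro sum_subtractf_nat) auto
      then show ?thesis using sum_part_partition[OF p, of m] sum_part_partition[OF s, of m] lenp lens that by simp
    qed
    have g: "?g0 \<in> gt N (row_part r)"
      using N' by (auto simp: gt_def part_row)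
    have w: "part_exp p + weight (row_part r) ?g0 = part_exp s"
      by (rule poly_mapping_eqI) (simp add: lookup_add lookup_weight[OF g] cut_weight_row[OF g] le)
    have "\<not> violation p (row_part r) ?g0 j i" for i j
    proof -
      have "cut_weight (row_part r) j ?g0 (Suc i) \<le> part s (Suc i) - part p (Suc i)"
        by (simp add: cut_weight_row[OF g])
      then show ?thesis using il[of i] le[of "Suc i"] by (simp add: violation_def not_less)
    qed
    then show ?thesis using g w by (simp add: dominant_def)
  qed
  then show ?thesis using uniq hs by (auto split: if_splits)
qed

lemma pieri:
  assumes p: "p \<turnstile> k" and s: "s \<turnstile> k + r"
  shows "lr_coeff p (row_part r) s = (if horizontal_strip p s then 1 else 0)"
  using pieri_count[OF p s order_refl] partitions_uptoI[OF s order_refl]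
  unfolding lr_coeff_eq[OF p row_partition order_refl] lr_num_def by (simp split: if_splits)

lemma cut_weight_0_eq:
  assumes "r \<in> gt N p" "length p \<le> L"
  shows "cut_weight p 0 r m = (\<Sum>i<L. r i (Suc m) - r i m)"
  unfolding cut_weight_def using assms(2)
  by (intro sum.mono_neutral_cong_left) (auto simp: gt_beyond[OF assms(1)])

lemma horizontal_strip_length:
  assumes "horizontal_strip p q" "p \<turnstile> n" shows "length p \<le> length q"
proof -
  have "i < length q" if "i < length p" for i
    using assms(1) part_pos[OF assms(2), of i] that unfolding horizontal_strip_def
    by (metis le_zero_eq less_irrefl not_le part_beyond)
  then show ?thesis by (meson leI less_irrefl)
qed

text \<open>Erasing the largest letter \<open>M\<close> from a tableau of shape \<open>q\<close>
  leaves a shape \<open>p\<close>, and interlacing of the last two levels says that the erased cells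
  form a horizontal strip. \<open>sh\<close> is the shape left, \<open>tr\<close> truncates the
  pattern and \<open>ex\<close> restores it.\<close>

lemma kostka_rec:
  assumes q: "q \<turnstile> n" and n: "exp_total a + r = n" and a: "Poly_Mapping.keys a \<subseteq> {..<M}" and m: "n \<le> m"
  shows "schur q (a + Poly_Mapping.single M r) = (\<Sum>p | p \<in> partitions_upto m \<and> horizontal_strip p q. schur p a)"
proof -
  let ?b = "a + Poly_Mapping.single M r"
  let ?P = "{p \<in> partitions_upto m. horizontal_strip p q}"
  let ?A = "{g \<in> gt (Suc M) q. weight q g = ?b}"
  let ?B = "\<lambda>p. {g \<in> gt M p. weight p g = a}"
  have keys: "Poly_Mapping.keys ?b \<subseteq> {..<Suc M}"
    unfolding keys_add_nat using a by (auto split: if_splits)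
  have aM: "Poly_Mapping.lookup a i = 0" if "M \<le> i" for i
    using a that by (auto simp: in_keys_iff)
  define tr where "tr g = (\<lambda>i m. g i (min m M))" for g :: "nat \<Rightarrow> nat \<Rightarrow> nat"
  define sh where "sh g = (SOME p. p \<turnstile> (\<Sum>i<length q. g i M) \<and> part p = (\<lambda>i. g i M))" for g :: "nat \<Rightarrow> nat \<Rightarrow> nat"
  define ex where "ex g = (\<lambda>i m. if m \<le> M then g i m else part q i)" for g :: "nat \<Rightarrow> nat \<Rightarrow> nat"
  have sh: "sh g \<turnstile> (\<Sum>i<length q. g i M)" "part (sh g) = (\<lambda>i. g i M)" if "g \<in> ?A" for g
  proof -
    have g: "g \<in> gt (Suc M) q" using that by simp
    have "\<exists>p. p \<turnstile> (\<Sum>i<length q. g i M) \<and> part p = (\<lambda>i. g i M)"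
      by (rule partition_exI[of "\<lambda>i. g i M" "length q"]) 
        (use gt_antimono_row[OF g] gt_beyond[OF g] in auto)
    from someI_ex[OF this] show "sh g \<turnstile> (\<Sum>i<length q. g i M)" "part (sh g) = (\<lambda>i. g i M)"
      by (auto simp: sh_def)
  qed
  have hs: "horizontal_strip (sh g) q" if "g \<in> ?A" for g
  proof -
    have g: "g \<in> gt (Suc M) q" using that by simp
    show ?thesis using gtD(3,4)[OF g, of _ M] gtD(2)[OF g, of "Suc M"] by (auto simp: horizontal_strip_def sh(2)[OF that])
  qed
  have shP: "sh g \<in> ?P" if "g \<in> ?A" for g
  proof -
    have g: "g \<in> gt (Suc M) q" using that by simp
    have "(\<Sum>i<length q. g i M) \<le> (\<Sum>i<length q. part q i)"
      by (intro sum_mono gt_le_part[OF g])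
    also have "\<dots> = n" by (rule sum_part_partition[OF q order_refl])
    finally show ?thesis using hs[OF that] sh(1)[OF that] m by (auto intro: partitions_uptoI)
  qed
  have trB: "tr g \<in> ?B (sh g)" if gA: "g \<in> ?A" for g
  proof -
    have g: "g \<in> gt (Suc M) q" using gA by simp
    have t: "tr g \<in> gt M (sh g)"
      using gtD[OF g] gt_antimono_row[OF g] gt_mono[OF g]
      by (auto simp: gt_def tr_def sh(2)[OF gA] min_def not_less_eq_eq antisym)
    have "weight (sh g) (tr g) = a"
    proof (rule poly_mapping_eqI)
      fix i
      show "Poly_Mapping.lookup (weight (sh g) (tr g)) i = Poly_Mapping.lookup a i"
      proof (cases "i < M")
        case True
        have "Poly_Mapping.lookup (weight (sh g) (tr g)) i = (\<Sum>i'<length q. g i' (Suc i) - g i' i)"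
          unfolding lookup_weight[OF t] cut_weight_0_eq[OF t horizontal_strip_length[OF hs[OF gA] sh(1)[OF gA]]]
          using True by (simp add: tr_def)
        also have "\<dots> = Poly_Mapping.lookup ?b i"
          using gA by (simp add: lookup_weight[OF g, symmetric] cut_weight_0_eq[OF g order_refl, symmetric])
        finally show ?thesis using True by (simp add: lookup_add lookup_single)
      next
        case False
        then show ?thesis using aM cut_weight_beyond[OF t, of i 0] by (simp add: lookup_weight[OF t])
      qed
    qed
    then show ?thesis using t by simp
  qed
  have exA: "ex g \<in> ?A \<and> sh (ex g) = p \<and> tr (ex g) = g" if p: "p \<in> ?P" and gB: "g \<in> ?B p" for p g
  proof -
    obtain l where l: "p \<turnstile> l" using p by (auto simp: partitions_upto_def)
    have g: "g \<in> gt M p" using gB by simp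
    have h: "part p i \<le> part q i" "part q (Suc i) \<le> part p i" for i using p by (auto simp: horizontal_strip_def)
    have gM: "g i M = part p i" for i using gtD(2)[OF g] by simp
    have e: "ex g \<in> gt (Suc M) q"
      unfolding gt_def mem_Collect_eq
    proof (intro conjI allI impI)
      fix i m
      show "ex g i 0 = 0" by (simp add: ex_def gtD(1)[OF g])
      show "ex g i m = part q i" if "Suc M \<le> m" using that by (simp add: ex_def)
      show "ex g i m \<le> ex g i (Suc m)"
        using gtD(3)[OF g, of i m] h(1)[of i] gM by (cases "m = M") (auto simp: ex_def)
      show "ex g (Suc i) (Suc m) \<le> ex g i m"
        using gtD(4)[OF g, of i m] h(2)[of i] gM part_antimono[OF q, of i "Suc i"] by (cases "m = M") (auto simp: ex_def)
    qed
    have len: "length p \<le> length q" using horizontal_strip_length[OF _ l] p by simp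
    have lt: "l = exp_total a" using exp_total_weight[OF g l] gB by simp
    have "weight q (ex g) = ?b"
    proof (rule poly_mapping_eqI)
      fix i
      consider "i < M" | "i = M" | "M < i" by linarith
      then show "Poly_Mapping.lookup (weight q (ex g)) i = Poly_Mapping.lookup ?b i"
      proof cases
        case 1
        then have "Poly_Mapping.lookup (weight q (ex g)) i = Poly_Mapping.lookup (weight p g) i"
          unfolding lookup_weight[OF e] lookup_weight[OF g] cut_weight_0_eq[OF e order_refl] cut_weight_0_eq[OF g len]
          by (simp add: ex_def)
        then show ?thesis using 1 gB by (simp add: lookup_add lookup_single)
      next
        case 2
        have "Poly_Mapping.lookup (weight q (ex g)) i = (\<Sum>i<length q. part q i - part p i)"
          unfolding lookup_weight[OF e] cut_weight_0_eq[OF e order_refl] using 2 by (simp add: ex_def gM)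
        also have "\<dots> = n - l"
          using h(1) by (subst sum_subtractf_nat) (auto simp: sum_part_partition[OF q order_refl] sum_part_partition[OF l len])
        finally show ?thesis using 2 n lt aM by (simp add: lookup_add)
      next
        case 3
        then show ?thesis using aM cut_weight_beyond[OF e, of i 0] by (simp add: lookup_weight[OF e] lookup_add lookup_single)
      qed
    qed
    then have eA: "ex g \<in> ?A" using e by simp
    have "part (sh (ex g)) = part p" unfolding sh(2)[OF eA] by (simp add: ex_def gM)
    then have "sh (ex g) = p" by (rule partition_eqI[OF sh(1)[OF eA] l])
    moreover have "tr (ex g) = g"
      using gtD(2)[OF g] by (auto simp: tr_def ex_def fun_eq_iff min_def)
    ultimately show ?thesis using eA by blast
  qed
  have extr: "ex (tr g) = g" if gA: "g \<in> ?A" for g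
  proof -
    have g: "g \<in> gt (Suc M) q" using gA by simp
    show ?thesis using gtD(2)[OF g] by (auto simp: tr_def ex_def fun_eq_iff min_def)
  qed
  have "bij_betw (\<lambda>g. (sh g, tr g)) ?A (Sigma ?P ?B)"
  proof (rule bij_betw_byWitness[where f' = "\<lambda>x. ex (snd x)"])
    show "\<forall>g\<in>?A. ex (snd (sh g, tr g)) = g" using extr by simp
    show "(\<lambda>g. (sh g, tr g)) ` ?A \<subseteq> Sigma ?P ?B"
    proof (rule image_subsetI)
      fix g assume "g \<in> ?A"
      from shP[OF this] trB[OF this] show "(sh g, tr g) \<in> Sigma ?P ?B" by (rule SigmaI)
    qed
    have S: "fst x \<in> ?P" "snd x \<in> ?B (fst x)" if "x \<in> Sigma ?P ?B" for x using that by auto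
    show "\<forall>x\<in>Sigma ?P ?B. (sh (ex (snd x)), tr (ex (snd x))) = x"
      using exA[OF S] by (simp add: prod_eq_iff)
    show "(\<lambda>x. ex (snd x)) ` Sigma ?P ?B \<subseteq> ?A"
    proof (rule image_subsetI)
      fix x assume "x \<in> Sigma ?P ?B"
      from exA[OF S[OF this]] show "ex (snd x) \<in> ?A" by blast
    qed
  qed
  then have "card ?A = card (Sigma ?P ?B)" by (rule bij_betw_same_card)
  also have "\<dots> = (\<Sum>p\<in>?P. card (?B p))"
  proof (rule card_SigmaI)
    show "\<forall>p\<in>?P. finite (?B p)"
      using finite_gt by (auto simp: partitions_upto_def)
  qed simp
  finally have "int (card ?A) = (\<Sum>p\<in>?P. int (card (?B p)))" by simp
  also have "\<dots> = (\<Sum>p\<in>?P. schur p a)"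
    by (rule sum.cong[OF refl]) (auto simp: partitions_upto_def schur_eq_card_gt[OF _ a])
  finally show ?thesis by (simp add: schur_eq_card_gt[OF q keys])
qed

section \<open>Kostka numbers and complete homogeneous products\<close>

lemma schur_poly_Nil: "schur_poly N [] = 1"
proof -
  have "gt N [] = {\<lambda>_ _. 0}"
    by (auto simp: gt_def fun_eq_iff) (metis gt_le_part[unfolded gt_def, simplified] le_zero_eq part_Nil) 
  moreover have "cut_weight [] 0 (\<lambda>_ _. 0) = (\<lambda>_. 0)" by (simp add: cut_weight_def fun_eq_iff)
  then have "weight [] (\<lambda>_ _. 0) = 0" by (simp add: weight_def)
  ultimately show ?thesis by (simp add: schur_poly_def)
qed

lemma schur_0:
  assumes "p \<turnstile> n" shows "schur p 0 = (if p = [] then 1 else 0)"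
proof (cases "p = []")
  case True
  then show ?thesis using lookup_schur_poly[OF Nil_partition, of 0 0] by (simp add: schur_poly_Nil)
next
  case False
  then have "n \<noteq> 0" using assms by (cases p) (auto simp: partition_of_def)
  then show ?thesis using False schur_eq_0[OF assms, of 0] by (simp add: exp_total_def)
qed

lemma exp_total_single: "exp_total (Poly_Mapping.single i r) = r"
  by (simp add: exp_total_def)

text \<open>The complete homogeneous product \<open>\<Prod>i. h (a i)\<close> is expanded by the Kostka numbers,
  which are the coefficients of the Schur functions at \<open>a\<close>.\<close>

lemma prod_row_schur_poly:
  assumes "Poly_Mapping.keys a \<subseteq> {..<M}" "exp_total a \<le> N" "exp_total a \<le> m"
  shows "(\<Prod>i<M. schur_poly N (row_part (Poly_Mapping.lookup a i))) = (\<Sum>s\<in>partitions_upto m. of_int (schur s a) * schur_poly N s)"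
  using assms
proof (induction M arbitrary: a)
  case 0
  then have a: "a = 0" by simp
  have "(\<Sum>s\<in>partitions_upto m. of_int (schur s 0) * schur_poly N s) = (\<Sum>s\<in>partitions_upto m. if s = [] then schur_poly N s else 0)"
    by (rule sum.cong) (auto simp: partitions_upto_def schur_0)
  also have "\<dots> = 1" using partitions_uptoI[OF Nil_partition, of m] by (simp add: schur_poly_Nil)
  finally show ?case by (simp add: a)
next
  case (Suc M)
  let ?r = "Poly_Mapping.lookup a M" and ?P = "partitions_upto m"
  define b where "b = a - Poly_Mapping.single M ?r"
  have ab: "a = b + Poly_Mapping.single M ?r"
    by (rule poly_mapping_eqI) (simp add: b_def lookup_add lookup_minus lookup_single when_def)
  have kb: "Poly_Mapping.keys b \<subseteq> {..<M}"
  proof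
    fix i assume "i \<in> Poly_Mapping.keys b"
    then have "Poly_Mapping.lookup b i \<noteq> 0" by (simp only: in_keys_iff not_False_eq_True)
    then have "i \<noteq> M" "Poly_Mapping.lookup a i \<noteq> 0" by (auto simp: b_def lookup_minus)
    then have "i \<in> Poly_Mapping.keys a" "i \<noteq> M" by (auto simp only: in_keys_iff)
    then show "i \<in> {..<M}" using Suc.prems(1) by auto
  qed
  have tot: "exp_total a = exp_total b + ?r" using exp_total_add[of b "Poly_Mapping.single M ?r"] ab by (simp add: exp_total_single)
  have bi: "Poly_Mapping.lookup b i = Poly_Mapping.lookup a i" if "i < M" for i
    using that by (simp add: b_def lookup_minus lookup_single)
  \<comment> \<open>By homogeneity only partitions of \<open>exp_total b\<close> have a nonzero
    coefficient, so the Pieri rule applies with that size.\<close>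
  have step: "of_int (schur p b) * (schur_poly N p * schur_poly N (row_part ?r)) =
      (\<Sum>s\<in>?P. of_int (schur p b * (if s \<turnstile> exp_total a \<and> horizontal_strip p s then 1 else 0)) * schur_poly N s)" if pP: "p \<in> ?P" for p
  proof (cases "schur p b = 0")
    case False
    obtain n where n: "p \<turnstile> n" using pP by (auto simp: partitions_upto_def)
    then have "n = exp_total b" using False schur_eq_0[of p n b] by blast
    then have p: "p \<turnstile> exp_total b" using n by simp
    have c: "lr_coeff p (row_part ?r) s = (if s \<turnstile> exp_total a \<and> horizontal_strip p s then 1 else 0)" for s
    proof (cases "s \<turnstile> exp_total a")
      case True then show ?thesis using pieri[OF p, of s ?r] tot by simp
    next
      case False then show ?thesis using lr_coeff_partition[OF p row_partition, of ?r s] tot by auto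
    qed
    have "schur_poly N p * schur_poly N (row_part ?r) = (\<Sum>s\<in>?P. of_int (lr_coeff p (row_part ?r) s) * schur_poly N s)"
      using schur_poly_mult[OF p row_partition, of ?r N m] tot Suc.prems by simp
    then show ?thesis by (simp only: c sum_distrib_left of_int_mult mult.assoc)
  qed simp
  have rec: "(\<Sum>p\<in>?P. schur p b * (if s \<turnstile> exp_total a \<and> horizontal_strip p s then 1 else 0)) = schur s a" if sP: "s \<in> ?P" for s
  proof (cases "s \<turnstile> exp_total a")
    case True
    have "(\<Sum>p\<in>?P. schur p b * (if s \<turnstile> exp_total a \<and> horizontal_strip p s then 1 else 0)) = (\<Sum>p | p \<in> ?P \<and> horizontal_strip p s. schur p b)"
      using True by (intro sum.mono_neutral_cong_right) auto
    also have "\<dots> = schur s (b + Poly_Mapping.single M ?r)"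
      using kostka_rec[OF True _ kb Suc.prems(3), of ?r] tot by simp
    finally show ?thesis using ab by simp
  next
    case False
    obtain n where "s \<turnstile> n" using sP by (auto simp: partitions_upto_def)
    then show ?thesis using False schur_eq_0[of s n a] by auto
  qed
  have "(\<Prod>i<Suc M. schur_poly N (row_part (Poly_Mapping.lookup a i))) = 
     (\<Prod>i<M. schur_poly N (row_part (Poly_Mapping.lookup b i))) * schur_poly N (row_part ?r)"
    by (simp add: bi)
  also have "\<dots> = (\<Sum>p\<in>?P. of_int (schur p b) * (schur_poly N p * schur_poly N (row_part ?r)))"
    using Suc.IH[OF kb] Suc.prems tot by (simp add: sum_distrib_right mult.assoc)
  also have "\<dots> = (\<Sum>p\<in>?P. \<Sum>s\<in>?P. of_int (schur p b * (if s \<turnstile> exp_total a \<and> horizontal_strip p s then 1 else 0)) * schur_poly N s)"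
    using step by (rule sum.cong[OF refl])
  also have "\<dots> = (\<Sum>s\<in>?P. \<Sum>p\<in>?P. of_int (schur p b * (if s \<turnstile> exp_total a \<and> horizontal_strip p s then 1 else 0)) * schur_poly N s)"
    by (rule sum.swap)
  also have "\<dots> = (\<Sum>s\<in>?P. of_int (schur s a) * schur_poly N s)"
  proof (rule sum.cong[OF refl])
    fix s assume "s \<in> ?P"
    from rec[OF this] show "(\<Sum>p\<in>?P. of_int (schur p b * (if s \<turnstile> exp_total a \<and> horizontal_strip p s then 1 else 0)) * schur_poly N s) = of_int (schur s a) * schur_poly N s"
      unfolding sum_distrib_right[symmetric] of_int_sum[symmetric] by simp
  qed
  finally show ?case .
qed

text \<open>Two alphabets, the second one occupying the variables from \<open>N\<close> on: a
  coefficient at \<open>exp_append N a b\<close> is a coefficient of the coproduct.\<close>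

definition exp_append :: "nat \<Rightarrow> (nat \<Rightarrow>\<^sub>0 nat) \<Rightarrow> (nat \<Rightarrow>\<^sub>0 nat) \<Rightarrow> (nat \<Rightarrow>\<^sub>0 nat)" where
  "exp_append N a b = Abs_poly_mapping (\<lambda>i. if i < N then Poly_Mapping.lookup a i else Poly_Mapping.lookup b (i - N))"

lemma lookup_exp_append:
  "Poly_Mapping.lookup (exp_append N a b) i = (if i < N then Poly_Mapping.lookup a i else Poly_Mapping.lookup b (i - N))"
proof -
  have "{i. (if i < N then Poly_Mapping.lookup a i else Poly_Mapping.lookup b (i - N)) \<noteq> 0} \<subseteq> {..<N} \<union> (\<lambda>i. i + N) ` Poly_Mapping.keys b"
  proof
    fix i assume i: "i \<in> {i. (if i < N then Poly_Mapping.lookup a i else Poly_Mapping.lookup b (i - N)) \<noteq> 0}"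
    show "i \<in> {..<N} \<union> (\<lambda>i. i + N) ` Poly_Mapping.keys b"
    proof (cases "i < N")
      case False
      then have "i = (i - N) + N" "i - N \<in> Poly_Mapping.keys b" using i by (auto simp: in_keys_iff)
      then show ?thesis by blast
    qed simp
  qed
  then have "finite {i. (if i < N then Poly_Mapping.lookup a i else Poly_Mapping.lookup b (i - N)) \<noteq> 0}"
    by (rule finite_subset) simp
  then show ?thesis by (simp add: exp_append_def)
qed

lemma prod_lessThan_add:
  fixes f :: "nat \<Rightarrow> 'a::comm_monoid_mult"
  shows "(\<Prod>i<N + M. f i) = (\<Prod>i<N. f i) * (\<Prod>i<M. f (N + i))"
  by (induction M) (simp_all add: mult.assoc)

lemma sum_lessThan_add:
  fixes f :: "nat \<Rightarrow> 'a::comm_monoid_add"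
  shows "(\<Sum>i<N + M. f i) = (\<Sum>i<N. f i) + (\<Sum>i<M. f (N + i))"
  by (induction M) (simp_all add: add.assoc)

lemma keys_exp_append:
  assumes "Poly_Mapping.keys b \<subseteq> {..<M}"
  shows "Poly_Mapping.keys (exp_append N a b) \<subseteq> {..<N + M}"
proof
  fix i assume i: "i \<in> Poly_Mapping.keys (exp_append N a b)"
  show "i \<in> {..<N + M}"
  proof (cases "i < N")
    case False
    then have "i - N \<in> Poly_Mapping.keys b" using i by (simp add: in_keys_iff lookup_exp_append)
    then show ?thesis using assms False by auto
  qed simp
qed

lemma exp_total_append:
  assumes "Poly_Mapping.keys a \<subseteq> {..<N}"
  shows "exp_total (exp_append N a b) = exp_total a + exp_total b"
proof -
  obtain M where M: "Poly_Mapping.keys b \<subseteq> {..<M}"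
    using finite_nat_set_iff_bounded[of "Poly_Mapping.keys b"] by auto
  show ?thesis
    using exp_total_eq_sum[OF _ keys_exp_append[OF M, of N a]] exp_total_eq_sum[OF _ assms] exp_total_eq_sum[OF _ M]
    by (simp add: sum_lessThan_add lookup_exp_append)
qed

text \<open>The complete homogeneous product for the concatenated exponent factors into those for
  \<open>a\<close> and for \<open>b\<close>. Expanding all three by Kostka numbers and comparing the
  coefficients of \<open>s\<close> shows that product and coproduct have the same structure
  constants, with no appeal to an inner product.\<close>

lemma schur_append:
  assumes s: "s \<turnstile> n" "n \<le> m" and a: "Poly_Mapping.keys a \<subseteq> {..<N}"
  shows "schur s (exp_append N a b) = (\<Sum>p\<in>partitions_upto m. \<Sum>q\<in>partitions_upto m. lr_coeff p q s * schur p a * schur q b)"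
proof (cases "n = exp_total a + exp_total b")
  case False
  have "lr_coeff p q s * schur p a * schur q b = 0" if "p \<in> partitions_upto m" "q \<in> partitions_upto m" for p q
  proof (rule ccontr)
    assume nz: "lr_coeff p q s * schur p a * schur q b \<noteq> 0"
    obtain k l where kl: "p \<turnstile> k" "q \<turnstile> l" using \<open>p \<in> _\<close> \<open>q \<in> _\<close> by (auto simp: partitions_upto_def)
    then have "k = exp_total a" "l = exp_total b" "s \<turnstile> k + l"
      using nz schur_eq_0[OF kl(1), of a] schur_eq_0[OF kl(2), of b] lr_coeff_partition[OF kl, of s] by auto
    then show False using False partition_sum_list[OF s(1)] partition_sum_list by auto
  qed
  then show ?thesis using schur_eq_0[OF s(1)] exp_total_append[OF a, of b] False by (simp add: sum.neutral)
next
  case True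
  let ?P = "partitions_upto m" and ?ab = "exp_append N a b"
  obtain M where M: "Poly_Mapping.keys b \<subseteq> {..<M}"
    using finite_nat_set_iff_bounded[of "Poly_Mapping.keys b"] by auto
  have prod: "of_int (schur p a) * schur_poly m p * (of_int (schur q b) * schur_poly m q) =
     (\<Sum>s\<in>?P. of_int (lr_coeff p q s * schur p a * schur q b) * schur_poly m s)" if "p \<in> ?P" "q \<in> ?P" for p q
  proof (cases "schur p a = 0 \<or> schur q b = 0")
    case nz: False
    obtain k l where kl: "p \<turnstile> k" "q \<turnstile> l" using \<open>p \<in> _\<close> \<open>q \<in> _\<close> by (auto simp: partitions_upto_def)
    then have "k = exp_total a" "l = exp_total b"
      using nz schur_eq_0[OF kl(1), of a] schur_eq_0[OF kl(2), of b] by auto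
    then have "schur_poly m p * schur_poly m q = (\<Sum>s\<in>?P. of_int (lr_coeff p q s) * schur_poly m s)"
      using schur_poly_mult[OF kl, of m m] True s(2) by simp
    then have "of_int (schur p a * schur q b) * (schur_poly m p * schur_poly m q) = of_int (schur p a * schur q b) * (\<Sum>s\<in>?P. of_int (lr_coeff p q s) * schur_poly m s)"
      by simp
    then show ?thesis by (simp add: sum_distrib_left mult_ac)
  qed auto
  have "(\<Sum>s\<in>?P. of_int (schur s ?ab) * schur_poly m s) = (\<Prod>i<N + M. schur_poly m (row_part (Poly_Mapping.lookup ?ab i)))"
    using prod_row_schur_poly[OF keys_exp_append[OF M], of N a m m] exp_total_append[OF a, of b] True s(2) by simp
  also have "\<dots> = (\<Prod>i<N. schur_poly m (row_part (Poly_Mapping.lookup a i))) * (\<Prod>i<M. schur_poly m (row_part (Poly_Mapping.lookup b i)))"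
    by (simp add: prod_lessThan_add lookup_exp_append)
  also have "\<dots> = (\<Sum>p\<in>?P. of_int (schur p a) * schur_poly m p) * (\<Sum>q\<in>?P. of_int (schur q b) * schur_poly m q)"
    using prod_row_schur_poly[OF a, of m m] prod_row_schur_poly[OF M, of m m] True s(2) by simp
  also have "\<dots> = (\<Sum>p\<in>?P. \<Sum>q\<in>?P. \<Sum>s\<in>?P. of_int (lr_coeff p q s * schur p a * schur q b) * schur_poly m s)"
    unfolding sum_product by (intro sum.cong refl prod)
  also have "\<dots> = (\<Sum>p\<in>?P. \<Sum>s\<in>?P. \<Sum>q\<in>?P. of_int (lr_coeff p q s * schur p a * schur q b) * schur_poly m s)"
    by (intro sum.cong refl sum.swap)
  also have "\<dots> = (\<Sum>s\<in>?P. \<Sum>p\<in>?P. \<Sum>q\<in>?P. of_int (lr_coeff p q s * schur p a * schur q b) * schur_poly m s)"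
    by (rule sum.swap)
  also have "\<dots> = (\<Sum>s\<in>?P. of_int (\<Sum>p\<in>?P. \<Sum>q\<in>?P. lr_coeff p q s * schur p a * schur q b) * schur_poly m s)"
    by (simp only: of_int_sum sum_distrib_right)
  finally have eq: "(\<Sum>s\<in>?P. of_int (schur s ?ab) * schur_poly m s) = (\<Sum>s\<in>?P. of_int (\<Sum>p\<in>?P. \<Sum>q\<in>?P. lr_coeff p q s * schur p a * schur q b) * schur_poly m s)" .
  show ?thesis
  proof (rule schur_independent[of ?P m "\<lambda>s. schur s ?ab"])
    fix x :: "nat \<Rightarrow>\<^sub>0 nat" assume "Poly_Mapping.keys x \<subseteq> {..<m}"
    from arg_cong[OF eq, of "\<lambda>f. Poly_Mapping.lookup f x", unfolded lookup_schur_poly_sum_upto[OF this]]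
    show "(\<Sum>s\<in>?P. schur s ?ab * schur s x) = (\<Sum>s\<in>?P. (\<Sum>p\<in>?P. \<Sum>q\<in>?P. lr_coeff p q s * schur p a * schur q b) * schur s x)" .
  qed (use s partitions_upto_props partitions_uptoI in auto)
qed

section \<open>Mackey's formula\<close>

definition splittings :: "(nat \<Rightarrow>\<^sub>0 nat) \<Rightarrow> ((nat \<Rightarrow>\<^sub>0 nat) \<times> (nat \<Rightarrow>\<^sub>0 nat)) set" where
  "splittings a = {(b, c). b + c = a}"

lemma exp_append_add: "exp_append N (a + a') (b + b') = exp_append N a b + exp_append N a' b'"
  by (rule poly_mapping_eqI) (simp add: lookup_exp_append lookup_add)

lemma exp_append_inject:
  assumes "Poly_Mapping.keys a \<subseteq> {..<N}" "Poly_Mapping.keys a' \<subseteq> {..<N}" "exp_append N a b = exp_append N a' b'"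
  shows "a = a' \<and> b = b'"
proof
  have eq: "Poly_Mapping.lookup (exp_append N a b) i = Poly_Mapping.lookup (exp_append N a' b') i" for i
    by (simp add: assms(3))
  show "a = a'"
  proof (rule poly_mapping_eqI)
    fix i
    show "Poly_Mapping.lookup a i = Poly_Mapping.lookup a' i"
    proof (cases "i < N")
      case True then show ?thesis using eq[of i] by (simp add: lookup_exp_append)
    next
      case False
      then have "i \<notin> Poly_Mapping.keys a" "i \<notin> Poly_Mapping.keys a'" using assms by auto
      then show ?thesis by (simp add: in_keys_iff)
    qed
  qed
  show "b = b'"
  proof (rule poly_mapping_eqI)
    fix i show "Poly_Mapping.lookup b i = Poly_Mapping.lookup b' i"
      using eq[of "i + N"] by (simp add: lookup_exp_append)
  qed
qed

lemma exp_append_surj: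
  obtains a b where "Poly_Mapping.keys a \<subseteq> {..<N}" "x = exp_append N a b"
proof
  let ?a = "Abs_poly_mapping (\<lambda>i. if i < N then Poly_Mapping.lookup x i else 0)"
  let ?b = "Poly_Mapping.map_key (\<lambda>i. i + N) x"
  have "finite {i. (if i < N then Poly_Mapping.lookup x i else 0) \<noteq> 0}"
    by (rule finite_subset[of _ "{..<N}"]) (auto split: if_splits)
  then have a: "Poly_Mapping.lookup ?a i = (if i < N then Poly_Mapping.lookup x i else 0)" for i by simp
  show "Poly_Mapping.keys ?a \<subseteq> {..<N}" using a by (auto simp: in_keys_iff split: if_splits)
  have inj: "inj (\<lambda>i. i + N)" by (simp add: inj_def)
  show "x = exp_append N ?a ?b"
    by (rule poly_mapping_eqI) (simp add: lookup_exp_append a map_key.rep_eq[OF inj])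
qed

text \<open>The bound on the keys of \<open>a\<close> makes the cut at \<open>N\<close> unique, so a
  splitting of the concatenation is a pair of independent splittings.\<close>

lemma sum_splittings_append:
  assumes "Poly_Mapping.keys a \<subseteq> {..<N}"
  shows "(\<Sum>(x, y)\<in>splittings (exp_append N a b). F x y) =
    (\<Sum>(a1, a2)\<in>splittings a. \<Sum>(b1, b2)\<in>splittings b. F (exp_append N a1 b1) (exp_append N a2 b2))"
proof -
  let ?f = "\<lambda>((a1, a2), (b1, b2)). (exp_append N a1 b1, exp_append N a2 b2)"
  have k: "Poly_Mapping.keys a1 \<subseteq> {..<N}" "Poly_Mapping.keys a2 \<subseteq> {..<N}" if "(a1, a2) \<in> splittings a" for a1 a2
    using that assms keys_add_nat[of a1 a2] by (auto simp: splittings_def)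
  have inj: "inj_on ?f (splittings a \<times> splittings b)"
  proof (rule inj_onI)
    fix x y assume xy: "x \<in> splittings a \<times> splittings b" "y \<in> splittings a \<times> splittings b" "?f x = ?f y"
    obtain a1 a2 b1 b2 where x: "x = ((a1, a2), (b1, b2))" by (metis surj_pair)
    obtain a1' a2' b1' b2' where y: "y = ((a1', a2'), (b1', b2'))" by (metis surj_pair)
    have s: "(a1, a2) \<in> splittings a" "(a1', a2') \<in> splittings a"
      and eq: "exp_append N a1 b1 = exp_append N a1' b1'" "exp_append N a2 b2 = exp_append N a2' b2'"
      using xy unfolding x y by auto
    show "x = y" unfolding x y
      using exp_append_inject[OF k(1)[OF s(1)] k(1)[OF s(2)] eq(1)] exp_append_inject[OF k(2)[OF s(1)] k(2)[OF s(2)] eq(2)] by simp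
  qed
  have im: "?f ` (splittings a \<times> splittings b) = splittings (exp_append N a b)"
  proof (intro equalityI subsetI)
    fix z assume "z \<in> ?f ` (splittings a \<times> splittings b)"
    then show "z \<in> splittings (exp_append N a b)" by (auto simp: splittings_def exp_append_add[symmetric])
  next
    fix z assume z: "z \<in> splittings (exp_append N a b)"
    obtain x y where xy: "z = (x, y)" by force
    obtain a1 b1 where 1: "Poly_Mapping.keys a1 \<subseteq> {..<N}" "x = exp_append N a1 b1" by (rule exp_append_surj)
    obtain a2 b2 where 2: "Poly_Mapping.keys a2 \<subseteq> {..<N}" "y = exp_append N a2 b2" by (rule exp_append_surj)
    have "exp_append N (a1 + a2) (b1 + b2) = exp_append N a b"
      using z xy 1 2 by (simp add: splittings_def exp_append_add)
    moreover have "Poly_Mapping.keys (a1 + a2) \<subseteq> {..<N}" using 1 2 by (simp add: keys_add_nat)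
    ultimately have "a1 + a2 = a" "b1 + b2 = b" using exp_append_inject assms by blast+
    then have "((a1, a2), (b1, b2)) \<in> splittings a \<times> splittings b" by (simp add: splittings_def)
    then show "z \<in> ?f ` (splittings a \<times> splittings b)" using xy 1 2 by force
  qed
  have "(\<Sum>(x, y)\<in>splittings (exp_append N a b). F x y) = (\<Sum>z\<in>splittings a \<times> splittings b. case ?f z of (x, y) \<Rightarrow> F x y)"
    unfolding im[symmetric] by (rule sum.reindex_cong[OF inj]) auto
  also have "\<dots> = (\<Sum>(a1, a2)\<in>splittings a. \<Sum>(b1, b2)\<in>splittings b. F (exp_append N a1 b1) (exp_append N a2 b2))"
    by (simp add: sum.cartesian_product case_prod_beta)
  finally show ?thesis .
qed

lemma sum_factor_four:
  fixes c :: "'x \<Rightarrow> 'y \<Rightarrow> 'a::comm_semiring_0"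
  shows "(\<Sum>u\<in>A. \<Sum>v\<in>B. \<Sum>x\<in>X. \<Sum>y\<in>Y. c x y * f x y u * g x y v) =
    (\<Sum>x\<in>X. \<Sum>y\<in>Y. c x y * (\<Sum>u\<in>A. f x y u) * (\<Sum>v\<in>B. g x y v))"
proof -
  have "(\<Sum>u\<in>A. \<Sum>v\<in>B. \<Sum>x\<in>X. \<Sum>y\<in>Y. c x y * f x y u * g x y v) = (\<Sum>u\<in>A. \<Sum>x\<in>X. \<Sum>v\<in>B. \<Sum>y\<in>Y. c x y * f x y u * g x y v)"
    by (intro sum.cong refl sum.swap)
  also have "\<dots> = (\<Sum>x\<in>X. \<Sum>u\<in>A. \<Sum>v\<in>B. \<Sum>y\<in>Y. c x y * f x y u * g x y v)"
    by (rule sum.swap)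
  also have "\<dots> = (\<Sum>x\<in>X. \<Sum>u\<in>A. \<Sum>y\<in>Y. \<Sum>v\<in>B. c x y * f x y u * g x y v)"
    by (intro sum.cong refl sum.swap)
  also have "\<dots> = (\<Sum>x\<in>X. \<Sum>y\<in>Y. \<Sum>u\<in>A. \<Sum>v\<in>B. c x y * f x y u * g x y v)"
    by (intro sum.cong refl sum.swap)
  also have "\<dots> = (\<Sum>x\<in>X. \<Sum>y\<in>Y. c x y * (\<Sum>u\<in>A. f x y u) * (\<Sum>v\<in>B. g x y v))"
  proof (intro sum.cong refl)
    fix x y
    show "(\<Sum>u\<in>A. \<Sum>v\<in>B. c x y * f x y u * g x y v) = c x y * (\<Sum>u\<in>A. f x y u) * (\<Sum>v\<in>B. g x y v)"
      by (subst mult.assoc, subst sum_product, simp add: sum_distrib_left mult.assoc)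
  qed
  finally show ?thesis .
qed

text \<open>The coproduct is multiplicative: a coefficient of the product of \<open>schur p\<close>
  and \<open>schur q\<close> in two alphabets can be found by multiplying first and then splitting,
  or by splitting each factor first. The pieces of \<open>p\<close> and \<open>q\<close> are taken
  of size at most \<open>t\<close>, so their products reach size \<open>2 * t\<close>.\<close>

theorem mackey:
  assumes p: "p \<turnstile> k" and q: "q \<turnstile> l" and t: "k + l \<le> t"
    and r: "r \<in> partitions_upto (2 * t)" and s: "s \<in> partitions_upto (2 * t)"
  shows "(\<Sum>z\<in>partitions_upto (2 * t). lr_coeff p q z * lr_coeff r s z) =
    (\<Sum>x\<in>partitions_upto t \<times> partitions_upto t. \<Sum>y\<in>partitions_upto t \<times> partitions_upto t.
      lr_coeff (fst x) (snd x) p * lr_coeff (fst y) (snd y) q * lr_coeff (fst x) (fst y) r * lr_coeff (snd x) (snd y) s)"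
proof -
  let ?M = "partitions_upto (2 * t)" and ?P = "partitions_upto t \<times> partitions_upto t"
  define X where "X r s = (\<Sum>z\<in>?M. lr_coeff p q z * lr_coeff r s z)" for r s
  define c where "c x y = lr_coeff (fst x) (snd x) p * lr_coeff (fst y) (snd y) q" for x y :: "nat list \<times> nat list"
  define Y where "Y r s = (\<Sum>x\<in>?P. \<Sum>y\<in>?P. c x y * lr_coeff (fst x) (fst y) r * lr_coeff (snd x) (snd y) s)" for r s
  have eq: "(\<Sum>r\<in>?M. (\<Sum>s\<in>?M. X r s * schur s b) * schur r a) = (\<Sum>r\<in>?M. (\<Sum>s\<in>?M. Y r s * schur s b) * schur r a)"
    if a: "Poly_Mapping.keys a \<subseteq> {..<2 * t}" for a b
  proof -
    let ?ap = "exp_append (2 * t)"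
    let ?T = "mseries_mult (schur p) (schur q) (?ap a b)"
    have "?T = (\<Sum>z\<in>?M. lr_coeff p q z * schur z (?ap a b))"
      using schur_mult[OF p q, of "2 * t"] t by simp
    also have "\<dots> = (\<Sum>z\<in>?M. lr_coeff p q z * (\<Sum>r\<in>?M. \<Sum>s\<in>?M. lr_coeff r s z * schur r a * schur s b))"
      using schur_append[OF _ _ a] by (intro sum.cong refl) (auto simp: partitions_upto_def)
    also have "\<dots> = (\<Sum>z\<in>?M. \<Sum>r\<in>?M. \<Sum>s\<in>?M. lr_coeff p q z * lr_coeff r s z * schur s b * schur r a)"
      by (simp add: sum_distrib_left mult_ac)
    also have "\<dots> = (\<Sum>r\<in>?M. \<Sum>z\<in>?M. \<Sum>s\<in>?M. lr_coeff p q z * lr_coeff r s z * schur s b * schur r a)"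
      by (rule sum.swap)
    also have "\<dots> = (\<Sum>r\<in>?M. \<Sum>s\<in>?M. \<Sum>z\<in>?M. lr_coeff p q z * lr_coeff r s z * schur s b * schur r a)"
      by (intro sum.cong refl sum.swap)
    also have "\<dots> = (\<Sum>r\<in>?M. (\<Sum>s\<in>?M. X r s * schur s b) * schur r a)"
      by (simp only: X_def sum_distrib_right)
    finally have 1: "?T = \<dots>" .
    have app: "schur p' (?ap a1 b1) = (\<Sum>x\<in>?P. lr_coeff (fst x) (snd x) p' * schur (fst x) a1 * schur (snd x) b1)"
      if "p' \<turnstile> k'" "k' \<le> t" "Poly_Mapping.keys a1 \<subseteq> {..<2 * t}" for p' k' a1 b1
      using schur_append[OF that, of b1] by (simp add: sum.cartesian_product case_prod_beta)
    have k: "Poly_Mapping.keys a1 \<subseteq> {..<2 * t}" "Poly_Mapping.keys a2 \<subseteq> {..<2 * t}" if "(a1, a2) \<in> splittings a" for a1 a2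
      using that a keys_add_nat[of a1 a2] by (auto simp: splittings_def)
    have "?T = (\<Sum>(a1, a2)\<in>splittings a. \<Sum>(b1, b2)\<in>splittings b. schur p (?ap a1 b1) * schur q (?ap a2 b2))"
      unfolding mseries_mult_def splittings_def[symmetric] by (rule sum_splittings_append[OF a])
    also have "\<dots> = (\<Sum>u\<in>splittings a. \<Sum>v\<in>splittings b. \<Sum>x\<in>?P. \<Sum>y\<in>?P.
        c x y * (schur (fst x) (fst u) * schur (fst y) (snd u)) * (schur (snd x) (fst v) * schur (snd y) (snd v)))"
      using app[OF p _ k(1)] app[OF q _ k(2)] t
      by (intro sum.cong refl) (auto simp: sum_product c_def mult_ac intro!: sum.cong)
    also have "\<dots> = (\<Sum>x\<in>?P. \<Sum>y\<in>?P. c x y * mseries_mult (schur (fst x)) (schur (fst y)) a * mseries_mult (schur (snd x)) (schur (snd y)) b)"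
      unfolding sum_factor_four by (simp add: mseries_mult_def splittings_def case_prod_beta)
    also have "\<dots> = (\<Sum>x\<in>?P. \<Sum>y\<in>?P. c x y * (\<Sum>r\<in>?M. lr_coeff (fst x) (fst y) r * schur r a) * (\<Sum>s\<in>?M. lr_coeff (snd x) (snd y) s * schur s b))"
    proof (intro sum.cong refl)
      fix x y assume xy: "x \<in> ?P" "y \<in> ?P"
      have m: "mseries_mult (schur p') (schur q') e = (\<Sum>r\<in>?M. lr_coeff p' q' r * schur r e)"
        if pq: "p' \<in> partitions_upto t" "q' \<in> partitions_upto t" for p' q' e
      proof -
        obtain k' l' where "p' \<turnstile> k'" "k' \<le> t" "q' \<turnstile> l'" "l' \<le> t" using pq by (auto simp: partitions_upto_def)
        then show ?thesis by (intro schur_mult) auto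
      qed
      show "c x y * mseries_mult (schur (fst x)) (schur (fst y)) a * mseries_mult (schur (snd x)) (schur (snd y)) b =
        c x y * (\<Sum>r\<in>?M. lr_coeff (fst x) (fst y) r * schur r a) * (\<Sum>s\<in>?M. lr_coeff (snd x) (snd y) s * schur s b)"
        using xy by (simp add: m mem_Times_iff)
    qed
    also have "\<dots> = (\<Sum>r\<in>?M. \<Sum>s\<in>?M. \<Sum>x\<in>?P. \<Sum>y\<in>?P. c x y * (lr_coeff (fst x) (fst y) r * schur r a) * (lr_coeff (snd x) (snd y) s * schur s b))"
      by (rule sum_factor_four[symmetric])
    also have "\<dots> = (\<Sum>r\<in>?M. (\<Sum>s\<in>?M. Y r s * schur s b) * schur r a)"
      by (simp add: Y_def sum_distrib_right sum_distrib_left mult_ac)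
    finally show ?thesis using 1 by simp
  qed
  \<comment> \<open>Independence is applied once for each alphabet: first in \<open>a\<close> with
    \<open>b\<close> fixed, then in \<open>b\<close>.\<close>
  have eq2: "(\<Sum>s\<in>?M. X r s * schur s b) = (\<Sum>s\<in>?M. Y r s * schur s b)" for b
    by (rule schur_independent[of ?M "2 * t" "\<lambda>r. \<Sum>s\<in>?M. X r s * schur s b" "\<lambda>r. \<Sum>s\<in>?M. Y r s * schur s b"])
      (use eq r partitions_upto_props in auto)
  have "X r s = Y r s"
    by (rule schur_independent[of ?M "2 * t" "X r" "Y r"]) (use eq2 s partitions_upto_props in auto)
  then show ?thesis by (simp add: X_def Y_def c_def)
qed

text \<open>\<open>mackey\<close> at \<open>r = p\<close>, \<open>s = q\<close> is a sum of squares
  on the left and runs over \<open>card ^ 4\<close> quadruples on the right, so some quadruple has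
  at least the average. Its four factors form two pairs, each splitting both \<open>p\<close> and
  \<open>q\<close>. One of the pairs is at least the square root of the average, whence the factor
  \<open>card ^ 2\<close>.\<close>

lemma lr_coeff_descent:
  assumes p: "p \<turnstile> k" and q: "q \<turnstile> l" and pos: "1 \<le> lr_coeff p q z"
  obtains a b c d i j i' j' where "a \<turnstile> i" "b \<turnstile> j" "i + j = k" "c \<turnstile> i'" "d \<turnstile> j'" "i' + j' = l"
    "1 \<le> lr_coeff a b p" "1 \<le> lr_coeff c d q"
    "lr_coeff p q z \<le> int (card (partitions_upto (k + l)) ^ 2) * (lr_coeff a b p * lr_coeff c d q)"
proof -
  let ?t = "k + l" and ?C = "lr_coeff p q z" and ?n = "int (card (partitions_upto (k + l)) ^ 2)"
  let ?M = "partitions_upto (2 * ?t)" and ?P = "partitions_upto ?t \<times> partitions_upto ?t"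
  let ?F = "\<lambda>x y. lr_coeff (fst x) (snd x) p * lr_coeff (fst y) (snd y) q * lr_coeff (fst x) (fst y) p * lr_coeff (snd x) (snd y) q"
  have z: "z \<turnstile> ?t" using lr_coeff_partition[OF p q, of z] pos by simp
  have "?C * ?C \<le> (\<Sum>z\<in>?M. lr_coeff p q z * lr_coeff p q z)"
    using z by (intro member_le_sum) (auto intro: partitions_uptoI)
  also have "\<dots> = (\<Sum>x\<in>?P. \<Sum>y\<in>?P. ?F x y)"
    by (rule mackey[OF p q order_refl]) (use p q in \<open>auto intro: partitions_uptoI\<close>)
  also have "\<dots> = (\<Sum>w\<in>?P \<times> ?P. ?F (fst w) (snd w))" by (simp add: sum.cartesian_product case_prod_beta)
  finally have le: "?C * ?C \<le> (\<Sum>w\<in>?P \<times> ?P. ?F (fst w) (snd w))" .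
  have "\<exists>w\<in>?P \<times> ?P. ?C * ?C \<le> ?n * ?n * ?F (fst w) (snd w)"
  proof (rule ccontr)
    assume "\<not> ?thesis"
    then have lt: "?n * ?n * ?F (fst w) (snd w) < ?C * ?C" if "w \<in> ?P \<times> ?P" for w using that by (meson not_le)
    have card: "int (card (?P \<times> ?P)) = ?n * ?n" by (simp add: card_cartesian_product power2_eq_square)
    have "([], []) \<in> ?P" by (auto intro: partitions_uptoI[OF Nil_partition])
    then have ne: "?P \<times> ?P \<noteq> {}" by blast
    have "?n * ?n * (\<Sum>w\<in>?P \<times> ?P. ?F (fst w) (snd w)) = (\<Sum>w\<in>?P \<times> ?P. ?n * ?n * ?F (fst w) (snd w))"
      by (rule sum_distrib_left)
    also have "\<dots> < (\<Sum>w\<in>?P \<times> ?P. ?C * ?C)"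
      using lt ne by (intro sum_strict_mono) auto
    also have "\<dots> = ?n * ?n * (?C * ?C)" using card by simp
    finally have "?n * ?n * (\<Sum>w\<in>?P \<times> ?P. ?F (fst w) (snd w)) < ?n * ?n * (?C * ?C)" .
    then show False using le mult_left_mono[OF le, of "?n * ?n"] by simp
  qed
  then obtain x y where xy: "x \<in> ?P" "y \<in> ?P" "?C * ?C \<le> ?n * ?n * ?F x y" by auto
  obtain a b c d where abcd: "x = (a, b)" "y = (c, d)" by force
  obtain i j i' j' where ij: "a \<turnstile> i" "b \<turnstile> j" "c \<turnstile> i'" "d \<turnstile> j'" using xy abcd by (auto simp: partitions_upto_def)
  note nn = lr_coeff_nonneg[OF ij(1,2), of p] lr_coeff_nonneg[OF ij(3,4), of q] lr_coeff_nonneg[OF ij(1,3), of p] lr_coeff_nonneg[OF ij(2,4), of q]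
  have "0 < ?n * ?n * ?F x y" using xy(3) pos by (meson less_le_trans mult_pos_pos zero_less_one)
  then have "?F x y \<noteq> 0" by auto
  then have ge: "1 \<le> lr_coeff a b p" "1 \<le> lr_coeff c d q" "1 \<le> lr_coeff a c p" "1 \<le> lr_coeff b d q"
    using nn by (auto simp: abcd)
  have sizes: "i + j = k" "i' + j' = l" "i + i' = k" "j + j' = l"
    using lr_coeff_partition[OF ij(1,2), of p] lr_coeff_partition[OF ij(3,4), of q]
      lr_coeff_partition[OF ij(1,3), of p] lr_coeff_partition[OF ij(2,4), of q] ge partition_sum_list[OF p] partition_sum_list[OF q] partition_sum_list
    by fastforce+
  have "?C * ?C \<le> (?n * (lr_coeff a b p * lr_coeff c d q)) * (?n * (lr_coeff a c p * lr_coeff b d q))"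
    using xy(3) by (simp add: abcd mult_ac)
  then have "?C \<le> ?n * (lr_coeff a b p * lr_coeff c d q) \<or> ?C \<le> ?n * (lr_coeff a c p * lr_coeff b d q)"
    using pos by (smt (verit) mult_strict_mono' nn mult_nonneg_nonneg of_nat_0_le_iff)
  then show ?thesis
  proof
    assume "?C \<le> ?n * (lr_coeff a b p * lr_coeff c d q)"
    then show ?thesis using that ij ge sizes by blast
  next
    assume "?C \<le> ?n * (lr_coeff a c p * lr_coeff b d q)"
    then show ?thesis using that ij ge sizes by blast
  qed
qed

section \<open>Dimensions\<close>

definition exp_ones :: "nat set \<Rightarrow> nat \<Rightarrow>\<^sub>0 nat" where
  "exp_ones A = Abs_poly_mapping (\<lambda>i. if i \<in> A then 1 else 0)"

lemma lookup_exp_ones: "finite A \<Longrightarrow> Poly_Mapping.lookup (exp_ones A) i = (if i \<in> A then 1 else 0)"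
proof -
  assume "finite A"
  moreover have "{i. (if i \<in> A then 1 else 0 :: nat) \<noteq> 0} = A" by simp
  ultimately show ?thesis by (simp add: exp_ones_def)
qed

lemma keys_exp_ones: "finite A \<Longrightarrow> Poly_Mapping.keys (exp_ones A) = A"
  by (auto simp: in_keys_iff lookup_exp_ones split: if_splits)

lemma exp_total_exp_ones: "finite A \<Longrightarrow> exp_total (exp_ones A) = card A"
  by (simp add: exp_total_def keys_exp_ones lookup_exp_ones)

text \<open>With squarefree content every letter occurs once, so rows increase strictly. The shift
  by one is there because variables are counted from \<open>0\<close> and standard entries from
  \<open>1\<close>.\<close>

lemma num_syt_eq_schur:
  assumes p: "p \<turnstile> n"
  shows "int (num_syt p) = schur p (exp_ones {..<n})"
proof -
  let ?S = "{T \<in> ssyt p. \<forall>i. card {c \<in> diagram p. T c = i} = Poly_Mapping.lookup (exp_ones {..<n}) i}"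
  let ?f = "\<lambda>T. \<lambda>x\<in>diagram p. Suc (T x)" and ?g = "\<lambda>T. \<lambda>x\<in>diagram p. T x - 1"
  have n: "sum_list p = n" using partition_sum_list[OF p] .
  have bij: "bij_betw T (diagram p) {..<n}" if T: "T \<in> ?S" for T
  proof -
    have c: "card {c \<in> diagram p. T c = i} = (if i < n then 1 else 0)" for i
      using T by (simp add: lookup_exp_ones)
    have fin: "finite {c \<in> diagram p. T c = i}" for i by simp
    have "inj_on T (diagram p)"
    proof (rule inj_onI)
      fix x y assume xy: "x \<in> diagram p" "y \<in> diagram p" "T x = T y"
      have "card {c \<in> diagram p. T c = T y} \<le> Suc 0" unfolding c by simp
      then have "\<forall>a\<in>{c \<in> diagram p. T c = T y}. \<forall>b\<in>{c \<in> diagram p. T c = T y}. a = b"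
        by (rule card_le_Suc0_iff_eq[OF fin, THEN iffD1])
      moreover have "x \<in> {c \<in> diagram p. T c = T y}" "y \<in> {c \<in> diagram p. T c = T y}"
        using xy by simp_all
      ultimately show "x = y" by blast
    qed
    moreover have "T ` diagram p = {..<n}"
    proof (intro equalityI subsetI)
      fix i assume "i \<in> T ` diagram p"
      then have "{c \<in> diagram p. T c = i} \<noteq> {}" by blast
      then have "card {c \<in> diagram p. T c = i} \<noteq> 0" using fin by (metis card_eq_0_iff)
      then show "i \<in> {..<n}" using c[of i] by (simp split: if_splits)
    next
      fix i assume "i \<in> {..<n}"
      then have "card {c \<in> diagram p. T c = i} \<noteq> 0" using c[of i] by simp
      then have "{c \<in> diagram p. T c = i} \<noteq> {}" by (metis card.empty)
      then show "i \<in> T ` diagram p" by blast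
    qed
    ultimately show ?thesis by (simp add: bij_betw_def)
  qed
  have S: "T \<in> ?S" if T: "T \<in> ssyt p" "bij_betw T (diagram p) {..<n}" for T
  proof -
    have "card {c \<in> diagram p. T c = i} = (if i < n then 1 else 0)" for i
    proof (cases "i < n")
      case True
      then obtain x where x: "x \<in> diagram p" "T x = i" using T(2) by (metis bij_betw_imp_surj_on imageE lessThan_iff)
      then have "{c \<in> diagram p. T c = i} = {x}" using T(2) by (auto simp: bij_betw_def inj_on_def simp del: split_paired_All)
      then show ?thesis using True by simp
    next
      case False
      then have "{c \<in> diagram p. T c = i} = {}" using T(2) by (auto simp: bij_betw_def)
      then show ?thesis using False by (simp only: card.empty if_False)
    qed
    then show ?thesis using T(1) by (simp add: lookup_exp_ones)
  qed
  have strict: "T (i, j) < T (i, j')" if "T \<in> ?S" "j < j'" "j' < part p i" for T i j j'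
  proof -
    have "T (i, j) \<le> T (i, j')" using that by (auto simp: ssyt_def)
    moreover have "T (i, j) \<noteq> T (i, j')"
      using inj_onD[OF bij_betw_imp_inj_on[OF bij[OF that(1)]], of "(i, j)" "(i, j')"] that(2,3) by auto
    ultimately show ?thesis by simp
  qed
  have "bij_betw ?f ?S (syt p)"
  proof (rule bij_betw_byWitness[where f' = ?g])
    show "\<forall>T\<in>?S. ?g (?f T) = T"
    proof
      fix T assume "T \<in> ?S"
      then have "T \<in> extensional (diagram p)" by (simp add: ssyt_def)
      then show "?g (?f T) = T" by (auto simp: fun_eq_iff extensional_def restrict_def)
    qed
    show "\<forall>T\<in>syt p. ?f (?g T) = T"
    proof
      fix T assume T: "T \<in> syt p"
      have "T x \<noteq> 0" if "x \<in> diagram p" for x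
        using T that bij_betwE[of T "diagram p" "{1..sum_list p}"] by (auto simp: syt_def simp del: split_paired_All)
      then show "?f (?g T) = T" using T by (auto simp: fun_eq_iff extensional_def restrict_def syt_def)
    qed
    show "?f ` ?S \<subseteq> syt p"
    proof (rule image_subsetI)
      fix T assume T: "T \<in> ?S"
      have "bij_betw (Suc \<circ> T) (diagram p) {1..n}"
        by (rule bij_betw_trans[OF bij[OF T]]) (auto simp: bij_betw_def lessThan_atLeast0 image_Suc_atLeastLessThan)
      then have "bij_betw (?f T) (diagram p) {1..n}" 
        by (rule bij_betw_cong[THEN iffD1, rotated]) auto
      then show "?f T \<in> syt p"
        using strict[OF T] T by (auto simp: syt_def n ssyt_def)
    qed
    show "?g ` syt p \<subseteq> ?S"
    proof (rule image_subsetI)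
      fix T assume T: "T \<in> syt p"
      have b: "bij_betw T (diagram p) {1..n}" using T by (simp add: syt_def n)
      have "bij_betw ((\<lambda>x. x - 1) \<circ> T) (diagram p) {..<n}"
        by (rule bij_betw_trans[OF b]) (rule bij_betw_byWitness[where f' = Suc], auto)
      then have gb: "bij_betw (?g T) (diagram p) {..<n}" 
        by (rule bij_betw_cong[THEN iffD1, rotated]) auto
      have pos: "1 \<le> T (i, j)" if "j < part p i" for i j
        using bij_betwE[OF b] that by auto
      have row: "T (i, j) - 1 \<le> T (i, j') - 1" if "j < j'" "j' < part p i" for i j j'
        using T that by (intro diff_le_mono less_imp_le) (auto simp: syt_def)
      have col: "T (i, j) - 1 < T (i', j) - 1" if "i < i'" "j < part p i" "j < part p i'" for i i' j
        using T that pos by (intro diff_less_mono) (auto simp: syt_def)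
      have "?g T \<in> ssyt p"
        using row col by (auto simp: ssyt_def)
      then show "?g T \<in> ?S" using S gb by blast
    qed
  qed
  then show ?thesis unfolding num_syt_def schur_def by (simp add: bij_betw_same_card)
qed

lemma schur_map_key:
  assumes p: "p \<turnstile> n" and w: "w permutes {..<N}" and a: "Poly_Mapping.keys a \<subseteq> {..<N}"
  shows "schur p (Poly_Mapping.map_key w a) = schur p a"
proof -
  have keys: "Poly_Mapping.keys (Poly_Mapping.map_key w a) \<subseteq> {..<N}"
  proof
    fix i assume "i \<in> Poly_Mapping.keys (Poly_Mapping.map_key w a)"
    then have "w i \<in> {..<N}" using a by (auto simp: keys_map_key[OF permutes_inj[OF w]])
    then show "i \<in> {..<N}" using permutes_in_image[OF w, of i] by simp
  qed
  have sc: "schur p b = (\<Sum>r\<in>gt N p. if weight p r = b then 1 else 0)" if "Poly_Mapping.keys b \<subseteq> {..<N}" for b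
    using finite_gt[OF p] by (simp add: schur_eq_card_gt[OF p that] sum.If_cases Int_def)
  have inj: "Poly_Mapping.map_key w u = Poly_Mapping.map_key w a \<longleftrightarrow> u = a" for u
  proof
    assume eq: "Poly_Mapping.map_key w u = Poly_Mapping.map_key w a"
    show "u = a"
    proof (rule poly_mapping_eqI)
      fix i
      obtain j where "w j = i" using permutes_surj[OF w] by (metis surjD)
      then show "Poly_Mapping.lookup u i = Poly_Mapping.lookup a i"
        using arg_cong[OF eq, of "\<lambda>v. Poly_Mapping.lookup v j"] by (simp add: lookup_map_key_permutes[OF w])
    qed
  qed simp
  show ?thesis
    unfolding sc[OF keys] sc[OF a]
    using sum_weight_symmetric[OF p w, of "\<lambda>u. if u = Poly_Mapping.map_key w a then 1 else (0 :: int)"]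
    by (simp add: inj)
qed

text \<open>By symmetry only the number of variables matters; \<open>w\<close> is some permutation
  carrying \<open>{..<k}\<close> onto \<open>A\<close>.\<close>

lemma schur_exp_ones:
  assumes p: "p \<turnstile> k" and A: "A \<subseteq> {..<N}"
  shows "schur p (exp_ones A) = (if card A = k then int (num_syt p) else 0)"
proof (cases "card A = k")
  case False
  then show ?thesis using schur_eq_0[OF p, of "exp_ones A"] finite_subset[OF A] by (simp add: exp_total_exp_ones)
next
  case True
  have finA: "finite A" using A finite_subset by blast
  have kN: "k \<le> N" using card_mono[OF _ A] True by simp
  obtain f where f: "bij_betw f {..<k} A" using ex_bij_betw_nat_finite[OF finA] True by (auto simp: lessThan_atLeast0)
  have "card ({..<N} - {..<k}) = card ({..<N} - A)" using A kN finA True by (simp add: card_Diff_subset)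
  then obtain g where g: "bij_betw g ({..<N} - {..<k}) ({..<N} - A)"
    using finite_same_card_bij[of "{..<N} - {..<k}" "{..<N} - A"] by auto
  define w where "w i = (if i < k then f i else if i < N then g i else i)" for i
  have wf: "bij_betw w {..<k} A" using f by (rule bij_betw_cong[THEN iffD1, rotated]) (simp add: w_def)
  have wg: "bij_betw w ({..<N} - {..<k}) ({..<N} - A)" using g by (rule bij_betw_cong[THEN iffD1, rotated]) (auto simp: w_def)
  have "bij_betw w ({..<k} \<union> ({..<N} - {..<k})) (A \<union> ({..<N} - A))"
    by (rule bij_betw_combine[OF wf wg]) auto
  moreover have "{..<k} \<union> ({..<N} - {..<k}) = {..<N}" "A \<union> ({..<N} - A) = {..<N}" using A kN by auto
  ultimately have "bij_betw w {..<N} {..<N}" by simp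
  then have w: "w permutes {..<N}" by (rule bij_imp_permutes) (use kN in \<open>simp add: w_def\<close>)
  have mem: "w i \<in> A \<longleftrightarrow> i < k" for i
  proof (cases "i < k")
    case True then show ?thesis using bij_betwE[OF wf] by simp
  next
    case False
    then show ?thesis using bij_betwE[OF wg] A by (cases "i < N") (auto simp: w_def)
  qed
  have "Poly_Mapping.map_key w (exp_ones A) = exp_ones {..<k}"
    by (rule poly_mapping_eqI) (simp add: lookup_map_key_permutes[OF w] lookup_exp_ones finA mem)
  then show ?thesis
    using schur_map_key[OF p w, of "exp_ones A"] A finA True num_syt_eq_schur[OF p] by (simp add: keys_exp_ones)
qed

text \<open>To factor a squarefree monomial is to choose the subset of variables that goes to the
  first factor.\<close>

lemma mseries_mult_schur_exp_ones:
  assumes p: "p \<turnstile> k" and q: "q \<turnstile> l"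
  shows "mseries_mult (schur p) (schur q) (exp_ones {..<k + l}) = int ((k + l choose k) * (num_syt p * num_syt q))"
proof -
  let ?n = "k + l" and ?f = "\<lambda>A. (exp_ones A, exp_ones ({..<k + l} - A))"
  have fin: "finite A" if "A \<in> Pow {..<?n}" for A using that finite_subset by auto
  have inj: "inj_on ?f (Pow {..<?n})"
    by (rule inj_onI) (metis Pair_inject fin keys_exp_ones)
  have im: "?f ` Pow {..<?n} = {(b, c). b + c = exp_ones {..<?n}}"
  proof (intro equalityI subsetI)
    fix x assume "x \<in> ?f ` Pow {..<?n}"
    then obtain A where A: "A \<in> Pow {..<?n}" "x = ?f A" by blast
    have "exp_ones A + exp_ones ({..<?n} - A) = exp_ones {..<?n}"
      using A(1) fin[OF A(1)] by (intro poly_mapping_eqI) (auto simp: lookup_add lookup_exp_ones)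
    then show "x \<in> {(b, c). b + c = exp_ones {..<?n}}" using A by simp
  next
    fix x assume "x \<in> {(b, c). b + c = exp_ones {..<?n}}"
    then obtain b c where x: "x = (b, c)" "b + c = exp_ones {..<?n}" by auto
    have bc: "Poly_Mapping.lookup b i + Poly_Mapping.lookup c i = (if i < ?n then 1 else 0)" for i
      using arg_cong[OF x(2), of "\<lambda>v. Poly_Mapping.lookup v i"] by (simp add: lookup_add lookup_exp_ones)
    let ?A = "Poly_Mapping.keys b"
    have A: "?A \<subseteq> {..<?n}"
    proof
      fix i assume "i \<in> ?A"
      then show "i \<in> {..<?n}" using bc[of i] by (simp add: in_keys_iff split: if_splits)
    qed
    have bi: "Poly_Mapping.lookup b i = (if i \<in> ?A then 1 else 0)" for i
      using bc[of i] unfolding in_keys_iff by (cases "i < ?n") auto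
    have "b = exp_ones ?A"
      by (rule poly_mapping_eqI) (simp add: lookup_exp_ones bi[symmetric])
    moreover have "c = exp_ones ({..<?n} - ?A)"
    proof (rule poly_mapping_eqI)
      fix i
      show "Poly_Mapping.lookup c i = Poly_Mapping.lookup (exp_ones ({..<?n} - ?A)) i"
        using bc[of i] bi[of i] by (auto simp: lookup_exp_ones split: if_splits)
    qed
    ultimately show "x \<in> ?f ` Pow {..<?n}" using A x(1) by blast
  qed
  have "mseries_mult (schur p) (schur q) (exp_ones {..<?n}) = (\<Sum>A\<in>Pow {..<?n}. schur p (exp_ones A) * schur q (exp_ones ({..<?n} - A)))"
    unfolding mseries_mult_def im[symmetric] by (subst sum.reindex[OF inj]) simp
  also have "\<dots> = (\<Sum>A\<in>Pow {..<?n}. if card A = k then int (num_syt p * num_syt q) else 0)"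
  proof (rule sum.cong[OF refl])
    fix A assume A: "A \<in> Pow {..<?n}"
    then have "card ({..<?n} - A) = ?n - card A" using fin[OF A] by (simp add: card_Diff_subset)
    then show "schur p (exp_ones A) * schur q (exp_ones ({..<?n} - A)) = (if card A = k then int (num_syt p * num_syt q) else 0)"
      using A schur_exp_ones[OF p, of A ?n] schur_exp_ones[OF q, of "{..<?n} - A" ?n] by auto
  qed
  also have "\<dots> = int (card {A \<in> Pow {..<?n}. card A = k} * (num_syt p * num_syt q))"
    by (simp add: sum.If_cases Int_def)
  also have "{A \<in> Pow {..<?n}. card A = k} = {A. A \<subseteq> {..<?n} \<and> card A = k}" by auto
  also have "card \<dots> = ?n choose k" by (simp add: n_subsets)
  finally show ?thesis .
qed

section \<open>Restriction, induction and the sum of squares\<close>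

lemma exp_append_ones: "exp_append k (exp_ones {..<k}) (exp_ones {..<l}) = exp_ones {..<k + l}"
  by (rule poly_mapping_eqI) (auto simp: lookup_exp_append lookup_exp_ones)

lemma finite_partitions [simp]: "finite {p. p \<turnstile> n}"
  using finite_subset[of "{p. p \<turnstile> n}" "partitions_upto n"] by (auto intro: partitions_uptoI)

lemma sum_partitions_upto:
  assumes "n \<le> m" "\<And>p. p \<in> partitions_upto m \<Longrightarrow> \<not> p \<turnstile> n \<Longrightarrow> f p = 0"
  shows "(\<Sum>p\<in>partitions_upto m. f p) = (\<Sum>p | p \<turnstile> n. f p)"
  by (rule sum.mono_neutral_right) (use assms in \<open>auto intro: partitions_uptoI\<close>)

lemma schur_ones:
  assumes "p \<in> partitions_upto m"
  shows "schur p (exp_ones {..<n}) = (if p \<turnstile> n then int (num_syt p) else 0)"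
proof (cases "p \<turnstile> n")
  case True then show ?thesis by (simp add: num_syt_eq_schur)
next
  case False
  obtain k where "p \<turnstile> k" using assms by (auto simp: partitions_upto_def)
  then show ?thesis using False schur_eq_0[of p k "exp_ones {..<n}"] by (auto simp: exp_total_exp_ones)
qed

text \<open>The coproduct at squarefree monomials: the dimension count for restriction to a Young
  subgroup.\<close>

lemma num_syt_restrict:
  assumes s: "s \<turnstile> k + l"
  shows "int (num_syt s) = (\<Sum>p | p \<turnstile> k. \<Sum>q | q \<turnstile> l. lr_coeff p q s * int (num_syt p) * int (num_syt q))"
proof -
  let ?P = "partitions_upto (k + l)"
  have "int (num_syt s) = schur s (exp_append k (exp_ones {..<k}) (exp_ones {..<l}))"
    using num_syt_eq_schur[OF s] by (simp add: exp_append_ones)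
  also have "\<dots> = (\<Sum>p\<in>?P. \<Sum>q\<in>?P. lr_coeff p q s * schur p (exp_ones {..<k}) * schur q (exp_ones {..<l}))"
    by (rule schur_append[OF s order_refl]) (simp add: keys_exp_ones)
  also have "\<dots> = (\<Sum>p | p \<turnstile> k. \<Sum>q\<in>?P. lr_coeff p q s * schur p (exp_ones {..<k}) * schur q (exp_ones {..<l}))"
    by (rule sum_partitions_upto) (auto simp: schur_ones)
  also have "\<dots> = (\<Sum>p | p \<turnstile> k. \<Sum>q | q \<turnstile> l. lr_coeff p q s * schur p (exp_ones {..<k}) * schur q (exp_ones {..<l}))"
    by (rule sum.cong[OF refl], rule sum_partitions_upto) (auto simp: schur_ones)
  also have "\<dots> = (\<Sum>p | p \<turnstile> k. \<Sum>q | q \<turnstile> l. lr_coeff p q s * int (num_syt p) * int (num_syt q))"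
    by (intro sum.cong refl) (simp add: num_syt_eq_schur)
  finally show ?thesis .
qed

text \<open>The product at a squarefree monomial: the dimension of the induced
  representation.\<close>

lemma num_syt_induce:
  assumes p: "p \<turnstile> k" and q: "q \<turnstile> l"
  shows "(\<Sum>s | s \<turnstile> k + l. lr_coeff p q s * int (num_syt s)) = int ((k + l choose k) * (num_syt p * num_syt q))"
proof -
  have "int ((k + l choose k) * (num_syt p * num_syt q)) = (\<Sum>s\<in>partitions_upto (k + l). lr_coeff p q s * schur s (exp_ones {..<k + l}))"
    using mseries_mult_schur_exp_ones[OF p q] schur_mult[OF p q order_refl] by metis
  also have "\<dots> = (\<Sum>s | s \<turnstile> k + l. lr_coeff p q s * schur s (exp_ones {..<k + l}))"
    by (rule sum_partitions_upto) (auto simp: schur_ones)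
  also have "\<dots> = (\<Sum>s | s \<turnstile> k + l. lr_coeff p q s * int (num_syt s))"
    by (intro sum.cong refl) (simp add: num_syt_eq_schur)
  finally show ?thesis by simp
qed

lemma lr_coeff_mult_num_syt_le:
  assumes p: "p \<turnstile> k" and q: "q \<turnstile> l" and s: "s \<turnstile> k + l"
  shows "lr_coeff p q s * int (num_syt p) * int (num_syt q) \<le> int (num_syt s)"
    "lr_coeff p q s * int (num_syt s) \<le> int ((k + l choose k) * (num_syt p * num_syt q))"
proof -
  have "lr_coeff p q s * int (num_syt p) * int (num_syt q) \<le> (\<Sum>q | q \<turnstile> l. lr_coeff p q s * int (num_syt p) * int (num_syt q))"
    using q p lr_coeff_nonneg by (intro member_le_sum) auto
  also have "\<dots> \<le> (\<Sum>p | p \<turnstile> k. \<Sum>q | q \<turnstile> l. lr_coeff p q s * int (num_syt p) * int (num_syt q))"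
    using p lr_coeff_nonneg
    by (intro member_le_sum[of p _ "\<lambda>p. \<Sum>q | q \<turnstile> l. lr_coeff p q s * int (num_syt p) * int (num_syt q)"] sum_nonneg) auto
  finally show "lr_coeff p q s * int (num_syt p) * int (num_syt q) \<le> int (num_syt s)"
    by (simp add: num_syt_restrict[OF s])
  show "lr_coeff p q s * int (num_syt s) \<le> int ((k + l choose k) * (num_syt p * num_syt q))"
    unfolding num_syt_induce[OF p q, symmetric]
    using s lr_coeff_nonneg[OF p q] by (intro member_le_sum) auto
qed

text \<open>One factor of each square is restricted; summing over \<open>s\<close> then induces the
  other. With \<open>l = 1\<close> this is a recursion giving \<open>fact n\<close>, in place of the
  Robinson--Schensted bijection.\<close>

lemma sum_num_syt_squared_add:
  "(\<Sum>s | s \<turnstile> k + l. int (num_syt s) ^ 2) = int (k + l choose k) * (\<Sum>p | p \<turnstile> k. int (num_syt p) ^ 2) * (\<Sum>q | q \<turnstile> l. int (num_syt q) ^ 2)"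
proof -
  have "(\<Sum>s | s \<turnstile> k + l. int (num_syt s) ^ 2) =
    (\<Sum>s | s \<turnstile> k + l. \<Sum>p | p \<turnstile> k. \<Sum>q | q \<turnstile> l. int (num_syt p) * int (num_syt q) * (lr_coeff p q s * int (num_syt s)))"
  proof (rule sum.cong[OF refl])
    fix s assume "s \<in> {s. s \<turnstile> k + l}"
    then have s: "s \<turnstile> k + l" by simp
    have "int (num_syt s) ^ 2 = int (num_syt s) * (\<Sum>p | p \<turnstile> k. \<Sum>q | q \<turnstile> l. lr_coeff p q s * int (num_syt p) * int (num_syt q))"
      unfolding power2_eq_square by (subst (2) num_syt_restrict[OF s]) simp
    then show "int (num_syt s) ^ 2 = (\<Sum>p | p \<turnstile> k. \<Sum>q | q \<turnstile> l. int (num_syt p) * int (num_syt q) * (lr_coeff p q s * int (num_syt s)))"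
      by (simp add: sum_distrib_left mult_ac)
  qed
  also have "\<dots> = (\<Sum>p | p \<turnstile> k. \<Sum>s | s \<turnstile> k + l. \<Sum>q | q \<turnstile> l. int (num_syt p) * int (num_syt q) * (lr_coeff p q s * int (num_syt s)))"
    by (rule sum.swap)
  also have "\<dots> = (\<Sum>p | p \<turnstile> k. \<Sum>q | q \<turnstile> l. \<Sum>s | s \<turnstile> k + l. int (num_syt p) * int (num_syt q) * (lr_coeff p q s * int (num_syt s)))"
    by (intro sum.cong refl sum.swap)
  also have "\<dots> = (\<Sum>p | p \<turnstile> k. \<Sum>q | q \<turnstile> l. int (num_syt p) * int (num_syt q) * int ((k + l choose k) * (num_syt p * num_syt q)))"
    unfolding sum_distrib_left[symmetric] by (intro sum.cong refl) (simp only: num_syt_induce mem_Collect_eq)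
  also have "\<dots> = int (k + l choose k) * (\<Sum>p | p \<turnstile> k. \<Sum>q | q \<turnstile> l. int (num_syt p) ^ 2 * int (num_syt q) ^ 2)"
    unfolding sum_distrib_left by (intro sum.cong refl) (simp add: power2_eq_square mult_ac)
  finally show ?thesis by (simp add: sum_product mult.assoc)
qed

lemma num_syt_Nil: "num_syt [] = 1"
proof -
  have "int (num_syt []) = 1"
    using num_syt_eq_schur[OF Nil_partition] schur_0[OF Nil_partition] keys_exp_ones[of "{}"] by simp
  then show ?thesis by simp
qed

lemma num_syt_one: "p \<turnstile> 1 \<Longrightarrow> p = [1] \<and> num_syt p = 1"
proof -
  assume p: "p \<turnstile> 1"
  have p1: "p = [1]"
    using p partition_length_le[OF p] by (cases p) (auto simp: partition_of_def)
  have d: "diagram [1] = {(0, 0)}" by (auto simp: diagram_def)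
  have "syt p = {\<lambda>x\<in>{(0,0)}. 1}"
    unfolding p1 syt_def d by (auto simp: extensional_def fun_eq_iff bij_betw_def)
  then show ?thesis using p1 by (simp add: num_syt_def)
qed

lemma sum_num_syt_squared: "(\<Sum>p | p \<turnstile> n. int (num_syt p) ^ 2) = fact n"
proof (induction n)
  case 0
  have "{p. p \<turnstile> 0} = {[]}" using Nil_partition by (auto simp: partition_of_def) (metis list.set_intros(1) neq_Nil_conv)
  then show ?case by (simp add: num_syt_Nil)
next
  case (Suc n)
  have "{p. p \<turnstile> 1} = {[1]}" using num_syt_one by (auto simp: partition_of_def)
  moreover have "num_syt [1] = 1" using num_syt_one[of "[1]"] by (simp add: partition_of_def)
  ultimately have "(\<Sum>q | q \<turnstile> 1. int (num_syt q) ^ 2) = 1" by simp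
  then show ?case using sum_num_syt_squared_add[of n 1] Suc by simp
qed

lemma num_syt_squared_le_fact:
  assumes "p \<turnstile> n" shows "num_syt p ^ 2 \<le> fact n"
proof -
  have "int (num_syt p) ^ 2 \<le> (\<Sum>p | p \<turnstile> n. int (num_syt p) ^ 2)"
    using assms by (intro member_le_sum) auto
  then have "int (num_syt p ^ 2) \<le> int (fact n)" using sum_num_syt_squared[of n] by simp
  then show ?thesis by linarith
qed

lemma partition_remove_box:
  assumes q: "q \<turnstile> Suc n"
  obtains p where "p \<turnstile> n" "horizontal_strip p q"
proof -
  define l where "l = length q - 1"
  have "q \<noteq> []" using q by (auto simp: partition_of_def)
  then have l: "length q = Suc l" by (simp add: l_def)
  then have pos: "0 < part q l" using part_pos[OF q, of l] by simp
  define g where "g i = (if i = l then part q l - 1 else part q i)" for i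
  have le: "part q (Suc i) \<le> part q i" for i by (rule part_antimono[OF q]) simp
  have ql: "part q (Suc l) = 0" using l by (simp add: part_beyond)
  have anti: "g (Suc i) \<le> g i" for i using le[of i] ql pos by (auto simp: g_def)
  have g0: "g (Suc l) = 0" using ql by (simp add: g_def)
  obtain p where p: "p \<turnstile> (\<Sum>i<Suc l. g i)" "part p = g" using partition_exI[of g "Suc l", OF anti g0] .
  have "(\<Sum>i<Suc l. part q i) = Suc n" using sum_part_partition[OF q, of "Suc l"] l by simp
  then have "(\<Sum>i<Suc l. g i) = n" using pos by (simp add: g_def)
  moreover have "horizontal_strip p q"
    using le ql pos by (auto simp: horizontal_strip_def p(2) g_def)
  ultimately show ?thesis using that p(1) by simp
qed

text \<open>Adding a cell cannot lower the count, by the Pieri rule for one cell and the restriction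
  inequality. Positivity gives the logarithms below their meaning.\<close>

lemma num_syt_pos: "p \<turnstile> n \<Longrightarrow> 1 \<le> num_syt p"
proof (induction n arbitrary: p)
  case 0
  then have "p = []" using partition_length_le by fastforce
  then show ?case by (simp add: num_syt_Nil)
next
  case (Suc n)
  obtain q where q: "q \<turnstile> n" "horizontal_strip q p" by (rule partition_remove_box[OF Suc.prems])
  have "lr_coeff q (row_part 1) p = 1" using pieri[OF q(1), of p 1] Suc.prems q(2) by simp
  moreover have "num_syt (row_part 1) = 1" by (rule conjunct2[OF num_syt_one[OF row_partition]])
  ultimately have "int (num_syt q) \<le> int (num_syt p)"
    using lr_coeff_mult_num_syt_le(1)[OF q(1) row_partition, of p 1] Suc.prems by simp
  then show ?case using Suc.IH[OF q(1)] by simp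
qed

section \<open>Asymptotics\<close>

text \<open>As \<open>n < s * s\<close>, the diagram contains no square of side \<open>s\<close>, so
  the first \<open>s\<close> row lengths and the first \<open>s\<close> column lengths determine the
  partition.\<close>

lemma card_partitions_upto:
  assumes n: "n < s * s"
  shows "card (partitions_upto n) \<le> (n + 1) ^ (2 * s)"
proof -
  let ?E = "{..<s} \<rightarrow>\<^sub>E {..n}"
  define col where "col p c = card {i. c < part p i}" for p c
  define F where "F p = (\<lambda>i\<in>{..<s}. part p i, \<lambda>c\<in>{..<s}. col p c)" for p
  have col: "c < part p i \<longleftrightarrow> i < col p c" if "p \<turnstile> k" for p k c i
  proof -
    have "{i. c < part p i} \<subseteq> {..<length p}" by (auto simp: part_def split: if_splits)
    then have "{i. c < part p i} = {..<col p c}"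
      unfolding col_def using part_antimono[OF that] by (intro card_initial_segment) (auto intro: less_le_trans less_imp_le)
    then show ?thesis by blast
  qed
  have bound: "part p i \<le> n" "col p c \<le> n" if p: "p \<in> partitions_upto n" for p i c
  proof -
    obtain k where k: "p \<turnstile> k" "k \<le> n" using p by (auto simp: partitions_upto_def)
    have "part p i \<le> (\<Sum>i'<max (Suc i) (length p). part p i')" by (rule member_le_sum) auto
    also have "\<dots> = k" by (rule sum_part_partition[OF k(1)]) simp
    finally show "part p i \<le> n" using k(2) by simp
    have "col p c \<le> card {..<length p}"
      unfolding col_def by (rule card_mono) (auto simp: part_def split: if_splits)
    then show "col p c \<le> n" using partition_length_le[OF k(1)] k(2) by simp
  qed
  have small: "part p i < s" if p: "p \<in> partitions_upto n" and i: "s \<le> i" for p i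
  proof (rule ccontr)
    assume ge: "\<not> part p i < s"
    obtain k where k: "p \<turnstile> k" "k \<le> n" using p by (auto simp: partitions_upto_def)
    have "s * s = (\<Sum>i'<s. s)" by simp
    also have "\<dots> \<le> (\<Sum>i'<s. part p i')"
    proof (rule sum_mono)
      fix i' assume "i' \<in> {..<s}"
      then show "s \<le> part p i'" using ge part_antimono[OF k(1), of i' i] i by simp
    qed
    also have "\<dots> \<le> (\<Sum>i'<max s (length p). part p i')" by (rule sum_mono2) auto
    also have "\<dots> = k" by (rule sum_part_partition[OF k(1)]) simp
    finally show False using k(2) n by simp
  qed
  have "inj_on F (partitions_upto n)"
  proof (rule inj_onI)
    fix p q assume p: "p \<in> partitions_upto n" and q: "q \<in> partitions_upto n" and eq: "F p = F q"
    obtain k where k: "p \<turnstile> k" using p by (auto simp: partitions_upto_def)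
    obtain l where l: "q \<turnstile> l" using q by (auto simp: partitions_upto_def)
    have 1: "part p i = part q i" if "i < s" for i
      using that fun_cong[OF conjunct1[OF eq[unfolded F_def prod.inject]], of i] by simp
    have 2: "col p c = col q c" if "c < s" for c
      using that fun_cong[OF conjunct2[OF eq[unfolded F_def prod.inject]], of c] by simp
    have "part p i = part q i" for i
    proof (cases "i < s")
      case False
      have "c < part p i \<longleftrightarrow> c < part q i" for c
        using col[OF k, of c i] col[OF l, of c i] 2[of c] small[OF p, of i] small[OF q, of i] False
        by (cases "c < s") auto
      then show ?thesis by (meson linorder_neqE_nat less_irrefl)
    qed (rule 1)
    then show "p = q" by (intro partition_eqI[OF k l] ext)
  qed
  moreover have "F ` partitions_upto n \<subseteq> ?E \<times> ?E"
    using bound by (intro image_subsetI) (simp add: F_def restrict_PiE_iff)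
  ultimately have "card (partitions_upto n) \<le> card (?E \<times> ?E)"
    by (rule card_inj_on_le) (auto intro: finite_PiE)
  also have "\<dots> = (n + 1) ^ (2 * s)"
    by (simp add: card_cartesian_product card_PiE mult_2 power_add)
  finally show ?thesis .
qed

lemma ln_card_partitions_upto:
  "ln (real (card (partitions_upto n))) \<le> 2 * (sqrt (real n) + 1) * ln (real n + 1)"
proof -
  define s where "s = nat \<lfloor>sqrt (real n)\<rfloor> + 1"
  have s: "sqrt (real n) < real s" "real s \<le> sqrt (real n) + 1"
    unfolding s_def by (simp_all, linarith)
  have s0: "0 < s" by (simp add: s_def)
  have "sqrt (real n) * sqrt (real n) < real s * real s"
    by (intro mult_strict_mono) (use s(1) s0 in auto)
  then have "real n < real s * real s" by simp
  then have "n < s * s" by (metis of_nat_less_iff of_nat_mult)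
  then have "card (partitions_upto n) \<le> (n + 1) ^ (2 * s)" by (rule card_partitions_upto)
  then have "real (card (partitions_upto n)) \<le> (real n + 1) ^ (2 * s)"
    by (metis of_nat_1 of_nat_add of_nat_le_iff of_nat_power)
  moreover have "0 < card (partitions_upto n)"
    using partitions_uptoI[OF Nil_partition, of n] by (auto simp: card_gt_0_iff)
  ultimately have "ln (real (card (partitions_upto n))) \<le> ln ((real n + 1) ^ (2 * s))"
    by simp
  also have "\<dots> = 2 * real s * ln (real n + 1)" by (simp add: ln_realpow)
  also have "\<dots> \<le> 2 * (sqrt (real n) + 1) * ln (real n + 1)"
    using s(2) by (intro mult_right_mono) auto
  finally show ?thesis .
qed

text \<open>Any exponent strictly between 1/2 and 1 would serve: above 1/2 it absorbs the
  logarithms, below 1 it gains under splitting.\<close>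

lemma error_growth:
  obtains E where "0 \<le> E" "\<And>n. (sqrt (real n) + 1) * ln (real n + 1) * ln (real n) \<le> E * real n powr (3/4)"
proof -
  define X where "X n = (sqrt (real n) + 1) * ln (real n + 1) * ln (real n) / real n powr (3/4)" for n
  have "X \<longlonglongrightarrow> 0" unfolding X_def by real_asymp
  then have "Bseq X" by (rule convergent_imp_Bseq[OF convergentI])
  then obtain K where K: "0 < K" "\<And>n. norm (X n) \<le> K" by (auto elim: BseqE)
  have "(sqrt (real n) + 1) * ln (real n + 1) * ln (real n) \<le> K * real n powr (3/4)" for n
  proof (cases "n = 0")
    case False
    then have "0 < real n powr (3/4)" by simp
    moreover have "X n \<le> K" using K(2)[of n] by simp
    ultimately show ?thesis by (simp add: X_def divide_le_eq)
  qed simp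
  then show ?thesis using that K(1) by (meson less_imp_le)
qed

text \<open>Write \<open>x powr (3/4)\<close> as \<open>x * x powr (-1/4)\<close>. Both parts are at
  most \<open>3/4 * n\<close>, so the second factor is at least
  \<open>(3/4 * n) powr (-1/4)\<close>, and the parts add up to \<open>n\<close>.\<close>

lemma powr_split_gain:
  fixes k l n :: real
  assumes "0 < k" "0 < l" "k + l = n" "k \<le> 3/4 * n" "l \<le> 3/4 * n"
  shows "(4/3) powr (1/4) * n powr (3/4) \<le> k powr (3/4) + l powr (3/4)"
proof -
  have n: "0 < n" using assms by simp
  have *: "x * (3/4 * n) powr (-1/4) \<le> x powr (3/4)" if "0 < x" "x \<le> 3/4 * n" for x
  proof -
    have "(3/4 * n) powr (-1/4) \<le> x powr (-1/4)" using that by (intro powr_mono2') auto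
    then have "x * (3/4 * n) powr (-1/4) \<le> x powr 1 * x powr (-1/4)" using that by simp
    also have "\<dots> = x powr (1 + -1/4)" by (rule powr_add[symmetric])
    also have "\<dots> = x powr (3/4)" by simp
    finally show ?thesis .
  qed
  have "(4/3) powr (1/4) * n powr (3/4) = n * (3/4 * n) powr (-1/4)"
  proof -
    have "(3/4 * n) powr (-1/4) = (3/4) powr (-1/4) * n powr (-1/4)" by (rule powr_mult)
    also have "(3/4 :: real) powr (-1/4) = (4/3) powr (1/4)"
      by (simp add: powr_minus powr_divide)
    finally have "n * (3/4 * n) powr (-1/4) = (4/3) powr (1/4) * (n powr 1 * n powr (-1/4))" using n by simp
    moreover have "n powr 1 * n powr (-1/4) = n powr (1 + -1/4)" by (rule powr_add[symmetric])
    ultimately show ?thesis by simp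
  qed
  also have "\<dots> = k * (3/4 * n) powr (-1/4) + l * (3/4 * n) powr (-1/4)"
    using assms(3) by (simp add: distrib_right[symmetric])
  also have "\<dots> \<le> k powr (3/4) + l powr (3/4)" using assms * by (intro add_mono) auto
  finally show ?thesis .
qed

text \<open>A single term of the expansion of \<open>(1/2 + 1) ^ n\<close>. The weight 1/2 is not
  the optimal one, but the resulting rate is still below \<open>ln 2\<close>.\<close>

lemma ln_binomial_unbalanced:
  assumes "4 * k \<le> n"
  shows "ln (real (n choose k)) \<le> real n * (ln (3/2) + ln 2 / 4)"
proof -
  have kn: "k \<le> n" using assms by simp
  have "real (n choose k) * (1/2) ^ k \<le> (\<Sum>i\<le>n. real (n choose i) * (1/2) ^ i * 1 ^ (n - i))"
    using kn by (intro order_trans[OF _ member_le_sum[of k]]) auto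
  also have "\<dots> = (1/2 + 1) ^ n" by (rule binomial_ring[symmetric])
  finally have "real (n choose k) * (1/2) ^ k \<le> (3/2) ^ n" by simp
  then have "real (n choose k) \<le> (3/2) ^ n * 2 ^ k" by (simp add: power_divide field_simps)
  then have "ln (real (n choose k)) \<le> ln ((3/2) ^ n * 2 ^ k)" using kn by simp
  also have "\<dots> = real n * ln (3/2) + real k * ln 2" by (simp add: ln_mult ln_realpow)
  also have "\<dots> \<le> real n * ln (3/2) + real n / 4 * ln 2"
    using assms by (intro add_left_mono mult_right_mono) auto
  finally show ?thesis by (simp add: algebra_simps)
qed

lemma ln_binomial_le: "ln (real (n choose k)) \<le> real n * ln 2"
proof (cases "k \<le> n")
  case True
  have "real (n choose k) \<le> 2 ^ n" using binomial_le_pow2[of n k] by (metis of_nat_le_iff of_nat_numeral of_nat_power)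
  then have "ln (real (n choose k)) \<le> ln (2 ^ n)" using True by simp
  then show ?thesis by (simp add: ln_realpow)
qed (simp add: binomial_eq_0)

text \<open>Allows the central binomial coefficient to be replaced by \<open>2 ^ n\<close> at a
  logarithmic cost.\<close>

lemma two_power_le_central_binomial: "2 ^ n \<le> (n + 1) * (n choose (n div 2))"
proof -
  have "2 ^ n = (\<Sum>k\<le>n. n choose k)" by (rule choose_row_sum[symmetric])
  also have "\<dots> \<le> (\<Sum>k\<le>n. n choose (n div 2))" by (intro sum_mono binomial_maximum)
  finally show ?thesis by simp
qed

section \<open>Defects and deficiencies\<close>

definition defect :: "nat list \<Rightarrow> nat \<Rightarrow> real" where
  "defect p n = ln (fact n) / 2 - ln (real (num_syt p))"

text \<open>Measuring the deficiency against \<open>2 powr (n / 2)\<close> rather than the square root of the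
  binomial coefficient makes it additive under Mackey's formula.\<close>

definition lr_defect :: "nat list \<Rightarrow> nat list \<Rightarrow> nat list \<Rightarrow> nat \<Rightarrow> real" where
  "lr_defect p q s n = real n * ln 2 / 2 - ln (real_of_int (lr_coeff p q s))"

lemma defect_nonneg:
  assumes "p \<turnstile> n" shows "0 \<le> defect p n"
proof -
  have "real (num_syt p) ^ 2 \<le> fact n"
    using num_syt_squared_le_fact[OF assms] by (metis of_nat_fact of_nat_le_iff of_nat_power)
  moreover have "0 < real (num_syt p)" using num_syt_pos[OF assms] by simp
  ultimately have "ln (real (num_syt p) ^ 2) \<le> ln (fact n)" by simp
  then show ?thesis by (simp add: defect_def ln_realpow)
qed

lemma defect_le_trivial:
  assumes "p \<turnstile> n" shows "defect p n \<le> real n * ln (real n) / 2"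
proof (cases "n = 0")
  case True then show ?thesis using num_syt_pos[OF assms] by (simp add: defect_def)
next
  case False
  have "(fact n :: real) \<le> real n ^ n" using fact_le_power[of n, where 'a = real] by simp
  then have "ln (fact n :: real) \<le> ln (real n ^ n)" using False by (subst ln_le_cancel_iff) auto
  then have "ln (fact n :: real) \<le> real n * ln (real n)" using False by (simp add: ln_realpow)
  moreover have "0 \<le> ln (real (num_syt p))" using num_syt_pos[OF assms] by simp
  ultimately show ?thesis by (simp add: defect_def)
qed

text \<open>All three come from \<open>lr_coeff_mult_num_syt_le\<close> in logarithms. Adding its
  two inequalities cancels the dimensions and bounds the coefficient. Restriction alone gives
  \<open>defect_le\<close> and induction alone \<open>defect_ge\<close>, once
  \<open>fact (k + l)\<close> is factored through the binomial coefficient and half its logarithm is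
  bounded by \<open>n * ln 2 / 2\<close>.\<close>

lemma
  assumes p: "p \<turnstile> k" and q: "q \<turnstile> l" and pos: "1 \<le> lr_coeff p q s"
  shows ln_lr_coeff_le: "ln (real_of_int (lr_coeff p q s)) \<le> ln (real (k + l choose k)) / 2"
    and defect_le: "defect s (k + l) \<le> lr_defect p q s (k + l) + defect p k + defect q l"
    and defect_ge: "defect p k + defect q l \<le> lr_defect p q s (k + l) + defect s (k + l)"
proof -
  have s: "s \<turnstile> k + l" using lr_coeff_partition[OF p q, of s] pos by simp
  let ?c = "real_of_int (lr_coeff p q s)" and ?B = "real (k + l choose k)"
  let ?p = "real (num_syt p)" and ?q = "real (num_syt q)" and ?s = "real (num_syt s)"
  have P: "0 < ?p" "0 < ?q" "0 < ?s" "0 < ?c" "0 < ?B"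
    using num_syt_pos[OF p] num_syt_pos[OF q] num_syt_pos[OF s] pos by auto
  have "real_of_int (lr_coeff p q s * int (num_syt p) * int (num_syt q)) \<le> real_of_int (int (num_syt s))"
    using lr_coeff_mult_num_syt_le(1)[OF p q s] by (simp only: of_int_le_iff)
  then have "?c * ?p * ?q \<le> ?s" by simp
  then have "ln (?c * ?p * ?q) \<le> ln ?s" using P by simp
  then have 1: "ln ?c + ln ?p + ln ?q \<le> ln ?s" using P by (simp add: ln_mult)
  have "real_of_int (lr_coeff p q s * int (num_syt s)) \<le> real_of_int (int ((k + l choose k) * (num_syt p * num_syt q)))"
    using lr_coeff_mult_num_syt_le(2)[OF p q s] by (simp only: of_int_le_iff)
  then have "?c * ?s \<le> ?B * (?p * ?q)" by simp
  then have "ln (?c * ?s) \<le> ln (?B * (?p * ?q))" using P by simp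
  then have 2: "ln ?c + ln ?s \<le> ln ?B + ln ?p + ln ?q" using P by (simp add: ln_mult)
  show "ln ?c \<le> ln ?B / 2" using 1 2 by simp
  have "(fact (k + l) :: real) = ?B * (fact k * fact l)"
    using binomial_fact_lemma[of k "k + l"] by (metis add_diff_cancel_left' le_add1 mult.commute of_nat_fact of_nat_mult)
  then have "ln (fact (k + l) :: real) = ln ?B + (ln (fact k) + ln (fact l))" using P(5) by (simp add: ln_mult)
  then show "defect s (k + l) \<le> lr_defect p q s (k + l) + defect p k + defect q l"
    "defect p k + defect q l \<le> lr_defect p q s (k + l) + defect s (k + l)"
    using 1 2 ln_binomial_le[of "k + l" k] by (simp_all add: defect_def lr_defect_def field_simps)
qed

lemma lr_defect_nonneg:
  assumes "p \<turnstile> k" "q \<turnstile> l" "1 \<le> lr_coeff p q s" shows "0 \<le> lr_defect p q s (k + l)"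
  using ln_lr_coeff_le[OF assms] ln_binomial_le[of "k + l" k] by (simp add: lr_defect_def)

text \<open>The coefficient is at most the root of a binomial coefficient exponentially smaller than
  \<open>2 ^ n\<close>; the constant is half the gap between \<open>ln 2\<close> and the rate in
  \<open>ln_binomial_unbalanced\<close>.\<close>

lemma lr_defect_unbalanced:
  assumes "p \<turnstile> k" "q \<turnstile> l" "1 \<le> lr_coeff p q s" "4 * k \<le> k + l \<or> 4 * l \<le> k + l"
  shows "real (k + l) * ((3 / 4 * ln 2 - ln (3/2)) / 2) \<le> lr_defect p q s (k + l)"
proof -
  have "k + l choose k = k + l choose l" using binomial_symmetric[of k "k + l"] by simp
  then have "ln (real (k + l choose k)) \<le> real (k + l) * (ln (3/2) + ln 2 / 4)"
    using assms(4) ln_binomial_unbalanced[of k "k + l"] ln_binomial_unbalanced[of l "k + l"] by auto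
  then show ?thesis using ln_lr_coeff_le[OF assms(1-3)] by (simp add: lr_defect_def field_simps)
qed

text \<open>The factor 4 is the square in \<open>lr_coeff_descent\<close> times the 2 in
  \<open>ln_card_partitions_upto\<close>.\<close>

lemma lr_defect_descent:
  assumes p: "p \<turnstile> k" and q: "q \<turnstile> l" and pos: "1 \<le> lr_coeff p q s"
  obtains a b c d i j i' j' where "a \<turnstile> i" "b \<turnstile> j" "i + j = k" "c \<turnstile> i'" "d \<turnstile> j'" "i' + j' = l"
    "1 \<le> lr_coeff a b p" "1 \<le> lr_coeff c d q"
    "lr_defect a b p k + lr_defect c d q l \<le>
      lr_defect p q s (k + l) + 4 * ((sqrt (real (k + l)) + 1) * ln (real (k + l) + 1))"
proof -
  let ?n = "card (partitions_upto (k + l))"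
  obtain a b c d i j i' j' where *: "a \<turnstile> i" "b \<turnstile> j" "i + j = k" "c \<turnstile> i'" "d \<turnstile> j'" "i' + j' = l"
    "1 \<le> lr_coeff a b p" "1 \<le> lr_coeff c d q"
    "lr_coeff p q s \<le> int (?n ^ 2) * (lr_coeff a b p * lr_coeff c d q)"
    by (rule lr_coeff_descent[OF p q pos])
  have n: "0 < real ?n" using partitions_uptoI[OF Nil_partition, of "k + l"] by (auto simp: card_gt_0_iff)
  have "real_of_int (lr_coeff p q s) \<le> real_of_int (int (?n ^ 2) * (lr_coeff a b p * lr_coeff c d q))"
    using *(9) by (simp only: of_int_le_iff)
  also have "\<dots> = real ?n ^ 2 * (real_of_int (lr_coeff a b p) * real_of_int (lr_coeff c d q))" by simp
  finally have "ln (real_of_int (lr_coeff p q s)) \<le> ln (real ?n ^ 2 * (real_of_int (lr_coeff a b p) * real_of_int (lr_coeff c d q)))"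
    using pos by simp
  also have "\<dots> = 2 * ln (real ?n) + (ln (real_of_int (lr_coeff a b p)) + ln (real_of_int (lr_coeff c d q)))"
    using n *(7,8) partitions_uptoI[OF Nil_partition, of "k + l"] by (auto simp: ln_mult ln_realpow)
  finally have "lr_defect a b p k + lr_defect c d q l \<le> lr_defect p q s (k + l) + 2 * ln (real ?n)"
    by (simp add: lr_defect_def field_simps)
  also have "\<dots> \<le> lr_defect p q s (k + l) + 4 * ((sqrt (real (k + l)) + 1) * ln (real (k + l) + 1))"
    using ln_card_partitions_upto[of "k + l"] by (simp only: mult.assoc)
  finally show ?thesis using that *(1-8) by blast
qed

text \<open>Amounts to \<open>(3/2) ^ 4 = 81/16 < 8\<close>.\<close>

lemma unbalanced_constant_pos: "0 < 3 / 4 * ln 2 - ln (3/2 :: real)"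
proof -
  have "4 * ln (3/2 :: real) = ln ((3/2) ^ 4)" by (simp add: ln_realpow)
  also have "\<dots> < ln (2 ^ 3)" by (subst ln_less_cancel_iff) (auto simp: power_divide)
  also have "\<dots> = 3 * ln (2 :: real)" using ln_realpow[of 2 3] by simp
  finally show ?thesis by simp
qed

text \<open>In the induction the term \<open>- E * n powr (3/4)\<close>, which gains under balanced splitting,
  absorbs the errors \<open>sqrt n * (ln n)\<^sup>2\<close> that stem from the number of partitions. Splittings more
  unbalanced than 1:3 have a linear deficiency, for which the trivial bound suffices.\<close>

lemma defect_bound:
  obtains A B where "0 \<le> A" "0 \<le> B"
    "\<And>p q s k l. p \<turnstile> k \<Longrightarrow> q \<turnstile> l \<Longrightarrow> 1 \<le> lr_coeff p q s \<Longrightarrow>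
      defect s (k + l) \<le> A * real (k + l) + B * lr_defect p q s (k + l) * ln (real (k + l))"
proof -
  define c0 where "c0 = (3 / 4 * ln 2 - ln (3/2 :: real)) / 2"
  define g where "g = ln (4/3 :: real)"
  define \<kappa> where "\<kappa> = (4/3 :: real) powr (1/4) - 1"
  \<comment> \<open>The first bound makes \<open>B\<close> times an unbalanced deficiency at least
    \<open>n / 2\<close>. The second makes the drop \<open>g\<close> of the logarithm, times
    \<open>B\<close>, at least 1, which pays for the deficiency charged at one level.\<close>
  define B where "B = max (1 / (2 * c0)) (1 / g)"
  obtain E0 where E0: "0 \<le> E0" "\<And>n. (sqrt (real n) + 1) * ln (real n + 1) * ln (real n) \<le> E0 * real n powr (3/4)"
    using error_growth by blast
  \<comment> \<open>Chosen so that the gain \<open>E * \<kappa> * n powr (3/4)\<close> of one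
    balanced splitting equals the bound on the partition-count error of that level.\<close>
  define E where "E = 4 * B * E0 / \<kappa>"
  have c0: "0 < c0" using unbalanced_constant_pos by (simp add: c0_def)
  have g: "0 < g" by (simp add: g_def)
  have \<kappa>: "0 < \<kappa>" by (simp add: \<kappa>_def gr_one_powr)
  have B: "0 < B" "1 / 2 \<le> B * c0" "1 \<le> B * g"
  proof -
    have "1 / (2 * c0) \<le> B" "1 / g \<le> B" by (simp_all add: B_def)
    then show "1 / 2 \<le> B * c0" "1 \<le> B * g" using c0 g by (simp_all add: field_simps)
    show "0 < B" using c0 by (simp add: B_def less_max_iff_disj)
  qed
  have E: "0 \<le> E" using B(1) E0(1) \<kappa> by (simp add: E_def)
  have powr_le: "real n powr (3/4) \<le> real n" for n
  proof (cases "n = 0")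
    case False
    then have "real n powr (3/4) \<le> real n powr 1" by (intro powr_mono) auto
    then show ?thesis by simp
  qed simp
  have main: "defect s n \<le> E * real n + B * lr_defect p q s n * ln (real n) - E * real n powr (3/4)"
    if "p \<turnstile> k" "q \<turnstile> l" "1 \<le> lr_coeff p q s" "n = k + l" for p q s k l n
    using that
  proof (induction n arbitrary: p q s k l rule: less_induct)
    case (less n)
    note p = less.prems(1) and q = less.prems(2) and pos = less.prems(3) and n = less.prems(4)
    let ?D = "lr_defect p q s n"
    have D: "0 \<le> ?D" using lr_defect_nonneg[OF p q pos] n by simp
    have s: "s \<turnstile> n" using lr_coeff_partition[OF p q, of s] pos n by simp
    show ?case
    \<comment> \<open>The unbalanced case includes \<open>k = 0\<close> and \<open>l = 0\<close>,
      hence every \<open>n\<close> up to 1, and so serves as the base of the induction; in the other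
      case both parts are smaller than \<open>n\<close>.\<close>
    proof (cases "4 * k \<le> n \<or> 4 * l \<le> n")
      case True
      have "defect s n \<le> B * ?D * ln (real n)"
      proof (cases "n = 0")
        case n0: False
        then have ln: "0 \<le> ln (real n)" by simp
        have "real n * c0 \<le> ?D" using lr_defect_unbalanced[OF p q pos] True n by (simp add: c0_def)
        then have "B * (real n * c0) \<le> B * ?D" using B(1) by simp
        moreover have "real n * (1/2) \<le> real n * (B * c0)" using B(2) by (intro mult_left_mono) auto
        ultimately have "real n / 2 \<le> B * ?D" by (simp add: mult_ac)
        from mult_right_mono[OF this ln] show ?thesis using defect_le_trivial[OF s] by simp
      qed (use defect_le_trivial[OF s] in simp)
      moreover have "0 \<le> E * (real n - real n powr (3/4))" using E powr_le[of n] by simp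
      ultimately show ?thesis by (simp add: algebra_simps)
    next
      case False
      then have kl: "0 < k" "0 < l" "k < n" "l < n" "4 * k \<le> 3 * n" "4 * l \<le> 3 * n" using n by auto
      let ?L = "(sqrt (real n) + 1) * ln (real n + 1)"
      obtain a b c d i j i' j' where *: "a \<turnstile> i" "b \<turnstile> j" "i + j = k" "c \<turnstile> i'" "d \<turnstile> j'" "i' + j' = l"
        "1 \<le> lr_coeff a b p" "1 \<le> lr_coeff c d q"
        "lr_defect a b p k + lr_defect c d q l \<le> ?D + 4 * ?L"
        using lr_defect_descent[OF p q pos] n by metis
      let ?D1 = "lr_defect a b p k" and ?D2 = "lr_defect c d q l"
      have D12: "0 \<le> ?D1" "0 \<le> ?D2"
        using lr_defect_nonneg[OF *(1,2,7)] lr_defect_nonneg[OF *(4,5,8)] *(3,6) by auto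
      have IH1: "defect p k \<le> E * real k + B * ?D1 * ln (real k) - E * real k powr (3/4)"
        using less.IH[OF kl(3) *(1,2,7)] *(3) by simp
      have IH2: "defect q l \<le> E * real l + B * ?D2 * ln (real l) - E * real l powr (3/4)"
        using less.IH[OF kl(4) *(4,5,8)] *(6) by simp
      \<comment> \<open>A balanced part has at most \<open>3/4 * n\<close> cells, so its logarithm
        is smaller by at least \<open>ln (4/3)\<close>.\<close>
      have lnle: "ln (real m) \<le> ln (real n) - g" if "0 < m" "4 * m \<le> 3 * n" for m
      proof -
        have "real m \<le> 3 / 4 * real n" using that(2) by linarith
        then have "ln (real m) \<le> ln (3 / 4 * real n)" using that by simp
        also have "\<dots> = ln (real n / (4/3))" by (simp add: mult.commute)
        also have "\<dots> = ln (real n) - g" unfolding g_def using kl by (intro ln_divide_pos) auto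
        finally show ?thesis .
      qed
      have lng: "0 \<le> ln (real n) - g" using lnle[OF kl(1,5)] kl(1) by (smt (verit) ln_ge_zero of_nat_0_less_iff of_nat_1 of_nat_le_iff Suc_leI One_nat_def)
      have L: "0 \<le> ?L" by simp
      have "?D1 * ln (real k) + ?D2 * ln (real l) \<le> ?D1 * (ln (real n) - g) + ?D2 * (ln (real n) - g)"
        using D12 lnle kl by (intro add_mono mult_left_mono) auto
      also have "\<dots> = (?D1 + ?D2) * (ln (real n) - g)" by (simp add: distrib_right)
      also have "\<dots> \<le> (?D + 4 * ?L) * (ln (real n) - g)" using *(9) lng by (rule mult_right_mono)
      also have "\<dots> = ?D * (ln (real n) - g) + 4 * ?L * (ln (real n) - g)" by (simp add: distrib_right)
      also have "\<dots> \<le> ?D * (ln (real n) - g) + 4 * ?L * ln (real n)"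
        using L g by (intro add_left_mono mult_left_mono) auto
      finally have "B * (?D1 * ln (real k) + ?D2 * ln (real l)) \<le> B * (?D * (ln (real n) - g) + 4 * ?L * ln (real n))"
        using B(1) by simp
      also have "\<dots> = B * ?D * ln (real n) - ?D * (B * g) + 4 * B * (?L * ln (real n))" by (simp add: algebra_simps)
      \<comment> \<open>The term \<open>- ?D\<close> won here cancels the \<open>?D\<close> that
        \<open>defect_le\<close> adds at the end.\<close>
      also have "\<dots> \<le> B * ?D * ln (real n) - ?D * 1 + 4 * B * (E0 * real n powr (3/4))"
        using D B E0(2)[of n] by (intro add_mono diff_left_mono mult_left_mono diff_mono) auto
      also have "4 * B * (E0 * real n powr (3/4)) = E * \<kappa> * real n powr (3/4)"
        using \<kappa> by (simp add: E_def)
      finally have step: "B * (?D1 * ln (real k) + ?D2 * ln (real l)) \<le> B * ?D * ln (real n) - ?D + E * \<kappa> * real n powr (3/4)"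
        by simp
      have "E * ((1 + \<kappa>) * real n powr (3/4)) \<le> E * (real k powr (3/4) + real l powr (3/4))"
      proof (rule mult_left_mono[OF _ E])
        have "real k \<le> 3 / 4 * real n" "real l \<le> 3 / 4 * real n" using kl(5,6) by linarith+
        then show "(1 + \<kappa>) * real n powr (3/4) \<le> real k powr (3/4) + real l powr (3/4)"
          using powr_split_gain[of "real k" "real l" "real n"] kl(1,2) n by (simp add: \<kappa>_def)
      qed
      then have gain: "E * real n powr (3/4) + E * \<kappa> * real n powr (3/4) \<le> E * real k powr (3/4) + E * real l powr (3/4)"
        by (simp add: algebra_simps)
      have En: "E * real n = E * real k + E * real l" using n by (simp add: algebra_simps)
      have Bs: "B * (?D1 * ln (real k) + ?D2 * ln (real l)) = B * ?D1 * ln (real k) + B * ?D2 * ln (real l)"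
        by (simp add: algebra_simps)
      have "defect s n \<le> ?D + defect p k + defect q l" using defect_le[OF p q pos] n by simp
      then show ?thesis using IH1 IH2 step gain En Bs by linarith
    qed
  qed
  show ?thesis
  proof (rule that[of E B])
    fix p q s k l assume "p \<turnstile> k" "q \<turnstile> l" "1 \<le> lr_coeff p q s"
    from main[OF this refl] show "defect s (k + l) \<le> E * real (k + l) + B * lr_defect p q s (k + l) * ln (real (k + l))"
      using E by (smt (verit) mult_nonneg_nonneg powr_ge_zero)
  qed (use E B in auto)
qed

text \<open>Only the lower bound carries information; the upper one is the sum-of-squares bound
  contained in \<open>defect_nonneg\<close>.\<close>

lemma eq_up_to_exp_num_syt:
  assumes p: "\<And>n. p n \<turnstile> m n" and K: "0 < K" and ev: "\<forall>\<^sub>F n in sequentially. defect (p n) (m n) \<le> K * real n"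
  shows "eq_up_to_exp (\<lambda>n. real (num_syt (p n))) (\<lambda>n. sqrt (fact (m n))) (\<lambda>n. real n)"
  unfolding eq_up_to_exp_def
proof (intro exI conjI)
  show "\<forall>\<^sub>F n in sequentially. sqrt (fact (m n)) * exp (- K * real n) \<le> real (num_syt (p n)) \<and>
      real (num_syt (p n)) \<le> sqrt (fact (m n)) * exp (K * real n)"
    using ev
  proof eventually_elim
    case (elim n)
    have pos: "0 < real (num_syt (p n))" using num_syt_pos[OF p[of n]] by simp
    have e: "real (num_syt (p n)) = sqrt (fact (m n)) * exp (- defect (p n) (m n))"
    proof -
      have "sqrt (fact (m n)) = exp (ln (fact (m n)) / 2)"
        by (simp add: ln_sqrt[symmetric])
      then show ?thesis using pos by (simp add: defect_def mult_exp_exp)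
    qed
    have "- K * real n \<le> - defect (p n) (m n)" "- defect (p n) (m n) \<le> K * real n"
      using elim defect_nonneg[OF p[of n]] by simp_all
    then show ?case unfolding e by (intro conjI mult_left_mono) auto
  qed
qed (rule K)

theorem theorem1p7:
  fixes lam mu nu :: "nat \<Rightarrow> nat list"
  assumes "\<And>n. lam n \<turnstile> n" and "\<And>n. mu n \<turnstile> n div 2" and "\<And>n. nu n \<turnstile> n - n div 2"
    and "eq_up_to_exp (\<lambda>n. real_of_int (lr_coeff (mu n) (nu n) (lam n)))
           (\<lambda>n. sqrt (real (n choose (n div 2)))) (\<lambda>n. real n / ln (real n))"
  shows "eq_up_to_exp (\<lambda>n. real (num_syt (lam n))) (\<lambda>n. sqrt (fact n)) (\<lambda>n. real n) \<and>
    eq_up_to_exp (\<lambda>n. real (num_syt (mu n))) (\<lambda>n. sqrt (fact (n div 2))) (\<lambda>n. real n) \<and>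
    eq_up_to_exp (\<lambda>n. real (num_syt (nu n))) (\<lambda>n. sqrt (fact (n - n div 2))) (\<lambda>n. real n)"
proof -
  obtain A B where AB: "0 \<le> A" "0 \<le> B"
    "\<And>p q s k l. p \<turnstile> k \<Longrightarrow> q \<turnstile> l \<Longrightarrow> 1 \<le> lr_coeff p q s \<Longrightarrow>
      defect s (k + l) \<le> A * real (k + l) + B * lr_defect p q s (k + l) * ln (real (k + l))"
    using defect_bound by blast
  obtain C where C: "0 < C" "\<forall>\<^sub>F n in sequentially.
     sqrt (real (n choose (n div 2))) * exp (- C * (real n / ln (real n))) \<le> real_of_int (lr_coeff (mu n) (nu n) (lam n)) \<and>
     real_of_int (lr_coeff (mu n) (nu n) (lam n)) \<le> sqrt (real (n choose (n div 2))) * exp (C * (real n / ln (real n)))"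
    using assms(4) unfolding eq_up_to_exp_def by blast
  \<comment> \<open>In \<open>C + 1\<close> the 1 covers the logarithmic loss of passing from the
    binomial coefficient to \<open>2 ^ n\<close>. The last summand pays for the deficiency that
    \<open>defect_ge\<close> adds for \<open>mu\<close> and \<open>nu\<close>.\<close>
  define K where "K = A + B * (C + 1) + (C + 1)"
  have K: "0 < K" unfolding K_def using AB C(1) by (intro add_nonneg_pos add_nonneg_nonneg mult_nonneg_nonneg) auto
  have log: "\<forall>\<^sub>F n in sequentially. ln (real n + 1) * ln (real n) / 2 \<le> real n"
    by real_asymp
  have ge3: "\<forall>\<^sub>F n in sequentially. 3 \<le> n" by (rule eventually_ge_at_top)
  have "\<forall>\<^sub>F n in sequentially. defect (lam n) n \<le> K * real n \<and>
      defect (mu n) (n div 2) \<le> K * real n \<and> defect (nu n) (n - n div 2) \<le> K * real n"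
    using C(2) log ge3
  proof eventually_elim
    case (elim n)
    let ?c = "real_of_int (lr_coeff (mu n) (nu n) (lam n))" and ?D = "lr_defect (mu n) (nu n) (lam n) n"
    have n: "n div 2 + (n - n div 2) = n" by simp
    have ln1: "1 \<le> ln (real n)"
    proof -
      have "exp 1 \<le> real n" using exp_le elim(3) by linarith
      then show ?thesis using elim(3) by (subst ln_ge_iff) auto
    qed
    have b: "0 < real (n choose (n div 2))" by simp
    have "0 < sqrt (real (n choose (n div 2))) * exp (- C * (real n / ln (real n)))"
      using b by simp
    then have "0 < ?c" using elim(1) by linarith
    \<comment> \<open>The lower bound of the hypothesis is positive, and a positive integer is at
      least 1.\<close>
    then have pos: "1 \<le> lr_coeff (mu n) (nu n) (lam n)" by linarith
    have aux: "ln (sqrt x * exp y) = ln x / 2 + y" if "0 < x" for x y :: real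
      using that by (simp add: ln_mult ln_sqrt)
    have "ln (sqrt (real (n choose (n div 2))) * exp (- C * (real n / ln (real n)))) \<le> ln ?c"
      using elim(1) b \<open>0 < ?c\<close> by (subst ln_le_cancel_iff) auto
    then have c: "ln (real (n choose (n div 2))) / 2 - C * (real n / ln (real n)) \<le> ln ?c"
      unfolding aux[OF b] by simp
    have "real (2 ^ n) \<le> real ((n + 1) * (n choose (n div 2)))"
      using two_power_le_central_binomial[of n] by (simp only: of_nat_le_iff)
    then have "2 ^ n \<le> (real n + 1) * real (n choose (n div 2))" by (simp add: algebra_simps)
    then have "ln (2 ^ n :: real) \<le> ln ((real n + 1) * real (n choose (n div 2)))"
      using b by (subst ln_le_cancel_iff) auto
    also have "\<dots> = ln (real n + 1) + ln (real (n choose (n div 2)))"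
      by (rule ln_mult_pos[OF _ b]) simp
    finally have "real n * ln 2 \<le> ln (real n + 1) + ln (real (n choose (n div 2)))"
      by (simp add: ln_realpow)
    then have "?D \<le> ln (real n + 1) / 2 + C * (real n / ln (real n))"
      using c by (simp add: lr_defect_def)
    \<comment> \<open>This is where the rate \<open>n / ln n\<close> of the hypothesis matters: the
      factor \<open>ln n\<close> lost in \<open>defect_bound\<close> turns it into
      \<open>n\<close>.\<close>
    then have "?D * ln (real n) \<le> (ln (real n + 1) / 2 + C * (real n / ln (real n))) * ln (real n)"
      using ln1 by (intro mult_right_mono) auto
    also have "\<dots> = ln (real n + 1) * ln (real n) / 2 + C * real n"
      using ln1 by (simp add: field_simps)
    also have "\<dots> \<le> (C + 1) * real n" using elim(2) by (simp add: algebra_simps)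
    finally have DL: "?D * ln (real n) \<le> (C + 1) * real n" .
    have D0: "0 \<le> ?D" using lr_defect_nonneg[OF assms(2,3) pos] n by simp
    have Dn: "?D \<le> (C + 1) * real n"
      using mult_left_mono[OF ln1 D0] DL by simp
    have "defect (lam n) n \<le> A * real n + B * (?D * ln (real n))"
      using AB(3)[OF assms(2,3) pos] n by (simp add: mult.assoc)
    also have "\<dots> \<le> A * real n + B * ((C + 1) * real n)"
      using DL AB(2) by (intro add_left_mono mult_left_mono)
    finally have l: "defect (lam n) n \<le> (A + B * (C + 1)) * real n" by (simp add: algebra_simps)
    \<comment> \<open>Once \<open>lam\<close> is settled, the induction inequality passes the bound
      down in one step; as both defects are nonnegative, each is bounded by the sum.\<close>
    have "defect (mu n) (n div 2) + defect (nu n) (n - n div 2) \<le> ?D + defect (lam n) n"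
      using defect_ge[OF assms(2,3) pos] n by simp
    also have "\<dots> \<le> K * real n" using l Dn by (simp add: K_def algebra_simps)
    finally have mn: "defect (mu n) (n div 2) + defect (nu n) (n - n div 2) \<le> K * real n" .
    have "(A + B * (C + 1)) * real n \<le> K * real n" using C(1) by (intro mult_right_mono) (auto simp: K_def)
    then show ?case
      using l mn defect_nonneg[OF assms(2), of n] defect_nonneg[OF assms(3), of n] by auto
  qed
  then have ev: "\<forall>\<^sub>F n in sequentially. defect (lam n) n \<le> K * real n"
    "\<forall>\<^sub>F n in sequentially. defect (mu n) (n div 2) \<le> K * real n"
    "\<forall>\<^sub>F n in sequentially. defect (nu n) (n - n div 2) \<le> K * real n"
    by (auto elim: eventually_mono)
  show ?thesis
    using eq_up_to_exp_num_syt[OF assms(1) K ev(1)] eq_up_to_exp_num_syt[OF assms(2) K ev(2)]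
      eq_up_to_exp_num_syt[OF assms(3) K ev(3)] by blast
qed

end
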